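(* Let $\lambda>0$ and let $\beta\in\mathbb{R}$ satisfy $0<\beta^2<4\pi$. Then the sequence $\{\rho_{\mathrm{heat},N}\}_{N\in\mathbb{N}}$ of renormalized truncated Gibbs measures $$d\rho_{\mathrm{heat},N}=Z_N^{-1}\exp\Big(-\lambda C_N\int_{\mathbb{T}^2}e^{\beta\,\mathbf{Q}_Nu}\,dx\Big)d\mu_1$$ converges in total variation to some limiting probability measure $\rho_{\mathrm{heat}}$. Moreover, $\rho_{\mathrm{heat}}$ and the massive Gaussian free field $\mu_1$ are mutually absolutely continuous.
   Context: $\mathbb{T}^2=(\mathbb{R}/2\pi\mathbb{Z})^2\simeq[-\pi,\pi)^2$, $e_n(x)=\frac1{2\pi}e^{in\cdot x}$, $\widehat f(n)$ denotes the coefficient of $f$ in the orthonormal basis $\{e_n\}$, $\langle n\rangle=\sqrt{1+|n|^2}$. $\mu_1$ is the massive Gaussian free field on $\mathcal{D}'(\mathbb{T}^2)$, formally $Z^{-1}e^{-\frac12\|u\|_{H^1}^2}du$; it is the law of $w_0=\sum_{n\in\mathbb{Z}^2}\frac{g_n}{\langle n\rangle}e_n$, where $\{g_n\}$ are mutually independent standard complex Gaussian random variables conditioned so that $g_{-n}=\overline{g_n}$ ($g_0$ real standard Gaussian). $\rho$ is a smooth, non-negative, even function compactly supported in $[-\pi,\pi)^2$ with $\int\rho\,dx=1$; $\rho_N(x)=N^2\rho(Nx)$; $\mathbf{Q}_Nf=\rho_N*f=\sum_{n}2\pi\widehat\rho_N(n)\widehat f(n)e_n$. The renormalization constant is $C_N=e^{-\frac{\beta^2}2\sigma_N}$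 with $\sigma_N=\frac1{4\pi^2}\sum_{n\in\mathbb{Z}^2}\frac{(2\pi\widehat\rho_N(n))^2}{\langle n\rangle^2}$, and $Z_N$ is the normalizing constant making $\rho_{\mathrm{heat},N}$ a probability measure. *)

theory Defs
  imports "HOL-Probability.Probability"
begin

text \<open>
  Functions on the torus are functions on the plane that are \<open>2 * pi\<close>-periodic in each variable;
  integrals over the torus are integrals over the fundamental cell.
\<close>

definition torus_cell :: "(real \<times> real) set" where
  "torus_cell = {-pi..<pi} \<times> {-pi..<pi}"

definition freq :: "int \<times> int \<Rightarrow> real \<times> real" where
  "freq n = (real_of_int (fst n), real_of_int (snd n))"

definition jbracket :: "int \<times> int \<Rightarrow> real" where
  "jbracket n = sqrt (1 + (norm (freq n))\<^sup>2)"

definition ebasis :: "int \<times> int \<Rightarrow> real \<times> real \<Rightarrow> complex" where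
  "ebasis n x = exp (\<i> * of_real (freq n \<bullet> x)) / of_real (2 * pi)"

definition fourier_coeff :: "(real \<times> real \<Rightarrow> real) \<Rightarrow> int \<times> int \<Rightarrow> complex" where
  "fourier_coeff f n = (LINT x:torus_cell|lborel. of_real (f x) * cnj (ebasis n x))"

primrec iter_partial :: "'a::euclidean_space list \<Rightarrow> ('a \<Rightarrow> real) \<Rightarrow> 'a \<Rightarrow> real" where
  "iter_partial [] f = f"
| "iter_partial (b # bs) f = (\<lambda>x. frechet_derivative (iter_partial bs f) (at x) b)"

text \<open>
  Infinitely differentiable: all iterated partial derivatives exist and are differentiable (hence
  continuous) everywhere.
\<close>

definition smooth_fun :: "('a::euclidean_space \<Rightarrow> real) \<Rightarrow> bool" where
  "smooth_fun f \<longleftrightarrow>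
     (\<forall>bs. set bs \<subseteq> Basis \<longrightarrow> (\<forall>x. iter_partial bs f differentiable (at x)))"

definition torus_periodic :: "(real \<times> real \<Rightarrow> 'b) \<Rightarrow> bool" where
  "torus_periodic f \<longleftrightarrow> (\<forall>x y. f (x + 2 * pi, y) = f (x, y) \<and> f (x, y + 2 * pi) = f (x, y))"

definition torus_test :: "(real \<times> real \<Rightarrow> real) set" where
  "torus_test = {\<phi>. smooth_fun \<phi> \<and> torus_periodic \<phi>}"

definition Ck_norm :: "nat \<Rightarrow> (real \<times> real \<Rightarrow> real) \<Rightarrow> real" where
  "Ck_norm k \<phi> =
     (SUP (bs, x) \<in> {bs. set bs \<subseteq> Basis \<and> length bs \<le> k} \<times> UNIV. \<bar>iter_partial bs \<phi> x\<bar>)"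

text \<open>
  Real-valued distributions on the torus: the linear functionals on the test functions that are
  continuous for the Frechet topology given by the norms \<open>Ck_norm k\<close>.  They are made \<open>extensional\<close>,
  so that a distribution is determined by its values on test functions.
\<close>

definition torus_distributions :: "((real \<times> real \<Rightarrow> real) \<Rightarrow> real) set" where
  "torus_distributions =
     {u \<in> extensional torus_test.
        (\<forall>\<phi>\<in>torus_test. \<forall>\<psi>\<in>torus_test. \<forall>a b.
            u (\<lambda>x. a * \<phi> x + b * \<psi> x) = a * u \<phi> + b * u \<psi>) \<and>
        (\<exists>C k. \<forall>\<phi>\<in>torus_test. \<bar>u \<phi>\<bar> \<le> C * Ck_norm k \<phi>)}"

text \<open>
  The measurable structure on distributions is the cylinder sigma-algebra, generated by the
  evaluations at test functions; it is the Borel sigma-algebra of both the weak-* and the strong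
  topology.
\<close>

definition distribution_space :: "((real \<times> real \<Rightarrow> real) \<Rightarrow> real) measure" where
  "distribution_space = restrict_space (PiM torus_test (\<lambda>_. borel)) torus_distributions"

text \<open>
  A set of representatives of the frequencies modulo \<open>n \<mapsto> - n\<close>.
\<close>

definition half_lattice :: "(int \<times> int) set" where
  "half_lattice = {n. fst n > 0 \<or> (fst n = 0 \<and> snd n \<ge> 0)}"

text \<open>
  Standard complex Gaussians \<open>g n\<close> that are mutually independent up to the constraint
  \<open>g (- n) = cnj (g n)\<close>.  A standard complex Gaussian has density \<open>exp (- \<bar>z\<bar>\<^sup>2) / pi\<close>, so that its
  expected squared modulus is one.  By the constraint, \<open>g 0\<close> is almost surely real.
\<close>

definition gaussian_family :: "'a measure \<Rightarrow> (int \<times> int \<Rightarrow> 'a \<Rightarrow> complex) \<Rightarrow> bool" where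
  "gaussian_family M g \<longleftrightarrow>
     prob_space M \<and>
     prob_space.indep_vars M (\<lambda>_. borel) g half_lattice \<and>
     (\<forall>n. g n \<in> borel_measurable M) \<and>
     (\<forall>n. AE \<omega> in M. g (- n) \<omega> = cnj (g n \<omega>)) \<and>
     (\<forall>n. n \<noteq> 0 \<longrightarrow> distributed M lborel (g n) (\<lambda>z. ennreal (exp (- (norm z)\<^sup>2) / pi))) \<and>
     distributed M lborel (\<lambda>\<omega>. Re (g 0 \<omega>)) (\<lambda>t. ennreal (std_normal_density t))"

text \<open>
  \<open>fourier_series_to c u\<close>: the series of the \<open>c n * ebasis n\<close> converges to \<open>u\<close> in the sense of
  distributions.
\<close>

definition fourier_series_to ::
    "(int \<times> int \<Rightarrow> complex) \<Rightarrow> ((real \<times> real \<Rightarrow> real) \<Rightarrow> real) \<Rightarrow> bool" where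
  "fourier_series_to c u \<longleftrightarrow>
     (\<forall>\<phi>\<in>torus_test.
        ((\<lambda>n. c n * (LINT x:torus_cell|lborel. ebasis n x * of_real (\<phi> x)))
           has_sum of_real (u \<phi>)) UNIV)"

text \<open>
  The random distribution \<open>\<Sum>n. g n / jbracket n * ebasis n\<close>.  The series converges almost surely;
  on the exceptional null set the value is the zero distribution.
\<close>

definition gff_series ::
    "(int \<times> int \<Rightarrow> 'a \<Rightarrow> complex) \<Rightarrow> 'a \<Rightarrow> (real \<times> real \<Rightarrow> real) \<Rightarrow> real" where
  "gff_series g \<omega> =
     (let c = (\<lambda>n. g n \<omega> / of_real (jbracket n)) in
      if \<exists>u\<in>torus_distributions. fourier_series_to c u
      then THE u. u \<in> torus_distributions \<and> fourier_series_to c u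
      else (\<lambda>\<phi>\<in>torus_test. 0))"

definition massive_gff ::
    "'a measure \<Rightarrow> (int \<times> int \<Rightarrow> 'a \<Rightarrow> complex) \<Rightarrow> ((real \<times> real \<Rightarrow> real) \<Rightarrow> real) measure" where
  "massive_gff M g = distr M distribution_space (gff_series g)"

definition mollifier_profile :: "(real \<times> real \<Rightarrow> real) \<Rightarrow> bool" where
  "mollifier_profile \<rho> \<longleftrightarrow>
     smooth_fun \<rho> \<and> (\<forall>x. \<rho> x \<ge> 0) \<and> (\<forall>x. \<rho> (- x) = \<rho> x) \<and>
     compact (closure {x. \<rho> x \<noteq> 0}) \<and> closure {x. \<rho> x \<noteq> 0} \<subseteq> torus_cell \<and>
     (LINT x|lborel. \<rho> x) = 1"

definition wrap :: "real \<Rightarrow> real" where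
  "wrap t = t - 2 * pi * of_int \<lfloor>(t + pi) / (2 * pi)\<rfloor>"

text \<open>
  \<open>mollifier \<rho> N\<close> is \<open>N\<^sup>2 \<rho>(N x)\<close> on the cell, extended periodically (\<open>wrap\<close> is the representative
  modulo \<open>2 * pi\<close> in \<open>[-pi, pi)\<close>).
\<close>

definition mollifier :: "(real \<times> real \<Rightarrow> real) \<Rightarrow> nat \<Rightarrow> real \<times> real \<Rightarrow> real" where
  "mollifier \<rho> N x = (real N)\<^sup>2 * \<rho> (real N *\<^sub>R (wrap (fst x), wrap (snd x)))"

definition mollify ::
    "(real \<times> real \<Rightarrow> real) \<Rightarrow> nat \<Rightarrow> ((real \<times> real \<Rightarrow> real) \<Rightarrow> real) \<Rightarrow> real \<times> real \<Rightarrow> real" where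
  "mollify \<rho> N u x = u (\<lambda>y. mollifier \<rho> N (x - y))"

text \<open>
  The Fourier coefficients of \<open>mollifier \<rho> N\<close> are real because \<open>\<rho>\<close> is even.
\<close>

definition sigma_N :: "(real \<times> real \<Rightarrow> real) \<Rightarrow> nat \<Rightarrow> real" where
  "sigma_N \<rho> N =
     1 / (4 * pi\<^sup>2) *
     (\<Sum>\<^sub>\<infinity>n\<in>UNIV. (2 * pi * Re (fourier_coeff (mollifier \<rho> N) n))\<^sup>2 / (jbracket n)\<^sup>2)"

definition C_N :: "(real \<times> real \<Rightarrow> real) \<Rightarrow> real \<Rightarrow> nat \<Rightarrow> real" where
  "C_N \<rho> \<beta> N = exp (- (\<beta>\<^sup>2 / 2) * sigma_N \<rho> N)"

definition gibbs_weight ::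
    "(real \<times> real \<Rightarrow> real) \<Rightarrow> real \<Rightarrow> real \<Rightarrow> nat \<Rightarrow> ((real \<times> real \<Rightarrow> real) \<Rightarrow> real) \<Rightarrow> real" where
  "gibbs_weight \<rho> lam \<beta> N u =
     exp (- lam * C_N \<rho> \<beta> N * (LINT x:torus_cell|lborel. exp (\<beta> * mollify \<rho> N u x)))"

definition Z_N ::
    "((real \<times> real \<Rightarrow> real) \<Rightarrow> real) measure \<Rightarrow> (real \<times> real \<Rightarrow> real) \<Rightarrow> real \<Rightarrow> real \<Rightarrow> nat \<Rightarrow> real" where
  "Z_N \<mu> \<rho> lam \<beta> N = (LINT u|\<mu>. gibbs_weight \<rho> lam \<beta> N u)"

definition rho_heat_N ::
    "((real \<times> real \<Rightarrow> real) \<Rightarrow> real) measure \<Rightarrow> (real \<times> real \<Rightarrow> real) \<Rightarrow> real \<Rightarrow> real \<Rightarrow> nat \<Rightarrow>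
     ((real \<times> real \<Rightarrow> real) \<Rightarrow> real) measure" where
  "rho_heat_N \<mu> \<rho> lam \<beta> N =
     density \<mu> (\<lambda>u. ennreal (inverse (Z_N \<mu> \<rho> lam \<beta> N) * gibbs_weight \<rho> lam \<beta> N u))"

text \<open>
  For finite measures on the same sigma-algebra; normalised so that probability measures are at
  distance at most one.
\<close>

definition tv_dist :: "'b measure \<Rightarrow> 'b measure \<Rightarrow> real" where
  "tv_dist \<mu> \<nu> = (SUP A\<in>sets \<mu>. \<bar>measure \<mu> A - measure \<nu> A\<bar>)"

end

theory Submission imports Defs begin

text \<open>
  Write \<open>Y\<^sub>N\<close> for the renormalized mass \<open>C\<^sub>N \<integral> exp (\<beta> Q\<^sub>N u)\<close>.  For \<open>\<beta>\<^sup>2 < 4\<pi>\<close> everything happens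
  in \<open>L\<^sup>2\<close>: the Gaussian moment generating function gives \<open>E[Y\<^sub>N Y\<^sub>M] = 4\<pi>\<^sup>2 \<integral> exp (\<beta>\<^sup>2 K\<^sub>N\<^sub>M)\<close>, where
  \<open>K\<^sub>N\<^sub>M\<close> is the Green function of \<open>1 - \<Delta>\<close> convolved with both mollifiers.  The kernels
  \<open>K\<^sub>N\<^sub>M\<close> are Cauchy in \<open>L\<^sup>1\<close> by Parseval, so \<open>(Y\<^sub>N)\<close> is Cauchy in \<open>L\<^sup>2\<close> as soon as
  \<open>\<integral> exp (\<gamma> K\<^sub>N\<^sub>M)\<close> is bounded for some \<open>\<gamma> > \<beta>\<^sup>2\<close>.

  For this bound, no asymptotics of the Green function are needed.  Up to an absolutely summable
  error, its Fourier coefficients are those of the periodic convolution in \<open>y\<close> of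
  \<open>- log \<bar>1 - exp (i x - \<bar>s\<bar>)\<bar>\<close> with a point mass; regularizing by \<open>q\<^bsup>\<bar>n\<^sub>1\<bar> + \<bar>n\<^sub>2\<bar>\<^esup>\<close> replaces the point mass
  by a Poisson kernel.  Convolution with a probability density on the torus does not increase
  \<open>\<integral> exp\<close>, by Jensen, so mollifiers and Poisson kernel can be dropped, and
  \<open>\<bar>1 - q exp (i x - \<bar>s\<bar>)\<bar>\<close> is bounded below by a multiple of \<open>max \<bar>x\<bar> \<bar>s\<bar> \<ge> (\<bar>x\<bar> \<bar>s\<bar>)\<^bsup>1/2\<^esup>\<close>, whence
  an integrable singularity exactly when \<open>\<gamma> < 4\<pi>\<close>.

  Finally the weights \<open>exp (- \<lambda> Y\<^sub>N)\<close> lie in \<open>[0, 1]\<close> and converge in \<open>L\<^sup>1\<close> to \<open>exp (- \<lambda> Y)\<close> with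
  \<open>Y\<close> finite almost surely; the limiting density is thus positive almost everywhere.
\<close>

section \<open>Test functions\<close>

text \<open>The threshold: each basis function carries a factor 1/(2 pi), so the covariance behaves
  like - log |z| / (2 pi) near 0 and exp (gamma K) like |z| to the power - gamma / (2 pi),
  integrable in the plane iff gamma < 4 pi. Passing from the maximum to the geometric mean keeps
  this threshold and splits the integral into two one-dimensional ones.

  The obstacle is uniformity in two independent mollification scales. The multipliers of a mollifier
  may change sign, so kernels cannot be compared coefficient by coefficient; convolution with a
  nonnegative density, however, is exactly what Jensen handles.

  Origin of the logarithmic kernel: the Fourier transform in s of exp (- |m| |s|) is 2 |m| / (m^2 +
  k^2), the Green function without its mass term, while the sum over m of exp (- |m| |s|) cos (m x)
  / |m| is elementary. The regularization q < 1 makes the double series absolutely convergent; it is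
  removed by Fatou while the mollifiers are still present, whose coefficients then supply the
  summability.

  All comparisons are Cauchy estimates in which one index stays fixed, so no limit of the second
  moments has to be identified.\<close>

lemma iter_partial_append: "iter_partial (bs @ cs) f = iter_partial bs (iter_partial cs f)"
  by (induction bs) auto

lemma smooth_fun_iter_partial:
  "smooth_fun f \<Longrightarrow> set cs \<subseteq> Basis \<Longrightarrow> smooth_fun (iter_partial cs f)"
  unfolding smooth_fun_def iter_partial_append[symmetric]
  by (metis Un_subset_iff set_append)

lemma smooth_fun_differentiable: "smooth_fun f \<Longrightarrow> f differentiable (at x)"
  unfolding smooth_fun_def by (metis empty_set empty_subsetI iter_partial.simps(1))

lemma smooth_fun_has_derivative:
  "smooth_fun f \<Longrightarrow> (f has_derivative frechet_derivative f (at x)) (at x)"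
  using frechet_derivative_works smooth_fun_differentiable by blast

lemma smooth_fun_continuous_on: "smooth_fun f \<Longrightarrow> continuous_on S f"
  by (meson continuous_at_imp_continuous_on differentiable_imp_continuous_within
      smooth_fun_differentiable)

text \<open>\<open>frechet_derivative\<close> is a choice from the set of derivatives at the point.
  Functions that agree nearby have the same set, so the choices agree even if it is empty.\<close>

lemma frechet_derivative_cong_open:
  assumes "open S" "x \<in> S" "\<And>y. y \<in> S \<Longrightarrow> f y = g y"
  shows "frechet_derivative f (at x) = frechet_derivative g (at x)"
proof -
  have "(f has_derivative D) (at x) \<longleftrightarrow> (g has_derivative D) (at x)" for D
    using assms by (metis has_derivative_transform_within_open)
  then show ?thesis unfolding frechet_derivative_def by simp
qed

lemma iter_partial_cong_open:
  assumes "open S" "\<And>y. y \<in> S \<Longrightarrow> f y = g y" "x \<in> S"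
  shows "iter_partial bs f x = iter_partial bs g x"
  using assms(3)
proof (induction bs arbitrary: x)
  case (Cons b bs)
  then have "frechet_derivative (iter_partial bs f) (at x) = frechet_derivative (iter_partial bs g) (at x)"
    by (intro frechet_derivative_cong_open[OF assms(1)])
  then show ?case by simp
qed (use assms in auto)

text \<open>Meant for \<open>mollifier\<close>, whose definition contains the discontinuous
  \<open>wrap\<close>: near every point it coincides with a single affine copy of the
  profile.\<close>

lemma smooth_fun_local:
  assumes "\<And>x. \<exists>S g. open S \<and> x \<in> S \<and> smooth_fun g \<and> (\<forall>y\<in>S. f y = g y)"
  shows "smooth_fun f"
  unfolding smooth_fun_def
proof (intro allI impI)
  fix bs :: "'a list" and x assume bs: "set bs \<subseteq> Basis"
  obtain S g where S: "open S" "x \<in> S" "smooth_fun g" "\<forall>y\<in>S. f y = g y"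
    using assms by metis
  have "iter_partial bs g differentiable (at x)" using S bs by (auto simp: smooth_fun_def)
  moreover have "\<And>y. y \<in> S \<Longrightarrow> iter_partial bs g y = iter_partial bs f y"
    using iter_partial_cong_open[OF S(1), of g f] S(4) by simp
  ultimately show "iter_partial bs f differentiable (at x)"
    using S(1,2) by (metis differentiable_def has_derivative_transform_within_open)
qed

lemma has_derivative_affine_compose:
  assumes "(f has_derivative D) (at (a + s *\<^sub>R x))"
  shows "((\<lambda>x. f (a + s *\<^sub>R x)) has_derivative (\<lambda>h. D (s *\<^sub>R h))) (at x)"
proof -
  have "((\<lambda>x. a + s *\<^sub>R x) has_derivative (\<lambda>h. s *\<^sub>R h)) (at x)"
    by (auto intro!: derivative_eq_intros)
  from has_derivative_compose[OF this assms] show ?thesis .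
qed

text \<open>One rule for the dilation in \<open>mollifier\<close>, the reflection y to x - y in
  \<open>mollify\<close> (s = -1) and the translations by periods (s = 1).\<close>

lemma iter_partial_affine:
  fixes f :: "'a::euclidean_space \<Rightarrow> real"
  assumes "smooth_fun f" "set bs \<subseteq> Basis"
  shows "iter_partial bs (\<lambda>x. c * f (a + s *\<^sub>R x)) =
         (\<lambda>x. c * s ^ length bs * iter_partial bs f (a + s *\<^sub>R x))"
  using assms(2)
proof (induction bs)
  case (Cons b bs)
  have IH: "iter_partial bs (\<lambda>x. c * f (a + s *\<^sub>R x)) =
         (\<lambda>x. c * s ^ length bs * iter_partial bs f (a + s *\<^sub>R x))"
    using Cons by simp
  have sm: "smooth_fun (iter_partial bs f)"
    using smooth_fun_iter_partial[OF assms(1)] Cons.prems by simp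
  let ?F = "iter_partial bs f"
  have "((\<lambda>x. c * s ^ length bs * ?F (a + s *\<^sub>R x)) has_derivative
      (\<lambda>h. c * s ^ length bs * frechet_derivative ?F (at (a + s *\<^sub>R x)) (s *\<^sub>R h))) (at x)" for x
    by (intro has_derivative_mult_right has_derivative_affine_compose smooth_fun_has_derivative sm)
  from frechet_derivative_at[OF this]
  have "frechet_derivative (\<lambda>x. c * s ^ length bs * ?F (a + s *\<^sub>R x)) (at x) =
      (\<lambda>h. c * s ^ length bs * frechet_derivative ?F (at (a + s *\<^sub>R x)) (s *\<^sub>R h))" for x
    by metis
  moreover have "frechet_derivative ?F (at y) (s *\<^sub>R h) = s * frechet_derivative ?F (at y) h" for y h
    using has_derivative_bounded_linear[OF smooth_fun_has_derivative[OF sm, of y]]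
    by (simp add: linear_simps(5))
  ultimately show ?case by (simp add: IH fun_eq_iff)
qed simp

lemma iter_partial_lincomb:
  fixes f g :: "'a::euclidean_space \<Rightarrow> real"
  assumes "smooth_fun f" "smooth_fun g" "set bs \<subseteq> Basis"
  shows "iter_partial bs (\<lambda>x. c * f x + d * g x) =
         (\<lambda>x. c * iter_partial bs f x + d * iter_partial bs g x)"
  using assms(3)
proof (induction bs)
  case (Cons b bs)
  have sm: "smooth_fun (iter_partial bs f)" "smooth_fun (iter_partial bs g)"
    using smooth_fun_iter_partial assms(1,2) Cons.prems by auto
  let ?F = "iter_partial bs f" and ?G = "iter_partial bs g"
  have "((\<lambda>x. c * ?F x + d * ?G x) has_derivative
      (\<lambda>h. c * frechet_derivative ?F (at x) h + d * frechet_derivative ?G (at x) h)) (at x)" for x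
    by (intro has_derivative_add has_derivative_mult_right smooth_fun_has_derivative sm)
  from frechet_derivative_at[OF this]
  have "frechet_derivative (\<lambda>x. c * ?F x + d * ?G x) (at x) =
      (\<lambda>h. c * frechet_derivative ?F (at x) h + d * frechet_derivative ?G (at x) h)" for x
    by metis
  moreover have "iter_partial bs (\<lambda>x. c * f x + d * g x) = (\<lambda>x. c * ?F x + d * ?G x)"
    using Cons by simp
  ultimately show ?case by simp
qed simp

lemma smooth_fun_affine:
  fixes f :: "'a::euclidean_space \<Rightarrow> real"
  assumes "smooth_fun f"
  shows "smooth_fun (\<lambda>x. c * f (a + s *\<^sub>R x))"
  unfolding smooth_fun_def
proof (intro allI impI)
  fix bs :: "'a list" and x assume bs: "set bs \<subseteq> Basis"
  note sm = smooth_fun_has_derivative[OF smooth_fun_iter_partial[OF assms bs]]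
  show "iter_partial bs (\<lambda>x. c * f (a + s *\<^sub>R x)) differentiable (at x)"
    unfolding iter_partial_affine[OF assms bs] differentiable_def
    by (rule exI, rule has_derivative_mult_right, rule has_derivative_affine_compose, rule sm)
qed

lemma smooth_fun_lincomb:
  fixes f g :: "'a::euclidean_space \<Rightarrow> real"
  assumes "smooth_fun f" "smooth_fun g"
  shows "smooth_fun (\<lambda>x. c * f x + d * g x)"
  unfolding smooth_fun_def
proof (intro allI impI)
  fix bs :: "'a list" and x assume bs: "set bs \<subseteq> Basis"
  have "iter_partial bs f differentiable (at x)" "iter_partial bs g differentiable (at x)"
    using assms bs by (auto simp: smooth_fun_def)
  then show "iter_partial bs (\<lambda>x. c * f x + d * g x) differentiable (at x)"
    unfolding iter_partial_lincomb[OF assms bs] by simp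
qed

text \<open>The span of the cosine and the sine is closed under partial derivatives: each one swaps
  the two coefficients up to sign and multiplies them by a component of v. The resulting bound on
  Fourier modes makes the coefficients of a distribution grow at most polynomially.\<close>

lemma iter_partial_trig:
  fixes v :: "'a::euclidean_space"
  assumes "set bs \<subseteq> Basis"
  shows "\<exists>A' B'. iter_partial bs (\<lambda>x. A * cos (v \<bullet> x) + B * sin (v \<bullet> x)) =
           (\<lambda>x. A' * cos (v \<bullet> x) + B' * sin (v \<bullet> x)) \<and>
           \<bar>A'\<bar> + \<bar>B'\<bar> \<le> norm v ^ length bs * (\<bar>A\<bar> + \<bar>B\<bar>)"
  using assms
proof (induction bs)
  case Nil
  then show ?case by (intro exI[of _ A] exI[of _ B]) auto
next
  case (Cons b bs)
  then obtain A' B' where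
    eq: "iter_partial bs (\<lambda>x. A * cos (v \<bullet> x) + B * sin (v \<bullet> x)) =
           (\<lambda>x. A' * cos (v \<bullet> x) + B' * sin (v \<bullet> x))"
    and le: "\<bar>A'\<bar> + \<bar>B'\<bar> \<le> norm v ^ length bs * (\<bar>A\<bar> + \<bar>B\<bar>)" by auto
  have "((\<lambda>x. A' * cos (v \<bullet> x) + B' * sin (v \<bullet> x)) has_derivative
      (\<lambda>h. (B' * (v \<bullet> h)) * cos (v \<bullet> x) + (- A' * (v \<bullet> h)) * sin (v \<bullet> x))) (at x)" for x
    by (auto intro!: derivative_eq_intros simp: algebra_simps)
  from frechet_derivative_at[OF this]
  have fd: "frechet_derivative (\<lambda>x. A' * cos (v \<bullet> x) + B' * sin (v \<bullet> x)) (at x) =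
      (\<lambda>h. (B' * (v \<bullet> h)) * cos (v \<bullet> x) + (- A' * (v \<bullet> h)) * sin (v \<bullet> x))" for x
    by metis
  have "\<bar>v \<bullet> b\<bar> \<le> norm v" using Cons.prems
    by (simp add: Basis_le_norm)
  then have "\<bar>v \<bullet> b\<bar> * (\<bar>A'\<bar> + \<bar>B'\<bar>) \<le> norm v * (norm v ^ length bs * (\<bar>A\<bar> + \<bar>B\<bar>))"
    using le by (intro mult_mono) auto
  then show ?case
    by (intro exI[of _ "B' * (v \<bullet> b)"] exI[of _ "- A' * (v \<bullet> b)"])
       (simp add: eq fd abs_mult algebra_simps)
qed

lemma smooth_fun_trig:
  fixes v :: "'a::euclidean_space"
  shows "smooth_fun (\<lambda>x. A * cos (v \<bullet> x) + B * sin (v \<bullet> x))"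
  unfolding smooth_fun_def
proof (intro allI impI)
  fix bs :: "'a list" and x assume bs: "set bs \<subseteq> Basis"
  from iter_partial_trig[OF this, of A v B] obtain A' B' where
    "iter_partial bs (\<lambda>x. A * cos (v \<bullet> x) + B * sin (v \<bullet> x)) =
           (\<lambda>x. A' * cos (v \<bullet> x) + B' * sin (v \<bullet> x))" by blast
  moreover have "(\<lambda>x. A' * cos (v \<bullet> x) + B' * sin (v \<bullet> x)) differentiable (at x)"
    unfolding differentiable_def by (intro exI derivative_eq_intros) auto
  ultimately show "iter_partial bs (\<lambda>x. A * cos (v \<bullet> x) + B * sin (v \<bullet> x)) differentiable (at x)"
    by simp
qed

lemma torus_periodic_int:
  fixes f :: "real \<times> real \<Rightarrow> 'b" and x y :: real and j k :: int
  assumes "torus_periodic f"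
  shows "f (x + 2 * pi * of_int j, y + 2 * pi * of_int k) = f (x, y)"
proof -
  interpret X: periodic_fun_simple "\<lambda>x. f (x, y + of_int k * (2 * pi))" "2 * pi"
    by standard (use assms in \<open>auto simp: torus_periodic_def\<close>)
  interpret Y: periodic_fun_simple "\<lambda>y. f (x, y)" "2 * pi"
    by standard (use assms in \<open>auto simp: torus_periodic_def\<close>)
  show ?thesis
    using X.plus_of_int[of x j] Y.plus_of_int[of y k] by (simp add: mult_ac)
qed

lemma wrap_bounds: "- pi \<le> wrap t" "wrap t < pi"
proof -
  define j where "j = \<lfloor>(t + pi) / (2 * pi)\<rfloor>"
  have "of_int j \<le> (t + pi) / (2 * pi)" "(t + pi) / (2 * pi) < of_int j + 1"
    unfolding j_def by linarith+
  then have "of_int j * (2 * pi) \<le> t + pi" "t + pi < (of_int j + 1) * (2 * pi)"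
    by (simp_all add: field_simps)
  then show "- pi \<le> wrap t" "wrap t < pi"
    unfolding wrap_def j_def[symmetric] by (simp_all add: algebra_simps)
qed

lemma torus_periodic_wrap: "torus_periodic f \<Longrightarrow> f (wrap x, wrap y) = f (x, y)"
  using torus_periodic_int[of f x "- \<lfloor>(x + pi) / (2 * pi)\<rfloor>" y "- \<lfloor>(y + pi) / (2 * pi)\<rfloor>"]
  by (simp add: wrap_def)

lemma torus_periodic_bounded:
  fixes f :: "real \<times> real \<Rightarrow> 'b::real_normed_vector"
  assumes "torus_periodic f" "continuous_on UNIV f"
  obtains B where "\<And>x. norm (f x) \<le> B"
proof -
  have "compact ({-pi..pi} \<times> {-pi..pi::real})" by (intro compact_Times) auto
  then have "bounded (f ` ({-pi..pi} \<times> {-pi..pi}))"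
    by (intro compact_imp_bounded compact_continuous_image continuous_on_subset[OF assms(2)]) auto
  then obtain B where B: "\<And>x. x \<in> {-pi..pi} \<times> {-pi..pi} \<Longrightarrow> norm (f x) \<le> B"
    by (auto simp: bounded_iff)
  have "norm (f x) \<le> B" for x
    using torus_periodic_wrap[OF assms(1), of "fst x" "snd x"] B[of "(wrap (fst x), wrap (snd x))"]
      wrap_bounds[of "fst x"] wrap_bounds[of "snd x"]
    by (auto simp: less_imp_le)
  then show ?thesis using that by blast
qed

lemma torus_periodic_uniformly_continuous:
  fixes f :: "real \<times> real \<Rightarrow> 'b::real_normed_vector"
  assumes "torus_periodic f" "continuous_on UNIV f" "e > 0"
  obtains d where "d > 0" "\<And>x y. dist x y < d \<Longrightarrow> dist (f x) (f y) < e"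
proof -
  define K where "K = {-pi-1..pi+1} \<times> {-pi-1..pi+1::real}"
  have "compact K" unfolding K_def by (intro compact_Times) auto
  then have "uniformly_continuous_on K f"
    by (intro compact_uniformly_continuous continuous_on_subset[OF assms(2)]) auto
  then obtain d where d: "d > 0" "\<And>x y. x \<in> K \<Longrightarrow> y \<in> K \<Longrightarrow> dist x y < d \<Longrightarrow> dist (f x) (f y) < e"
    using assms(3) unfolding uniformly_continuous_on_def by (metis dist_commute)
  show ?thesis
  proof (rule that[of "min d 1"])
    fix x y :: "real \<times> real" assume xy: "dist x y < min d 1"
    obtain x1 x2 y1 y2 where [simp]: "x = (x1, x2)" "y = (y1, y2)" by fastforce
    \<comment> \<open>The same lattice translation is applied to both points. It moves x into the
      cell and, since the points are closer than 1, y into the cell enlarged by 1; this dictates the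
      choice of K.\<close>
    define j k where "j = - \<lfloor>(x1 + pi) / (2 * pi)\<rfloor>" and "k = - \<lfloor>(x2 + pi) / (2 * pi)\<rfloor>"
    define x' where "x' = (x1 + 2 * pi * of_int j, x2 + 2 * pi * of_int k)"
    define y' where "y' = (y1 + 2 * pi * of_int j, y2 + 2 * pi * of_int k)"
    have f: "f x' = f x" "f y' = f y"
      unfolding x'_def y'_def using torus_periodic_int[OF assms(1)] by auto
    have x'w: "x' = (wrap x1, wrap x2)" by (simp add: x'_def wrap_def j_def k_def)
    have dxy: "dist x' y' = dist x y"
      by (simp add: x'_def y'_def dist_Pair_Pair dist_real_def)
    have "dist (fst x') (fst y') < 1" "dist (snd x') (snd y') < 1"
      using dist_fst_le[of x' y'] dist_snd_le[of x' y'] dxy xy by auto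
    then have "x' \<in> K" "y' \<in> K"
      using wrap_bounds[of x1] wrap_bounds[of x2]
      by (auto simp: K_def x'w dist_real_def abs_real_def mem_Times_iff split: if_splits)
    then show "dist (f x) (f y) < e" using d(2)[of x' y'] f dxy xy by auto
  qed (use d in auto)
qed

lemma torus_test_iter_partial:
  assumes "\<phi> \<in> torus_test" "set bs \<subseteq> Basis"
  shows "iter_partial bs \<phi> \<in> torus_test"
proof -
  have sm: "smooth_fun \<phi>" and per: "torus_periodic \<phi>" using assms by (auto simp: torus_test_def)
  have "iter_partial bs \<phi> (p + x) = iter_partial bs \<phi> x" if "p = (2 * pi, 0) \<or> p = (0, 2 * pi)" for p x
  proof -
    have "(\<lambda>x. 1 * \<phi> (p + 1 *\<^sub>R x)) = \<phi>"
      using per that by (auto simp: torus_periodic_def fun_eq_iff add.commute)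
    then show ?thesis using fun_cong[OF iter_partial_affine[OF sm assms(2), of 1 p 1], of x] by simp
  qed
  from this[of "(2 * pi, 0)"] this[of "(0, 2 * pi)"]
  have "torus_periodic (iter_partial bs \<phi>)"
    unfolding torus_periodic_def by (metis add_Pair add.commute add_0)
  then show ?thesis using smooth_fun_iter_partial[OF sm assms(2)] by (simp add: torus_test_def)
qed

lemma torus_test_bounded:
  assumes "\<phi> \<in> torus_test" obtains B where "\<And>x. \<bar>\<phi> x\<bar> \<le> B"
  using torus_periodic_bounded[of \<phi>] assms smooth_fun_continuous_on[of \<phi> UNIV]
  by (auto simp: torus_test_def)

text \<open>A supremum in the reals is informative only for bounded sets. Boundedness holds because
  there are finitely many lists of directions and each derivative is continuous and
  periodic.\<close>

lemma Ck_norm_upper: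
  assumes "\<phi> \<in> torus_test" "set bs \<subseteq> Basis" "length bs \<le> k"
  shows "\<bar>iter_partial bs \<phi> x\<bar> \<le> Ck_norm k \<phi>"
proof -
  let ?L = "{bs :: (real \<times> real) list. set bs \<subseteq> Basis \<and> length bs \<le> k}"
  have fin: "finite ?L" by (rule finite_lists_length_le) simp
  have "\<forall>bs\<in>?L. \<exists>B. \<forall>x. \<bar>iter_partial bs \<phi> x\<bar> \<le> B"
    using torus_test_bounded torus_test_iter_partial[OF assms(1)] by (metis (mono_tags, lifting) mem_Collect_eq)
  then obtain B where B: "\<And>bs x. bs \<in> ?L \<Longrightarrow> \<bar>iter_partial bs \<phi> x\<bar> \<le> B bs" by metis
  have B0: "0 \<le> B bs" if "bs \<in> ?L" for bs using B[OF that] abs_ge_zero order_trans by blast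
  have "\<bar>iter_partial bs \<phi> x\<bar> \<le> sum B ?L" if "bs \<in> ?L" for bs x
    using B[OF that, of x] member_le_sum[OF that _ fin, of B] B0 by fastforce
  then have "bdd_above ((\<lambda>(bs, x). \<bar>iter_partial bs \<phi> x\<bar>) ` (?L \<times> UNIV))"
    by (intro bdd_aboveI[of _ "sum B ?L"]) auto
  then show ?thesis unfolding Ck_norm_def
    by (intro cSUP_upper2[of _ _ "(bs, x)"]) (use assms in auto)
qed

lemma Ck_norm_least:
  assumes "\<And>bs x. set bs \<subseteq> Basis \<Longrightarrow> length bs \<le> k \<Longrightarrow> \<bar>iter_partial bs \<phi> x\<bar> \<le> B"
  shows "Ck_norm k \<phi> \<le> B"
  unfolding Ck_norm_def
proof (rule cSUP_least)
  have "([], 0) \<in> {bs :: (real \<times> real) list. set bs \<subseteq> Basis \<and> length bs \<le> k} \<times> UNIV" by simp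
  then show "{bs :: (real \<times> real) list. set bs \<subseteq> Basis \<and> length bs \<le> k} \<times> UNIV \<noteq> {}" by blast
qed (use assms in auto)

lemma Ck_norm_nonneg: "\<phi> \<in> torus_test \<Longrightarrow> 0 \<le> Ck_norm k \<phi>"
  using Ck_norm_upper[of \<phi> "[]" k 0] by auto

lemma torus_test_lincomb:
  "\<phi> \<in> torus_test \<Longrightarrow> \<psi> \<in> torus_test \<Longrightarrow> (\<lambda>x. a * \<phi> x + b * \<psi> x) \<in> torus_test"
  by (auto simp: torus_test_def torus_periodic_def intro!: smooth_fun_lincomb)

lemma freq_inner: "freq n \<bullet> x = of_int (fst n) * fst x + of_int (snd n) * snd x"
  by (cases x) (simp add: freq_def inner_prod_def)

lemma cos_shift: "cos (x + of_int k * (2 * pi)) = cos x"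
  and sin_shift: "sin (x + of_int k * (2 * pi)) = sin x"
  using cos.plus_of_int[of x k] sin.plus_of_int[of x k] by simp_all

lemma torus_periodic_trig:
  "torus_periodic (\<lambda>x. A * cos (freq n \<bullet> x) + B * sin (freq n \<bullet> x))"
proof -
  have "freq n \<bullet> (x + 2 * pi, y) = freq n \<bullet> (x, y) + of_int (fst n) * (2 * pi)"
    "freq n \<bullet> (x, y + 2 * pi) = freq n \<bullet> (x, y) + of_int (snd n) * (2 * pi)" for x y
    by (simp_all add: freq_inner algebra_simps)
  then show ?thesis
    unfolding torus_periodic_def by (simp only: cos_shift sin_shift) simp
qed

lemma torus_test_trig: "(\<lambda>x. A * cos (freq n \<bullet> x) + B * sin (freq n \<bullet> x)) \<in> torus_test"
  by (simp add: torus_test_def smooth_fun_trig torus_periodic_trig)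

lemma Ck_norm_trig:
  "Ck_norm k (\<lambda>x. A * cos (freq n \<bullet> x) + B * sin (freq n \<bullet> x)) \<le> jbracket n ^ k * (\<bar>A\<bar> + \<bar>B\<bar>)"
proof (rule Ck_norm_least)
  fix bs :: "(real \<times> real) list" and x :: "real \<times> real" assume bs: "set bs \<subseteq> Basis" "length bs \<le> k"
  from iter_partial_trig[OF bs(1), of A "freq n" B] obtain A' B' where
    eq: "iter_partial bs (\<lambda>x. A * cos (freq n \<bullet> x) + B * sin (freq n \<bullet> x)) =
           (\<lambda>x. A' * cos (freq n \<bullet> x) + B' * sin (freq n \<bullet> x))"
    and le: "\<bar>A'\<bar> + \<bar>B'\<bar> \<le> norm (freq n) ^ length bs * (\<bar>A\<bar> + \<bar>B\<bar>)" by blast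
  have "norm (freq n) \<le> jbracket n" "1 \<le> jbracket n"
    unfolding jbracket_def by (auto intro: real_le_rsqrt)
  then have "norm (freq n) ^ length bs \<le> jbracket n ^ k"
    by (meson bs(2) norm_ge_zero order_trans power_increasing power_mono)
  then have *: "\<bar>A'\<bar> + \<bar>B'\<bar> \<le> jbracket n ^ k * (\<bar>A\<bar> + \<bar>B\<bar>)"
    using le by (meson add_nonneg_nonneg abs_ge_zero mult_right_mono order_trans)
  have "\<bar>A' * cos (freq n \<bullet> x) + B' * sin (freq n \<bullet> x)\<bar> \<le> \<bar>A'\<bar> + \<bar>B'\<bar>"
    by (intro order_trans[OF abs_triangle_ineq] add_mono) (auto simp: abs_mult mult_left_le)
  then show "\<bar>iter_partial bs (\<lambda>x. A * cos (freq n \<bullet> x) + B * sin (freq n \<bullet> x)) x\<bar>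
      \<le> jbracket n ^ k * (\<bar>A\<bar> + \<bar>B\<bar>)"
    using * eq by simp
qed

section \<open>Integration and Fourier series on the torus\<close>

text \<open>Dominated convergence for unordered sums along an arbitrary filter: the dominating
  series makes the finite partial sums converge uniformly in j, so the two limits can be
  exchanged.\<close>

lemma infsum_dominated_tendsto:
  fixes f :: "'i \<Rightarrow> 'j \<Rightarrow> 'b::banach"
  assumes h: "h summable_on A" and le: "\<And>i j. i \<in> A \<Longrightarrow> norm (f i j) \<le> h i"
    and lim: "\<And>i. i \<in> A \<Longrightarrow> (f i \<longlongrightarrow> g i) F" and F: "F \<noteq> bot"
  shows "((\<lambda>j. infsum (\<lambda>i. f i j) A) \<longlongrightarrow> infsum g A) F"
proof (rule swap_uniform_limit')
  show "uniform_limit UNIV (\<lambda>X j. \<Sum>i\<in>X. f i j) (\<lambda>j. \<Sum>\<^sub>\<infinity>i\<in>A. f i j) (finite_subsets_at_top A)"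
    by (rule Weierstrass_m_test_general[OF le h])
  have gle: "norm (g i) \<le> h i" if "i \<in> A" for i
    by (rule tendsto_upperbound[OF tendsto_norm[OF lim[OF that]]]) (use le that F in auto)
  have "g summable_on A"
    using Infinite_Sum.abs_summable_on_comparison_test'[OF h gle] abs_summable_summable by blast
  then show "((\<lambda>X. \<Sum>i\<in>X. g i) \<longlongrightarrow> infsum g A) (finite_subsets_at_top A)"
    by (rule infsum_tendsto)
  show "\<forall>\<^sub>F X in finite_subsets_at_top A. ((\<lambda>j. \<Sum>i\<in>X. f i j) \<longlongrightarrow> (\<Sum>i\<in>X. g i)) F"
    by (rule eventually_finite_subsets_at_top_weakI) (auto intro!: tendsto_sum lim)
qed auto

text \<open>\<open>has_sum\<close> is a limit along the net of finite sets, whereas dominated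
  convergence is a statement about sequences. On a finite measure space the uniform convergence of
  the partial sums takes its place.\<close>

lemma has_sum_integral_dominated:
  fixes F :: "'i \<Rightarrow> 'a \<Rightarrow> 'b::{banach,second_countable_topology}"
  assumes "finite_measure M" and meas: "\<And>n. F n \<in> borel_measurable M"
    and le: "\<And>n x. norm (F n x) \<le> B n" and B: "B summable_on UNIV"
    and sum: "\<And>x. ((\<lambda>n. F n x) has_sum S x) UNIV" and S: "S \<in> borel_measurable M"
  shows "((\<lambda>n. integral\<^sup>L M (F n)) has_sum integral\<^sup>L M S) UNIV"
proof -
  interpret finite_measure M by fact
  have unif: "uniform_limit UNIV (\<lambda>X x. \<Sum>n\<in>X. F n x) S (finite_subsets_at_top UNIV)"
    by (rule Weierstrass_m_test_general'[OF le sum B])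
  have intF: "integrable M (F n)" for n
    by (rule integrable_const_bound[of _ "B n"]) (use le meas in auto)
  have "norm (S x) \<le> infsum B UNIV" for x
    using norm_infsum_le[OF sum has_sum_infsum[OF B], of x] le by auto
  then have intS: "integrable M S"
    by (intro integrable_const_bound[of _ "infsum B UNIV"]) (use S in auto)
  show ?thesis unfolding has_sum_def
  proof (rule tendstoI)
    fix e :: real assume e: "e > 0"
    define d where "d = e / (measure M (space M) + 1)"
    have d: "d > 0" using e by (simp add: d_def add_nonneg_pos)
    from uniform_limitD[OF unif d]
    have "\<forall>\<^sub>F X in finite_subsets_at_top UNIV. \<forall>x\<in>UNIV. dist (\<Sum>n\<in>X. F n x) (S x) < d" .
    then show "\<forall>\<^sub>F X in finite_subsets_at_top UNIV. dist (\<Sum>n\<in>X. integral\<^sup>L M (F n)) (integral\<^sup>L M S) < e"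
    proof eventually_elim
      case (elim X)
      have "dist (\<Sum>n\<in>X. integral\<^sup>L M (F n)) (integral\<^sup>L M S) = norm (\<integral>x. (\<Sum>n\<in>X. F n x) - S x \<partial>M)"
        using intF intS by (simp add: dist_norm Bochner_Integration.integral_diff Bochner_Integration.integral_sum)
      also have "\<dots> \<le> (\<integral>x. norm ((\<Sum>n\<in>X. F n x) - S x) \<partial>M)"
        by (rule integral_norm_bound)
      also have "\<dots> \<le> (\<integral>x. d \<partial>M)"
        using elim intF intS by (intro integral_mono) (auto simp: dist_norm intro: less_imp_le)
      also have "\<dots> = d * measure M (space M)" by simp
      also have "\<dots> < e"
      proof -
        have "d * measure M (space M) < d * (measure M (space M) + 1)" using d by simp
        also have "\<dots> = e" using measure_nonneg[of M "space M"] by (simp add: d_def add_nonneg_eq_0_iff)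
        finally show ?thesis .
      qed
      finally show ?case .
    qed
  qed
qed

section \<open>Lebesgue measure on the circle and on the torus\<close>

definition circM :: "real measure" where
  "circM = density lborel (indicator {-pi..<pi})"

definition torusM :: "(real \<times> real) measure" where
  "torusM = circM \<Otimes>\<^sub>M circM"

lemma sets_circM [simp, measurable_cong]: "sets circM = sets borel"
  and space_circM [simp]: "space circM = UNIV"
  by (auto simp: circM_def)

lemma sets_torusM [simp, measurable_cong]: "sets torusM = sets borel"
  unfolding torusM_def by (metis borel_prod sets_circM sets_pair_measure_cong)

lemma space_torusM [simp]: "space torusM = UNIV"
  by (simp add: torusM_def space_pair_measure)

lemma circM_closed: "circM = density lborel (indicator {-pi..pi})"
  unfolding circM_def
  by (rule density_cong) (use AE_lborel_singleton[of pi] in \<open>auto split: split_indicator\<close>)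

lemma emeasure_circM: "emeasure circM UNIV = ennreal (2 * pi)"
  unfolding circM_def by (simp add: emeasure_density)

interpretation circM: finite_measure circM
  by (rule finite_measureI) (simp add: emeasure_circM)

interpretation circM_pair: pair_sigma_finite circM circM ..

lemma measure_circM [simp]: "measure circM UNIV = 2 * pi"
  by (simp add: measure_def emeasure_circM)

lemma emeasure_torusM: "emeasure torusM UNIV = ennreal (4 * pi\<^sup>2)"
proof -
  have "emeasure torusM (UNIV \<times> UNIV) = ennreal (2 * pi) * ennreal (2 * pi)"
    unfolding torusM_def by (subst circM.emeasure_pair_measure_Times) (auto simp: emeasure_circM)
  then show ?thesis by (simp add: ennreal_mult[symmetric] power2_eq_square)
qed

interpretation torusM: finite_measure torusM
  by (rule finite_measureI) (simp add: emeasure_torusM)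

lemma measure_torusM [simp]: "measure torusM UNIV = 4 * pi\<^sup>2"
  by (simp add: measure_def emeasure_torusM)

lemma torusM_density: "torusM = density lborel (indicator torus_cell)"
proof -
  have "torusM = density (lborel \<Otimes>\<^sub>M lborel) (\<lambda>(x, y). indicator {-pi..<pi} x * indicator {-pi..<pi} y)"
    unfolding torusM_def circM_def
  proof (rule pair_measure_density)
    show "sigma_finite_measure (density lborel (indicator {-pi..<pi::real}))"
      using circM.sigma_finite_measure_axioms by (simp add: circM_def)
  qed (auto intro: lborel.sigma_finite_measure_axioms)
  also have "(\<lambda>(x, y). indicator {-pi..<pi} x * indicator {-pi..<pi} y :: ennreal) = indicator torus_cell"
    by (auto simp: torus_cell_def fun_eq_iff split: split_indicator)
  finally show ?thesis by (simp add: lborel_prod)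
qed

lemma torus_cell_borel [measurable]: "torus_cell \<in> sets borel"
  unfolding torus_cell_def by (simp add: borel_Times)

lemma set_integral_torus:
  fixes f :: "real \<times> real \<Rightarrow> 'b::{banach,second_countable_topology}"
  assumes [measurable]: "f \<in> borel_measurable borel"
  shows "(LINT x:torus_cell|lborel. f x) = (\<integral>x. f x \<partial>torusM)"
proof -
  have "(\<integral>x. f x \<partial>torusM) = (\<integral>x. f x \<partial>density lborel (\<lambda>x. ennreal (indicator torus_cell x)))"
    unfolding torusM_density by (simp add: ennreal_indicator)
  also have "\<dots> = (LINT x:torus_cell|lborel. f x)"
    unfolding set_lebesgue_integral_def by (rule integral_density) auto
  finally show ?thesis by simp
qed

lemma AE_torusM_cell: "AE x in torusM. x \<in> torus_cell"
  unfolding torusM_density by (subst AE_density) (auto split: split_indicator)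

lemma integral_circM_FTC_on:
  fixes f F :: "real \<Rightarrow> 'b::euclidean_space"
  assumes "\<And>x. x \<in> {-pi..pi} \<Longrightarrow> (F has_vector_derivative f x) (at x within {-pi..pi})"
    and "continuous_on UNIV f"
  shows "(\<integral>x. f x \<partial>circM) = F pi - F (- pi)"
proof -
  have [measurable]: "f \<in> borel_measurable borel" using assms(2) by (rule borel_measurable_continuous_onI)
  have "(\<integral>x. f x \<partial>circM) = (\<integral>x. f x \<partial>density lborel (\<lambda>x. ennreal (indicator {-pi..pi} x)))"
    unfolding circM_closed by (simp add: ennreal_indicator)
  also have "\<dots> = (\<integral>x. indicator {-pi..pi} x *\<^sub>R f x \<partial>lborel)"
    by (rule integral_density) auto
  also have "\<dots> = F pi - F (- pi)"
    by (rule integral_FTC_Icc) (use assms in \<open>auto intro: continuous_on_subset\<close>)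
  finally show ?thesis .
qed

lemma integral_circM_FTC:
  fixes f F :: "real \<Rightarrow> 'b::euclidean_space"
  assumes "\<And>x. (F has_vector_derivative f x) (at x)" "continuous_on UNIV f"
  shows "(\<integral>x. f x \<partial>circM) = F pi - F (- pi)"
  by (rule integral_circM_FTC_on[OF has_vector_derivative_at_within[OF assms(1)] assms(2)])

text \<open>In terms of an antiderivative F the shifted integral is G t = F (t + pi) - F (t - pi),
  and its derivative f (t + pi) - f (t - pi) vanishes by periodicity. The radius R is chosen such
  that every argument of F that occurs lies inside the interval on which F is constructed.\<close>

lemma integral_circM_shift:
  fixes f :: "real \<Rightarrow> 'b::euclidean_space"
  assumes cont: "continuous_on UNIV f" and per: "\<And>x. f (x + 2 * pi) = f x"
  shows "(\<integral>x. f (a + x) \<partial>circM) = (\<integral>x. f x \<partial>circM)"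
proof -
  define R where "R = \<bar>a\<bar> + pi + 1"
  have R: "R > pi" "R > 0" using pi_gt_zero abs_ge_zero[of a] unfolding R_def by linarith+
  obtain F where F: "\<And>x. x \<in> {-R..R} \<Longrightarrow> (F has_vector_derivative f x) (at x within {-R..R})"
    using antiderivative_continuous[of "-R" R f] continuous_on_subset[OF cont] by blast
  have Fat: "(F has_vector_derivative f x) (at x)" if "\<bar>x\<bar> < R" for x
    using F[of x] that at_within_Icc_at[of "-R" x R] by (simp add: abs_less_iff)
  have 1: "(\<integral>x. f (t + x) \<partial>circM) = F (t + pi) - F (t - pi)" if "\<bar>t\<bar> \<le> \<bar>a\<bar>" for t
  proof -
    have "(\<integral>x. f (t + x) \<partial>circM) = F (t + pi) - F (t + - pi)"
    proof (rule integral_circM_FTC_on[where F="\<lambda>x. F (t + x)"])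
      fix x assume x: "x \<in> {-pi..pi}"
      have "((\<lambda>x. t + x) has_vector_derivative 1) (at x within {-pi..pi})"
        by (auto intro!: derivative_eq_intros)
      moreover have "(F has_vector_derivative f (t + x)) (at (t + x))"
        using x that by (intro Fat) (auto simp: R_def)
      ultimately show "((\<lambda>x. F (t + x)) has_vector_derivative f (t + x)) (at x within {-pi..pi})"
        using vector_diff_chain_within[of "\<lambda>x. t + x" 1 x "{-pi..pi}" F "f (t + x)"]
        by (simp add: has_vector_derivative_at_within o_def)
    next
      show "continuous_on UNIV (\<lambda>x. f (t + x))"
        by (intro continuous_on_compose2[OF cont] continuous_intros) auto
    qed
    then show ?thesis by simp
  qed
  define G where "G t = F (t + pi) - F (t - pi)" for t
  have "\<exists>c. \<forall>t\<in>{-\<bar>a\<bar>..\<bar>a\<bar>}. G t = c"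
  proof (rule has_vector_derivative_zero_constant)
    fix t assume t: "t \<in> {-\<bar>a\<bar>..\<bar>a\<bar>}"
    have "((\<lambda>x. F (x + c)) has_vector_derivative f (t + c)) (at t)" if "\<bar>c\<bar> \<le> pi" for c
    proof -
      have "((\<lambda>x. x + c) has_vector_derivative 1) (at t)"
        by (auto intro!: derivative_eq_intros)
      moreover have "(F has_vector_derivative f (t + c)) (at (t + c))"
        using t that by (intro Fat) (auto simp: R_def)
      ultimately show ?thesis
        using vector_diff_chain_at[of "\<lambda>x. x + c" 1 t F "f (t + c)"] by (simp add: o_def)
    qed
    from this[of pi] this[of "-pi"]
    have "(G has_vector_derivative f (t + pi) - f (t - pi)) (at t)"
      unfolding G_def by (auto intro!: has_vector_derivative_diff)
    moreover have "f (t + pi) = f (t - pi)" using per[of "t - pi"] by (simp add: algebra_simps)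
    ultimately show "(G has_vector_derivative 0) (at t within {-\<bar>a\<bar>..\<bar>a\<bar>})"
      by (auto intro: has_vector_derivative_at_within)
  qed auto
  then have "G a = G 0" by fastforce
  then show ?thesis using 1[of a] 1[of 0] by (simp add: G_def)
qed

lemma integral_circM_reflect:
  fixes f :: "real \<Rightarrow> 'b::{banach,second_countable_topology}"
  assumes [measurable]: "f \<in> borel_measurable borel"
  shows "(\<integral>x. f (- x) \<partial>circM) = (\<integral>x. f x \<partial>circM)"
proof -
  have eq: "(\<integral>x. g x \<partial>circM) = (\<integral>x. indicator {-pi..pi} x *\<^sub>R g x \<partial>lborel)"
    if [measurable]: "g \<in> borel_measurable borel" for g :: "real \<Rightarrow> 'b"
  proof -
    have "(\<integral>x. g x \<partial>circM) = (\<integral>x. g x \<partial>density lborel (\<lambda>x. ennreal (indicator {-pi..pi} x)))"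
      unfolding circM_closed by (simp add: ennreal_indicator)
    then show ?thesis by (simp add: integral_density)
  qed
  have "(\<integral>x. indicator {-pi..pi} x *\<^sub>R f x \<partial>lborel) = (\<integral>x. indicator {-pi..pi} (- x) *\<^sub>R f (- x) \<partial>lborel)"
    using lborel_integral_real_affine[of "-1" "\<lambda>x. indicator {-pi..pi} x *\<^sub>R f x" 0] by simp
  also have "\<dots> = (\<integral>x. indicator {-pi..pi} x *\<^sub>R f (- x) \<partial>lborel)"
    by (intro Bochner_Integration.integral_cong) (auto split: split_indicator)
  finally show ?thesis by (simp add: eq)
qed

lemma integral_torusM_iterated:
  fixes f :: "real \<times> real \<Rightarrow> 'b::euclidean_space"
  assumes [measurable]: "f \<in> borel_measurable borel" and "\<And>x. norm (f x) \<le> B"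
  shows "(\<integral>x. f x \<partial>torusM) = (\<integral>x. (\<integral>y. f (x, y) \<partial>circM) \<partial>circM)"
    and "(\<integral>x. f x \<partial>torusM) = (\<integral>y. (\<integral>x. f (x, y) \<partial>circM) \<partial>circM)"
proof -
  have int: "integrable torusM f"
    by (rule torusM.integrable_const_bound[of _ B]) (use assms in auto)
  then show "(\<integral>x. f x \<partial>torusM) = (\<integral>x. (\<integral>y. f (x, y) \<partial>circM) \<partial>circM)"
    using circM_pair.integral_fst'[of f] by (simp add: torusM_def)
  show "(\<integral>x. f x \<partial>torusM) = (\<integral>y. (\<integral>x. f (x, y) \<partial>circM) \<partial>circM)"
    using circM_pair.integral_snd[of "\<lambda>x y. f (x, y)"] int by (simp add: torusM_def)
qed

lemma continuous_on_Pair1: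
  "continuous_on UNIV f \<Longrightarrow> continuous_on UNIV (\<lambda>x. f (x, y))"
  and continuous_on_Pair2: "continuous_on UNIV f \<Longrightarrow> continuous_on UNIV (\<lambda>y. f (x, y))"
  for f :: "real \<times> real \<Rightarrow> 'b::topological_space"
  by (auto intro!: continuous_on_compose2[of UNIV f] continuous_intros)

text \<open>Translations and reflections act on the coordinates separately. Fubini in one order
  treats the second coordinate, Fubini in the other order the first.\<close>

lemma integral_torusM_shift:
  fixes f :: "real \<times> real \<Rightarrow> 'b::euclidean_space"
  assumes cont: "continuous_on UNIV f" and per: "torus_periodic f"
  shows "(\<integral>x. f (a + x) \<partial>torusM) = (\<integral>x. f x \<partial>torusM)"
    and "(\<integral>x. f (a - x) \<partial>torusM) = (\<integral>x. f x \<partial>torusM)"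
proof -
  obtain B where B: "\<And>x. norm (f x) \<le> B" using torus_periodic_bounded[OF per cont] by blast
  have [measurable]: "f \<in> borel_measurable borel" using cont by (rule borel_measurable_continuous_onI)
  obtain a1 a2 where [simp]: "a = (a1, a2)" by (cases a)
  have s1: "(\<integral>x. f (a1 + x, y) \<partial>circM) = (\<integral>x. f (x, y) \<partial>circM)" for y
    using integral_circM_shift[of "\<lambda>x. f (x, y)" a1] continuous_on_Pair1[OF cont] per
    by (auto simp: torus_periodic_def)
  have s2: "(\<integral>y. f (x, a2 + y) \<partial>circM) = (\<integral>y. f (x, y) \<partial>circM)" for x
    using integral_circM_shift[of "\<lambda>y. f (x, y)" a2] continuous_on_Pair2[OF cont] per
    by (auto simp: torus_periodic_def)
  have r1: "(\<integral>x. f (a1 - x, y) \<partial>circM) = (\<integral>x. f (x, y) \<partial>circM)" for y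
    using integral_circM_reflect[of "\<lambda>x. f (a1 + x, y)"] s1[of y] by simp
  have r2: "(\<integral>y. f (x, a2 - y) \<partial>circM) = (\<integral>y. f (x, y) \<partial>circM)" for x
    using integral_circM_reflect[of "\<lambda>y. f (x, a2 + y)"] s2[of x] by simp
  note it = integral_torusM_iterated[OF _ B]
  have [measurable]: "(\<lambda>x. f (a1 - fst x, snd x)) \<in> borel_measurable borel"
    by (intro borel_measurable_continuous_onI continuous_on_compose2[OF cont])
       (auto intro!: continuous_intros)
  have "(\<integral>x. f (a + x) \<partial>torusM) = (\<integral>x. (\<integral>y. f (a1 + x, a2 + y) \<partial>circM) \<partial>circM)"
    using integral_torusM_iterated(1)[of "\<lambda>x. f (a + x)" B] B by simp
  also have "\<dots> = (\<integral>x. (\<integral>y. f (a1 + x, y) \<partial>circM) \<partial>circM)" by (simp add: s2)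
  also have "\<dots> = (\<integral>x. f ((a1, 0) + x) \<partial>torusM)"
    using integral_torusM_iterated(1)[of "\<lambda>x. f ((a1, 0) + x)" B] B by simp
  also have "\<dots> = (\<integral>y. (\<integral>x. f (a1 + x, y) \<partial>circM) \<partial>circM)"
    using integral_torusM_iterated(2)[of "\<lambda>x. f ((a1, 0) + x)" B] B by simp
  also have "\<dots> = (\<integral>x. f x \<partial>torusM)" by (simp add: s1 it(2))
  finally show "(\<integral>x. f (a + x) \<partial>torusM) = (\<integral>x. f x \<partial>torusM)" .
  have "(\<integral>x. f (a - x) \<partial>torusM) = (\<integral>x. (\<integral>y. f (a1 - x, a2 - y) \<partial>circM) \<partial>circM)"
    using integral_torusM_iterated(1)[of "\<lambda>x. f (a - x)" B] B by simp
  also have "\<dots> = (\<integral>x. (\<integral>y. f (a1 - x, y) \<partial>circM) \<partial>circM)" by (simp add: r2)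
  also have "\<dots> = (\<integral>x. f (a1 - fst x, snd x) \<partial>torusM)"
    using integral_torusM_iterated(1)[of "\<lambda>x. f (a1 - fst x, snd x)" B] B by simp
  also have "\<dots> = (\<integral>y. (\<integral>x. f (a1 - x, y) \<partial>circM) \<partial>circM)"
    using integral_torusM_iterated(2)[of "\<lambda>x. f (a1 - fst x, snd x)" B] B by simp
  also have "\<dots> = (\<integral>x. f x \<partial>torusM)" by (simp add: r1 it(2))
  finally show "(\<integral>x. f (a - x) \<partial>torusM) = (\<integral>x. f x \<partial>torusM)" .
qed

lemma integral_circM_cis:
  "(\<integral>x. cis (of_int k * x) \<partial>circM) = (if k = 0 then of_real (2 * pi) else 0)"
proof (cases "k = 0")
  case True
  then show ?thesis by (simp add: scaleR_conv_of_real)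
next
  case False
  have "(\<integral>x. cis (of_int k * x) \<partial>circM) = cis (of_int k * pi) / (\<i> * of_int k) - cis (of_int k * (-pi)) / (\<i> * of_int k)"
  proof (rule integral_circM_FTC)
    fix x :: real
    have "((\<lambda>x. cis (of_int k * x)) has_vector_derivative (of_int k *\<^sub>R (\<i> * cis (of_int k * x)))) (at x)"
      unfolding has_vector_derivative_def by (auto intro!: derivative_eq_intros simp: mult.commute)
    from has_vector_derivative_divide[OF this, of "\<i> * of_int k"]
    show "((\<lambda>x. cis (of_int k * x) / (\<i> * of_int k)) has_vector_derivative cis (of_int k * x)) (at x)"
      using False by (simp add: scaleR_conv_of_real)
  qed (auto intro!: continuous_intros)
  also have "cis (of_int k * (-pi)) = cis (of_int k * pi)"
    by (auto simp: complex_eq_iff)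
       (use sin_int_times_real in \<open>simp add: mult.commute\<close>)
  finally show ?thesis using False by simp
qed

lemma cis_freq_diff: "cis (freq n \<bullet> (x - y)) = cis (freq n \<bullet> x) * cnj (cis (freq n \<bullet> y))"
  by (simp add: inner_diff_right cis_mult cis_cnj)

lemma freq_add: "freq (n + m) = freq n + freq m" and freq_minus: "freq (- n) = - freq n"
  and freq_0 [simp]: "freq 0 = 0"
  by (auto simp: freq_def zero_prod_def)

lemma continuous_on_cis_freq [continuous_intros]: "continuous_on S (\<lambda>x. cis (freq n \<bullet> x))"
  by (intro continuous_intros)

lemma torus_periodic_cis: "torus_periodic (\<lambda>x. cis (freq n \<bullet> x))"
proof -
  have "freq n \<bullet> (x + 2 * pi, y) = freq n \<bullet> (x, y) + of_int (fst n) * (2 * pi)"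
    "freq n \<bullet> (x, y + 2 * pi) = freq n \<bullet> (x, y) + of_int (snd n) * (2 * pi)" for x y
    by (simp_all add: freq_inner algebra_simps)
  then show ?thesis
    unfolding torus_periodic_def by (simp only: complex_eq_iff cis.sel cos_shift sin_shift) simp
qed

lemma ebasis_cis: "ebasis n x = cis (freq n \<bullet> x) / of_real (2 * pi)"
  by (simp add: ebasis_def cis_conv_exp)

lemma cis_freq_measurable [measurable]: "(\<lambda>x. cis (freq n \<bullet> x)) \<in> borel_measurable borel"
  by (intro borel_measurable_continuous_onI continuous_intros)

lemma integral_torusM_cis:
  "(\<integral>x. cis (freq n \<bullet> x) \<partial>torusM) = (if n = 0 then of_real (4 * pi\<^sup>2) else 0)"
proof -
  have "(\<integral>x. cis (freq n \<bullet> x) \<partial>torusM)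
      = (\<integral>x. (\<integral>y. cis (of_int (fst n) * x) * cis (of_int (snd n) * y) \<partial>circM) \<partial>circM)"
    by (subst integral_torusM_iterated(1)[OF cis_freq_measurable, where B = 1]) (auto simp: freq_inner cis_mult)
  also have "\<dots> = (\<integral>x. cis (of_int (fst n) * x) \<partial>circM) * (\<integral>y. cis (of_int (snd n) * y) \<partial>circM)"
    by simp
  also have "\<dots> = (if n = 0 then of_real (4 * pi\<^sup>2) else 0)"
    unfolding integral_circM_cis by (cases n) (auto simp: power2_eq_square zero_prod_def)
  finally show ?thesis .
qed

lemma summable_on_int_inverse_square: "(\<lambda>m::int. 1 / (1 + (of_int m)\<^sup>2) :: real) summable_on UNIV"
proof -
  let ?f = "\<lambda>m::int. 1 / (1 + (of_int m)\<^sup>2) :: real"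
  have "summable (\<lambda>n::nat. 1 / (real n)\<^sup>2)"
    using inverse_power_summable[of 2, where 'a=real] by (simp add: inverse_eq_divide)
  then have "summable (\<lambda>n::nat. 1 / (1 + (real n)\<^sup>2))"
    by (rule summable_comparison_test_ev[rotated])
       (auto simp: eventually_sequentially intro!: exI[of _ 1] divide_left_mono mult_pos_pos add_pos_nonneg)
  then have nat: "(\<lambda>n::nat. 1 / (1 + (real n)\<^sup>2)) summable_on UNIV"
    by (intro summable_nonneg_imp_summable_on) auto
  have "?f summable_on (range int)"
    by (subst summable_on_reindex) (use nat in \<open>auto simp: o_def\<close>)
  moreover have "?f summable_on (range (\<lambda>n. - int n))"
    by (subst summable_on_reindex) (use nat in \<open>auto simp: o_def inj_on_def\<close>)
  ultimately have "?f summable_on (range int \<union> range (\<lambda>n. - int n))"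
    by (rule summable_on_union)
  also have "range int \<union> range (\<lambda>n. - int n) = UNIV"
    by (auto simp: image_iff) (metis int_cases2)
  finally show ?thesis .
qed

lemma summable_on_product_real:
  fixes f :: "'a \<Rightarrow> real" and g :: "'b \<Rightarrow> real"
  assumes f: "f summable_on UNIV" and g: "g summable_on UNIV"
    and "\<And>x. f x \<ge> 0" "\<And>y. g y \<ge> 0"
  shows "(\<lambda>(x, y). f x * g y) summable_on UNIV"
proof -
  have "(\<lambda>p. norm (f (fst p) * g (snd p))) summable_on (UNIV \<times> UNIV)"
    unfolding Infinite_Sum.abs_summable_on_Sigma_iff
    using assms by (auto simp: abs_mult infsum_cmult_right' intro!: summable_on_cmult_right summable_on_cmult_left)
  then show ?thesis using assms by (simp add: case_prod_unfold)
qed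

lemma jbracket_ge_1: "1 \<le> jbracket n"
  unfolding jbracket_def by simp

lemma jbracket_pos [simp]: "0 < jbracket n"
  using jbracket_ge_1[of n] by linarith

lemma jbracket_square: "(jbracket n)\<^sup>2 = 1 + (of_int (fst n))\<^sup>2 + (of_int (snd n))\<^sup>2"
  by (simp add: jbracket_def freq_def norm_Pair)

lemma jbracket_minus [simp]: "jbracket (- n) = jbracket n"
  by (simp add: jbracket_def freq_minus)

text \<open>The fourth power dominates (1 + m^2) (1 + k^2), which reduces the lattice sum to one
  dimension. This is the standard summable weight in what follows.\<close>

lemma summable_on_jbracket4: "(\<lambda>n. 1 / jbracket n ^ 4) summable_on UNIV"
proof -
  let ?f = "\<lambda>m::int. 1 / (1 + (of_int m)\<^sup>2) :: real"
  have "(\<lambda>(m, k). ?f m * ?f k) summable_on UNIV"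
    by (rule summable_on_product_real[OF summable_on_int_inverse_square summable_on_int_inverse_square]) simp_all
  then show ?thesis
  proof (rule summable_on_comparison_test)
    fix n :: "int \<times> int"
    obtain m k where [simp]: "n = (m, k)" by (cases n)
    have "(1 + (of_int m)\<^sup>2) * (1 + (of_int k)\<^sup>2) \<le> (jbracket n)\<^sup>2 * (jbracket n)\<^sup>2"
      unfolding jbracket_square by (intro mult_mono) auto
    also have "\<dots> = jbracket n ^ 4" by (simp flip: power_add)
    finally have "(1 + (of_int m)\<^sup>2) * (1 + (of_int k)\<^sup>2) \<le> jbracket n ^ 4" .
    then have "1 / jbracket n ^ 4 \<le> 1 / ((1 + (of_int m)\<^sup>2) * (1 + (of_int k)\<^sup>2))"
      by (intro divide_left_mono mult_pos_pos add_pos_nonneg zero_less_power) simp_all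
    then show "1 / jbracket n ^ 4 \<le> (case n of (m, k) \<Rightarrow> ?f m * ?f k)" by simp
  qed (simp add: less_imp_le)
qed

lemma borel_measurable_cnj [measurable]:
  "f \<in> borel_measurable M \<Longrightarrow> (\<lambda>x. cnj (f x)) \<in> borel_measurable M"
  by (rule borel_measurable_continuous_on[of cnj]) (intro continuous_intros)

lemma freq_diff: "freq (n - m) = freq n - freq m"
  by (simp add: freq_def)

section \<open>Absolutely convergent trigonometric series and Parseval's identity\<close>

definition trig_series :: "(int \<times> int \<Rightarrow> complex) \<Rightarrow> real \<times> real \<Rightarrow> complex" where
  "trig_series c x = (\<Sum>\<^sub>\<infinity>n. c n * cis (freq n \<bullet> x))"

context
  fixes c :: "int \<times> int \<Rightarrow> complex"
  assumes c: "(\<lambda>n. norm (c n)) summable_on UNIV"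
begin

lemma has_sum_trig_series: "((\<lambda>n. c n * cis (freq n \<bullet> x)) has_sum trig_series c x) UNIV"
proof -
  have "(\<lambda>n. norm (c n * cis (freq n \<bullet> x))) summable_on UNIV" using c by (simp only: norm_mult norm_cis mult_1_right)
  then show ?thesis unfolding trig_series_def by (rule has_sum_infsum[OF abs_summable_summable])
qed

lemma trig_series_norm_le: "norm (trig_series c x) \<le> (\<Sum>\<^sub>\<infinity>n. norm (c n))"
  by (rule norm_infsum_le[OF has_sum_trig_series has_sum_infsum[OF c]]) (simp add: norm_mult)

lemma continuous_trig_series: "continuous_on UNIV (trig_series c)"
proof (rule uniform_limit_theorem)
  show "uniform_limit UNIV (\<lambda>X x. \<Sum>n\<in>X. c n * cis (freq n \<bullet> x)) (trig_series c) (finite_subsets_at_top UNIV)"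
    by (rule Weierstrass_m_test_general'[OF _ has_sum_trig_series c]) (simp add: norm_mult)
qed (auto intro!: always_eventually continuous_intros)

lemma trig_series_measurable: "trig_series c \<in> borel_measurable borel"
  using continuous_trig_series by (rule borel_measurable_continuous_onI)

lemma torus_periodic_trig_series: "torus_periodic (trig_series c)"
  using torus_periodic_cis by (simp add: torus_periodic_def trig_series_def)

lemma has_sum_integral_trig_series:
  assumes f: "f \<in> borel_measurable borel" "\<And>x. norm (f x) \<le> B"
  shows "((\<lambda>n. c n * (\<integral>x. cis (freq n \<bullet> x) * f x \<partial>torusM)) has_sum
           (\<integral>x. trig_series c x * f x \<partial>torusM)) UNIV"
proof -
  have "((\<lambda>n. \<integral>x. c n * cis (freq n \<bullet> x) * f x \<partial>torusM) has_sum
           (\<integral>x. trig_series c x * f x \<partial>torusM)) UNIV"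
  proof (rule has_sum_integral_dominated[where B = "\<lambda>n. norm (c n) * B"])
    show "finite_measure torusM" by (rule torusM.finite_measure_axioms)
    show "norm (c n * cis (freq n \<bullet> x) * f x) \<le> norm (c n) * B" for n x
      using f(2)[of x] by (simp add: norm_mult mult_left_mono)
    show "(\<lambda>n. norm (c n) * B) summable_on UNIV" by (intro summable_on_cmult_left c)
    show "((\<lambda>n. c n * cis (freq n \<bullet> x) * f x) has_sum trig_series c x * f x) UNIV" for x
      by (intro has_sum_cmult_left has_sum_trig_series)
  qed (use f(1) trig_series_measurable in auto)
  then show ?thesis by (simp add: mult.assoc)
qed

text \<open>With absolutely summable coefficients two termwise integrations suffice: one against a
  single mode, which reads off a coefficient, and one against the conjugate of the series
  itself.\<close>

lemma parseval_trig_series: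
  "(\<integral>x. (norm (trig_series c x))\<^sup>2 \<partial>torusM) = 4 * pi\<^sup>2 * (\<Sum>\<^sub>\<infinity>n. (norm (c n))\<^sup>2)"
proof -
  have coeff: "(\<integral>x. cnj (trig_series c x) * cis (freq n \<bullet> x) \<partial>torusM) = cnj (c n) * of_real (4 * pi\<^sup>2)" for n
  proof -
    have "((\<lambda>m. c m * (\<integral>x. cis (freq m \<bullet> x) * cnj (cis (freq n \<bullet> x)) \<partial>torusM)) has_sum
           (\<integral>x. trig_series c x * cnj (cis (freq n \<bullet> x)) \<partial>torusM)) UNIV"
      by (rule has_sum_integral_trig_series[of _ 1]) auto
    moreover have "(\<integral>x. cis (freq m \<bullet> x) * cnj (cis (freq n \<bullet> x)) \<partial>torusM) = (if m = n then of_real (4 * pi\<^sup>2) else 0)" for m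
    proof -
      have "cis (freq m \<bullet> x) * cnj (cis (freq n \<bullet> x)) = cis (freq (m - n) \<bullet> x)" for x
        by (simp add: cis_cnj cis_mult freq_diff inner_diff_left)
      then show ?thesis using integral_torusM_cis[of "m - n"] by simp
    qed
    ultimately have "((\<lambda>m. if m = n then c m * of_real (4 * pi\<^sup>2) else 0) has_sum
           (\<integral>x. trig_series c x * cnj (cis (freq n \<bullet> x)) \<partial>torusM)) UNIV"
      by (simp add: if_distrib cong: if_cong)
    moreover have "((\<lambda>m. if m = n then c m * of_real (4 * pi\<^sup>2) else 0) has_sum c n * of_real (4 * pi\<^sup>2)) UNIV"
      by (rule has_sum_finite_neutralI[of "{n}"]) auto
    ultimately have e1: "(\<integral>x. trig_series c x * cnj (cis (freq n \<bullet> x)) \<partial>torusM) = c n * of_real (4 * pi\<^sup>2)"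
      using has_sum_unique by blast
    have e2: "(\<integral>x. cnj (trig_series c x) * cis (freq n \<bullet> x) \<partial>torusM)
        = (\<integral>x. cnj (trig_series c x * cnj (cis (freq n \<bullet> x))) \<partial>torusM)" by (simp only: complex_cnj_mult complex_cnj_cnj)
    show ?thesis by (subst e2, subst Bochner_Integration.integral_cnj, subst e1) simp
  qed
  have "((\<lambda>n. c n * (\<integral>x. cis (freq n \<bullet> x) * cnj (trig_series c x) \<partial>torusM)) has_sum
           (\<integral>x. trig_series c x * cnj (trig_series c x) \<partial>torusM)) UNIV"
    by (rule has_sum_integral_trig_series) (use trig_series_measurable trig_series_norm_le in auto)
  also have "(\<lambda>n. c n * (\<integral>x. cis (freq n \<bullet> x) * cnj (trig_series c x) \<partial>torusM)) = (\<lambda>n. of_real ((norm (c n))\<^sup>2 * (4 * pi\<^sup>2)))"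
    unfolding mult.commute[of "cis _"] coeff by (simp only: of_real_mult[of "(norm _)\<^sup>2"] complex_norm_square mult.assoc)
  also have "(\<integral>x. trig_series c x * cnj (trig_series c x) \<partial>torusM) = of_real (\<integral>x. (norm (trig_series c x))\<^sup>2 \<partial>torusM)"
    unfolding complex_norm_square[symmetric] by (rule integral_complex_of_real)
  finally have "((\<lambda>n. (norm (c n))\<^sup>2 * (4 * pi\<^sup>2)) has_sum (\<integral>x. (norm (trig_series c x))\<^sup>2 \<partial>torusM)) UNIV"
    unfolding has_sum_of_real_iff .
  from infsumI[OF this] show ?thesis by (simp add: infsum_cmult_left' mult.commute)
qed

end

section \<open>Rapid decay of the Fourier coefficients of test functions\<close>

abbreviation test_coeff :: "(real \<times> real \<Rightarrow> real) \<Rightarrow> int \<times> int \<Rightarrow> complex" where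
  "test_coeff \<phi> n \<equiv> (\<integral>x. of_real (\<phi> x) * cis (freq n \<bullet> x) \<partial>torusM)"

lemma torus_test_continuous: "\<phi> \<in> torus_test \<Longrightarrow> continuous_on S \<phi>"
  by (simp add: torus_test_def smooth_fun_continuous_on)

lemma torus_test_measurable: "\<phi> \<in> torus_test \<Longrightarrow> \<phi> \<in> borel_measurable borel"
  by (intro borel_measurable_continuous_onI torus_test_continuous)

text \<open>D is the derivative in direction b of the periodic function P. Its integral vanishes by
  the fundamental theorem in that variable, and the product rule splits it into the two sides of the
  identity.\<close>

lemma test_coeff_by_parts:
  assumes \<phi>: "\<phi> \<in> torus_test" and b: "b \<in> Basis"
  shows "test_coeff (iter_partial [b] \<phi>) n = - \<i> * of_real (freq n \<bullet> b) * test_coeff \<phi> n"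
proof -
  define D where "D x = of_real (iter_partial [b] \<phi> x) * cis (freq n \<bullet> x)
      + of_real (\<phi> x) * (of_real (freq n \<bullet> b) * (\<i> * cis (freq n \<bullet> x)))" for x
  define P where "P x = of_real (\<phi> x) * cis (freq n \<bullet> x)" for x
  note \<phi>' = torus_test_iter_partial[OF \<phi>, of "[b]"]
  have contD: "continuous_on UNIV D" unfolding D_def
    using torus_test_continuous[OF \<phi>, of UNIV] torus_test_continuous[OF \<phi>', of UNIV] b
    by (intro continuous_intros) auto
  have perP: "torus_periodic P" and perD: "torus_periodic D"
    using \<phi> \<phi>' b torus_periodic_cis[of n] by (auto simp: torus_periodic_def P_def D_def torus_test_def)
  have der: "(P has_derivative (\<lambda>h. of_real (frechet_derivative \<phi> (at x) h) * cis (freq n \<bullet> x)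
      + of_real (\<phi> x) * (of_real (freq n \<bullet> h) * (\<i> * cis (freq n \<bullet> x))))) (at x)" for x
  proof -
    have "(\<phi> has_derivative frechet_derivative \<phi> (at x)) (at x)"
      using smooth_fun_has_derivative \<phi> by (auto simp: torus_test_def)
    then show ?thesis unfolding P_def
      by (auto intro!: derivative_eq_intros simp: scaleR_conv_of_real algebra_simps)
  qed
  have dir: "((\<lambda>t. P (x + t *\<^sub>R b)) has_vector_derivative D (x + t *\<^sub>R b)) (at t)" for x t
  proof -
    have "((\<lambda>t. x + t *\<^sub>R b) has_vector_derivative b) (at t)"
      by (auto intro!: derivative_eq_intros)
    from vector_derivative_diff_chain_within[OF this has_derivative_at_withinI[OF der]]
    show ?thesis by (simp add: o_def D_def)
  qed
  obtain B where B: "\<And>x. norm (D x) \<le> B" using torus_periodic_bounded[OF perD contD] by blast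
  have Dm: "D \<in> borel_measurable borel" using contD by (rule borel_measurable_continuous_onI)
  note it = integral_torusM_iterated[OF Dm B]
  have "b = (1, 0) \<or> b = (0, 1)" using b by (auto simp: Basis_prod_def)
  then have "(\<integral>x. D x \<partial>torusM) = 0"
  proof
    assume b: "b = (1, 0)"
    have "(\<integral>x. D (x, y) \<partial>circM) = P (pi, y) - P (- pi, y)" for y
      by (rule integral_circM_FTC) (use dir[of "(0, y)"] b continuous_on_Pair1[OF contD] in auto)
    moreover have "P (pi, y) = P (- pi, y)" for y
      using perP[unfolded torus_periodic_def, rule_format, of "-pi" y] by simp
    ultimately show ?thesis by (simp add: it(2))
  next
    assume b: "b = (0, 1)"
    have "(\<integral>y. D (x, y) \<partial>circM) = P (x, pi) - P (x, - pi)" for x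
      by (rule integral_circM_FTC) (use dir[of "(x, 0)"] b continuous_on_Pair2[OF contD] in auto)
    moreover have "P (x, pi) = P (x, - pi)" for x
      using perP[unfolded torus_periodic_def, rule_format, of x "-pi"] by simp
    ultimately show ?thesis by (simp add: it(1))
  qed
  moreover have "(\<integral>x. D x \<partial>torusM) = test_coeff (iter_partial [b] \<phi>) n + \<i> * of_real (freq n \<bullet> b) * test_coeff \<phi> n"
  proof -
    have int: "integrable torusM (\<lambda>x. of_real (\<psi> x) * cis (freq n \<bullet> x))" if \<psi>: "\<psi> \<in> torus_test" for \<psi>
    proof -
      obtain B where "\<And>x. \<bar>\<psi> x\<bar> \<le> B" using torus_test_bounded[OF \<psi>] by blast
      then show ?thesis using torus_test_measurable[OF \<psi>]
        by (intro torusM.integrable_const_bound[of _ B]) (auto simp: norm_mult)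
    qed
    have "D x = of_real (iter_partial [b] \<phi> x) * cis (freq n \<bullet> x)
       + \<i> * of_real (freq n \<bullet> b) * (of_real (\<phi> x) * cis (freq n \<bullet> x))" for x
      by (simp add: D_def)
    then show ?thesis
      using int[OF \<phi>] int[OF \<phi>'] b by (simp del: iter_partial.simps)
  qed
  ultimately show ?thesis by (simp add: add_eq_0_iff del: iter_partial.simps)
qed

text \<open>
  The coefficients \<open>1\<close> are kept so that this is literally an iterated linear combination, the form
  under which \<open>torus_test\<close> and \<open>Ck_norm\<close> are known to behave well.
\<close>

definition bessel_op :: "(real \<times> real \<Rightarrow> real) \<Rightarrow> real \<times> real \<Rightarrow> real" where
  "bessel_op \<phi> x = 1 * \<phi> x + (-1) * (1 * iter_partial [(1, 0), (1, 0)] \<phi> x + 1 * iter_partial [(0, 1), (0, 1)] \<phi> x)"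

lemma Basis_prod_real: "(1, 0) \<in> (Basis :: (real \<times> real) set)" "(0, 1) \<in> (Basis :: (real \<times> real) set)"
  by (auto simp: Basis_prod_def)

lemma bessel_op_test: "\<phi> \<in> torus_test \<Longrightarrow> bessel_op \<phi> \<in> torus_test"
  unfolding bessel_op_def[abs_def]
  by (intro torus_test_lincomb torus_test_iter_partial) (auto simp: Basis_prod_real)

lemma Ck_norm_bessel_op:
  assumes \<phi>: "\<phi> \<in> torus_test" shows "Ck_norm k (bessel_op \<phi>) \<le> 3 * Ck_norm (k + 2) \<phi>"
proof (rule Ck_norm_least)
  fix bs :: "(real \<times> real) list" and x assume bs: "set bs \<subseteq> Basis" "length bs \<le> k"
  let ?e = "[(1, 0), (1, 0)] :: (real \<times> real) list" and ?f = "[(0, 1), (0, 1)] :: (real \<times> real) list"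
  have sm: "smooth_fun \<phi>" using \<phi> by (simp add: torus_test_def)
  have sm2: "smooth_fun (iter_partial ?e \<phi>)" "smooth_fun (iter_partial ?f \<phi>)"
    by (intro smooth_fun_iter_partial[OF sm]; simp add: Basis_prod_real)+
  have "iter_partial bs (bessel_op \<phi>) = (\<lambda>x. 1 * iter_partial bs \<phi> x + (-1) *
      (1 * iter_partial (bs @ ?e) \<phi> x + 1 * iter_partial (bs @ ?f) \<phi> x))"
    unfolding bessel_op_def[abs_def] iter_partial_append
    by (subst iter_partial_lincomb[OF sm smooth_fun_lincomb[OF sm2] bs(1)])
       (subst iter_partial_lincomb[OF sm2 bs(1)], rule refl)
  moreover have "\<bar>iter_partial bs \<phi> x\<bar> \<le> Ck_norm (k + 2) \<phi>"
    "\<bar>iter_partial (bs @ ?e) \<phi> x\<bar> \<le> Ck_norm (k + 2) \<phi>"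
    "\<bar>iter_partial (bs @ ?f) \<phi> x\<bar> \<le> Ck_norm (k + 2) \<phi>"
    by (intro Ck_norm_upper[OF \<phi>]; use bs in \<open>simp add: Basis_prod_real\<close>)+
  ultimately show "\<bar>iter_partial bs (bessel_op \<phi>) x\<bar> \<le> 3 * Ck_norm (k + 2) \<phi>" by simp
qed

lemma test_coeff_lincomb:
  assumes "\<phi> \<in> torus_test" "\<psi> \<in> torus_test"
  shows "test_coeff (\<lambda>x. a * \<phi> x + b * \<psi> x) n = of_real a * test_coeff \<phi> n + of_real b * test_coeff \<psi> n"
proof -
  have int: "integrable torusM (\<lambda>x. of_real (\<psi> x) * cis (freq n \<bullet> x))" if \<psi>: "\<psi> \<in> torus_test" for \<psi>
  proof -
    obtain B where "\<And>x. \<bar>\<psi> x\<bar> \<le> B" using torus_test_bounded[OF \<psi>] by blast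
    then show ?thesis using torus_test_measurable[OF \<psi>]
      by (intro torusM.integrable_const_bound[of _ B]) (auto simp: norm_mult)
  qed
  have "of_real (a * \<phi> x + b * \<psi> x) * cis (freq n \<bullet> x) =
      of_real a * (of_real (\<phi> x) * cis (freq n \<bullet> x)) + of_real b * (of_real (\<psi> x) * cis (freq n \<bullet> x))" for x
    by (simp add: algebra_simps)
  then show ?thesis using int assms by simp
qed

text \<open>\<open>bessel_op\<close> is the identity minus the Laplacian, with symbol 1 + |n|^2; two
  integrations by parts in each direction.\<close>

lemma test_coeff_bessel_op:
  assumes \<phi>: "\<phi> \<in> torus_test"
  shows "test_coeff (bessel_op \<phi>) n = of_real ((jbracket n)\<^sup>2) * test_coeff \<phi> n"
proof -
  have 2: "test_coeff (iter_partial [b, b] \<phi>) n = - of_real ((freq n \<bullet> b)\<^sup>2) * test_coeff \<phi> n"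
    if b: "b \<in> Basis" for b
  proof -
    have i2: "- \<i> * a * (- \<i> * a * c) = - (a\<^sup>2) * c" for a c :: complex
      by (simp add: complex_eq_iff power2_eq_square algebra_simps)
    have "test_coeff (iter_partial [b] (iter_partial [b] \<phi>)) n = - of_real ((freq n \<bullet> b)\<^sup>2) * test_coeff \<phi> n"
      by (subst test_coeff_by_parts[OF torus_test_iter_partial[OF \<phi>] b], use b in simp,
          subst test_coeff_by_parts[OF \<phi> b]) (simp only: i2 of_real_power)
    then show ?thesis by simp
  qed
  have t: "iter_partial [(1, 0), (1, 0)] \<phi> \<in> torus_test" "iter_partial [(0, 1), (0, 1)] \<phi> \<in> torus_test"
    by (intro torus_test_iter_partial \<phi>; simp add: Basis_prod_real)+
  show ?thesis unfolding bessel_op_def[abs_def]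
    by (subst test_coeff_lincomb[OF \<phi> torus_test_lincomb[OF t]], subst test_coeff_lincomb[OF t],
        subst 2[OF Basis_prod_real(1)], subst 2[OF Basis_prod_real(2)])
       (simp add: jbracket_square freq_def inner_prod_def algebra_simps)
qed

lemma test_coeff_bound:
  assumes "\<And>x. \<bar>\<phi> x\<bar> \<le> B" shows "norm (test_coeff \<phi> n) \<le> 4 * pi\<^sup>2 * B"
proof -
  have B: "0 \<le> B" using assms[of 0] by linarith
  have "norm (test_coeff \<phi> n) \<le> (\<integral>x. norm (of_real (\<phi> x) * cis (freq n \<bullet> x)) \<partial>torusM)"
    by (rule integral_norm_bound)
  also have "\<dots> = (\<integral>x. \<bar>\<phi> x\<bar> \<partial>torusM)" by (simp add: norm_mult)
  also have "\<dots> \<le> (\<integral>x. B \<partial>torusM)"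
  proof (cases "integrable torusM (\<lambda>x. \<bar>\<phi> x\<bar>)")
    case True
    then show ?thesis using assms by (intro integral_mono) auto
  qed (use B in \<open>simp add: not_integrable_integral_eq\<close>)
  also have "\<dots> = 4 * pi\<^sup>2 * B" by simp
  finally show ?thesis .
qed

text \<open>Each application of \<open>bessel_op\<close> gains two powers of
  \<open>jbracket n\<close> at the price of two derivatives and a factor 3; the remaining 4 pi^2 is
  the area of the torus.\<close>

lemma test_coeff_decay:
  assumes "\<phi> \<in> torus_test"
  shows "jbracket n ^ (2 * j) * norm (test_coeff \<phi> n) \<le> 4 * pi\<^sup>2 * 3 ^ j * Ck_norm (2 * j) \<phi>"
  using assms
proof (induction j arbitrary: \<phi>)
  case 0
  have "norm (test_coeff \<phi> n) \<le> 4 * pi\<^sup>2 * Ck_norm 0 \<phi>"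
    by (rule test_coeff_bound) (use Ck_norm_upper[OF 0, of "[]" 0] in auto)
  then show ?case by simp
next
  case (Suc j)
  have "jbracket n ^ (2 * Suc j) * norm (test_coeff \<phi> n) = jbracket n ^ (2 * j) * norm (test_coeff (bessel_op \<phi>) n)"
    unfolding test_coeff_bessel_op[OF Suc.prems] by (simp add: norm_mult power2_eq_square)
  also have "\<dots> \<le> 4 * pi\<^sup>2 * 3 ^ j * Ck_norm (2 * j) (bessel_op \<phi>)"
    by (rule Suc.IH[OF bessel_op_test[OF Suc.prems]])
  also have "\<dots> \<le> 4 * pi\<^sup>2 * 3 ^ j * (3 * Ck_norm (2 * j + 2) \<phi>)"
    by (intro mult_left_mono Ck_norm_bessel_op Suc.prems) auto
  finally show ?case by simp
qed

section \<open>Distributions with polynomially bounded coefficients\<close>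

lemma jbracket_nonzero [simp]: "jbracket n \<noteq> 0"
  using jbracket_pos[of n] by linarith

text \<open>The constant C and the exponent k range over the natural numbers so that the condition
  is a countable combination of conditions on single coefficients, hence a measurable event when c
  is random.\<close>

definition poly_coeffs :: "(int \<times> int \<Rightarrow> complex) \<Rightarrow> bool" where
  "poly_coeffs c \<longleftrightarrow> (\<exists>k C::nat. \<forall>n. norm (c n) \<le> real C * jbracket n ^ k) \<and> (\<forall>n. c (- n) = cnj (c n))"

text \<open>\<open>test_coeff \<phi> n / of_real (2 * pi)\<close> is the pairing of
  \<open>ebasis n\<close> with the test function, without conjugation. For coefficients with c (- n)
  = cnj (c n) the terms at n and - n are conjugate, so the sum is real and \<open>Re\<close>
  discards nothing.\<close>

definition series_distribution :: "(int \<times> int \<Rightarrow> complex) \<Rightarrow> (real \<times> real \<Rightarrow> real) \<Rightarrow> real" where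
  "series_distribution c = (\<lambda>\<phi>\<in>torus_test. Re (\<Sum>\<^sub>\<infinity>n. c n * (test_coeff \<phi> n / of_real (2 * pi))))"

lemma integral_ebasis_test:
  assumes "\<phi> \<in> torus_test"
  shows "(LINT x:torus_cell|lborel. ebasis n x * of_real (\<phi> x)) = test_coeff \<phi> n / of_real (2 * pi)"
proof -
  note [measurable] = torus_test_measurable[OF assms]
  have "(LINT x:torus_cell|lborel. ebasis n x * of_real (\<phi> x)) = (\<integral>x. ebasis n x * of_real (\<phi> x) \<partial>torusM)"
    by (rule set_integral_torus) (simp add: ebasis_cis)
  also have "\<dots> = (\<integral>x. of_real (\<phi> x) * cis (freq n \<bullet> x) / of_real (2 * pi) \<partial>torusM)"
    by (simp add: ebasis_cis mult.commute)
  also have "\<dots> = test_coeff \<phi> n / of_real (2 * pi)" by (rule integral_divide_zero)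
  finally show ?thesis .
qed

lemma fourier_series_to_iff:
  "fourier_series_to c u \<longleftrightarrow>
     (\<forall>\<phi>\<in>torus_test. ((\<lambda>n. c n * (test_coeff \<phi> n / of_real (2 * pi))) has_sum of_real (u \<phi>)) UNIV)"
  unfolding fourier_series_to_def by (simp add: integral_ebasis_test)

text \<open>A test function gives decay of order 2 k + 4. Against coefficients of growth k, bounded
  generously by growth 2 k, a summable fourth power remains.\<close>

lemma poly_coeffs_test_bound:
  assumes c: "\<And>n. norm (c n) \<le> C * jbracket n ^ k" and \<phi>: "\<phi> \<in> torus_test"
  shows "norm (c n * (test_coeff \<phi> n / of_real (2 * pi)))
      \<le> C * (2 * pi * 3 ^ (k + 2) * Ck_norm (2 * (k + 2)) \<phi>) * (1 / jbracket n ^ 4)"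
proof -
  have C: "0 \<le> C"
    using order_trans[OF norm_ge_zero c[of 0]] zero_less_power[OF jbracket_pos[of 0], of k]
    by (simp add: zero_le_mult_iff)
  have J: "jbracket n ^ (2 * (k + 2)) = jbracket n ^ (2 * k) * jbracket n ^ 4"
  proof -
    have "2 * (k + 2) = 2 * k + 4" by simp
    then show ?thesis by (simp only: power_add)
  qed
  have "jbracket n ^ (2 * k) * norm (test_coeff \<phi> n) * jbracket n ^ 4 \<le> 4 * pi\<^sup>2 * 3 ^ (k + 2) * Ck_norm (2 * (k + 2)) \<phi>"
    using test_coeff_decay[OF \<phi>, of n "k + 2"] unfolding J by (simp only: mult_ac)
  then have 1: "jbracket n ^ (2 * k) * norm (test_coeff \<phi> n) \<le> 4 * pi\<^sup>2 * 3 ^ (k + 2) * Ck_norm (2 * (k + 2)) \<phi> / jbracket n ^ 4"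
    by (subst pos_le_divide_eq) (simp_all only: zero_less_power jbracket_pos)
  have "norm (c n) * norm (test_coeff \<phi> n) \<le> C * jbracket n ^ k * norm (test_coeff \<phi> n)"
    by (intro mult_right_mono c) auto
  also have "\<dots> \<le> C * jbracket n ^ (2 * k) * norm (test_coeff \<phi> n)"
    using C jbracket_ge_1[of n] by (intro mult_right_mono mult_left_mono power_increasing) auto
  also have "\<dots> = C * (jbracket n ^ (2 * k) * norm (test_coeff \<phi> n))" by (simp only: mult.assoc)
  also have "\<dots> \<le> C * (4 * pi\<^sup>2 * 3 ^ (k + 2) * Ck_norm (2 * (k + 2)) \<phi> / jbracket n ^ 4)"
    by (rule mult_left_mono[OF 1 C])
  finally have 2: "norm (c n) * norm (test_coeff \<phi> n) \<le> C * (4 * pi\<^sup>2 * 3 ^ (k + 2) * Ck_norm (2 * (k + 2)) \<phi> / jbracket n ^ 4)" .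
  have "norm (c n * (test_coeff \<phi> n / of_real (2 * pi))) = norm (c n) * norm (test_coeff \<phi> n) / (2 * pi)"
    by (simp add: norm_mult norm_divide)
  also have "\<dots> \<le> C * (4 * pi\<^sup>2 * 3 ^ (k + 2) * Ck_norm (2 * (k + 2)) \<phi> / jbracket n ^ 4) / (2 * pi)"
    by (rule divide_right_mono[OF 2]) simp
  also have "\<dots> = C * (2 * pi * 3 ^ (k + 2) * Ck_norm (2 * (k + 2)) \<phi>) * (1 / jbracket n ^ 4)"
    by (simp add: power2_eq_square field_simps)
  finally show ?thesis .
qed

lemma test_coeff_minus: "test_coeff \<phi> (- n) = cnj (test_coeff \<phi> n)"
  by (subst Bochner_Integration.integral_cnj[symmetric]) (simp add: freq_minus cis_cnj)

context
  fixes c assumes pc: "poly_coeffs c"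
begin

lemma summable_on_test: "\<phi> \<in> torus_test \<Longrightarrow> (\<lambda>n. norm (c n * (test_coeff \<phi> n / of_real (2 * pi)))) summable_on UNIV"
proof -
  assume \<phi>: "\<phi> \<in> torus_test"
  obtain k C where c: "\<And>n. norm (c n) \<le> real C * jbracket n ^ k" using pc by (auto simp: poly_coeffs_def)
  show ?thesis
    by (rule Infinite_Sum.abs_summable_on_comparison_test'[OF _ poly_coeffs_test_bound[OF c \<phi>]])
       (intro summable_on_cmult_right summable_on_jbracket4)
qed

lemma has_sum_series_distribution:
  assumes \<phi>: "\<phi> \<in> torus_test"
  shows "((\<lambda>n. c n * (test_coeff \<phi> n / of_real (2 * pi))) has_sum of_real (series_distribution c \<phi>)) UNIV"
proof -
  let ?f = "\<lambda>n. c n * (test_coeff \<phi> n / of_real (2 * pi))"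
  define S where "S = infsum ?f UNIV"
  have S: "(?f has_sum S) UNIV" unfolding S_def
    by (rule has_sum_infsum[OF abs_summable_summable[OF summable_on_test[OF \<phi>]]])
  then have "((\<lambda>n. cnj (?f n)) has_sum cnj S) UNIV" by (simp only: has_sum_cnj_iff)
  also have "?this \<longleftrightarrow> (?f has_sum cnj S) UNIV"
    by (rule has_sum_reindex_bij_witness[of _ uminus uminus])
       (use pc in \<open>auto simp: poly_coeffs_def test_coeff_minus\<close>)
  finally have "cnj S = S" using S has_sum_unique by blast
  then have "S = of_real (Re S)" by (simp add: complex_eq_iff)
  then show ?thesis using S \<phi> by (simp add: series_distribution_def S_def)
qed

lemma series_distribution_in: "series_distribution c \<in> torus_distributions"
  unfolding torus_distributions_def
proof (intro CollectI conjI ballI allI)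
  show "series_distribution c \<in> extensional torus_test" by (simp add: series_distribution_def)
next
  fix \<phi> \<psi> :: "real \<times> real \<Rightarrow> real" and a b :: real
  assume t: "\<phi> \<in> torus_test" "\<psi> \<in> torus_test"
  let ?\<chi> = "\<lambda>x. a * \<phi> x + b * \<psi> x"
  have "((\<lambda>n. of_real a * (c n * (test_coeff \<phi> n / of_real (2 * pi))) + of_real b * (c n * (test_coeff \<psi> n / of_real (2 * pi))))
      has_sum (of_real a * of_real (series_distribution c \<phi>) + of_real b * of_real (series_distribution c \<psi>))) UNIV"
    by (intro has_sum_add has_sum_cmult_right has_sum_series_distribution t)
  also have "(\<lambda>n. of_real a * (c n * (test_coeff \<phi> n / of_real (2 * pi))) + of_real b * (c n * (test_coeff \<psi> n / of_real (2 * pi))))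
     = (\<lambda>n. c n * (test_coeff ?\<chi> n / of_real (2 * pi)))"
    by (simp only: test_coeff_lincomb[OF t] add_divide_distrib distrib_left times_divide_eq_right mult.left_commute)
  finally have "of_real (series_distribution c ?\<chi>) =
      (of_real a * of_real (series_distribution c \<phi>) + of_real b * of_real (series_distribution c \<psi>) :: complex)"
    using has_sum_unique has_sum_series_distribution[OF torus_test_lincomb[OF t]] by blast
  then have "of_real (series_distribution c ?\<chi>) =
      (of_real (a * series_distribution c \<phi> + b * series_distribution c \<psi>) :: complex)"
    by simp
  then show "series_distribution c ?\<chi> = a * series_distribution c \<phi> + b * series_distribution c \<psi>"
    unfolding of_real_eq_iff .
next
  obtain k C where c: "\<And>n. norm (c n) \<le> real C * jbracket n ^ k" using pc by (auto simp: poly_coeffs_def)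
  define S where "S = (\<Sum>\<^sub>\<infinity>n. 1 / jbracket n ^ 4)"
  show "\<exists>C k. \<forall>\<phi>\<in>torus_test. \<bar>series_distribution c \<phi>\<bar> \<le> C * Ck_norm k \<phi>"
  proof (intro exI ballI)
    fix \<phi> assume \<phi>: "\<phi> \<in> torus_test"
    have "((\<lambda>n. real C * (2 * pi * 3 ^ (k + 2) * Ck_norm (2 * (k + 2)) \<phi>) * (1 / jbracket n ^ 4)) has_sum
      real C * (2 * pi * 3 ^ (k + 2) * Ck_norm (2 * (k + 2)) \<phi>) * S) UNIV" unfolding S_def
      by (intro has_sum_cmult_right has_sum_infsum summable_on_jbracket4)
    from norm_infsum_le[OF has_sum_series_distribution[OF \<phi>] this poly_coeffs_test_bound[OF c \<phi>]]
    show "\<bar>series_distribution c \<phi>\<bar> \<le> (real C * (2 * pi * 3 ^ (k + 2)) * S) * Ck_norm (2 * (k + 2)) \<phi>"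
      by (simp add: mult_ac)
  qed
qed

end

lemma fourier_series_to_unique:
  assumes "u \<in> torus_distributions" "v \<in> torus_distributions" "fourier_series_to c u" "fourier_series_to c v"
  shows "u = v"
proof (rule extensionalityI[of _ torus_test])
  fix \<phi> assume "\<phi> \<in> torus_test"
  then have "of_real (u \<phi>) = (of_real (v \<phi>) :: complex)"
    using assms(3,4) has_sum_unique unfolding fourier_series_to_iff by blast
  then show "u \<phi> = v \<phi>" by simp
qed (use assms in \<open>auto simp: torus_distributions_def\<close>)

lemma test_coeff_trig:
  "test_coeff (\<lambda>x. A * cos (freq n \<bullet> x) + B * sin (freq n \<bullet> x)) m =
    (if m = - n then of_real (2 * pi\<^sup>2) * (of_real A - \<i> * of_real B) else 0) +
    (if m = n then of_real (2 * pi\<^sup>2) * (of_real A + \<i> * of_real B) else 0)"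
proof -
  let ?p = "(of_real A - \<i> * of_real B) / 2" and ?q = "(of_real A + \<i> * of_real B) / 2"
  have e: "of_real (A * cos t + B * sin t) * cis s = ?p * cis (s + t) + ?q * cis (s - t)" for s t
    by (simp add: complex_eq_iff cos_add sin_add cos_diff sin_diff algebra_simps add_divide_distrib diff_divide_distrib)
  have "test_coeff (\<lambda>x. A * cos (freq n \<bullet> x) + B * sin (freq n \<bullet> x)) m
     = (\<integral>x. ?p * cis (freq (m + n) \<bullet> x) + ?q * cis (freq (m - n) \<bullet> x) \<partial>torusM)"
    by (simp only: e freq_add freq_diff inner_add_left inner_diff_left)
  also have "\<dots> = ?p * (\<integral>x. cis (freq (m + n) \<bullet> x) \<partial>torusM) + ?q * (\<integral>x. cis (freq (m - n) \<bullet> x) \<partial>torusM)"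
  proof -
    have [simp]: "integrable torusM (\<lambda>x. cis (freq k \<bullet> x))" for k
      by (rule torusM.integrable_const_bound[of _ 1]) auto
    show ?thesis by simp
  qed
  also have "m + n = 0 \<longleftrightarrow> m = - n" by (simp add: add_eq_0_iff2)
  ultimately show ?thesis by (simp add: integral_torusM_cis)
qed

text \<open>Testing u against the cosine and the sine of frequency n yields two real numbers from
  which c n and c (- n) are recovered. That they are real forces c (- n) = cnj (c n), and the
  continuity of u with \<open>Ck_norm_trig\<close> gives the polynomial growth.\<close>

lemma poly_coeffs_of_distribution:
  assumes u: "u \<in> torus_distributions" and f: "fourier_series_to c u"
  shows "poly_coeffs c"
proof -
  obtain C k where C: "\<And>\<phi>. \<phi> \<in> torus_test \<Longrightarrow> \<bar>u \<phi>\<bar> \<le> C * Ck_norm k \<phi>"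
    using u unfolding torus_distributions_def by blast
  let ?t = "\<lambda>A B n x. A * cos (freq n \<bullet> x) + B * sin (freq n \<bullet> x)"
  \<comment> \<open>Only the frequencies n and - n meet this test function. For n = 0 they coincide
    and both contributions add up, so the formula covers this case as well.\<close>
  have eq: "of_real (u (?t A B n)) = of_real pi * ((of_real A - \<i> * of_real B) * c (- n) + (of_real A + \<i> * of_real B) * c n)"
    for A B n
  proof -
    have "((\<lambda>m. c m * (test_coeff (?t A B n) m / of_real (2 * pi))) has_sum of_real (u (?t A B n))) UNIV"
      using f unfolding fourier_series_to_iff by (rule bspec[OF _ torus_test_trig])
    moreover have "((\<lambda>m. (if m = - n then of_real pi * (of_real A - \<i> * of_real B) * c m else 0) +
        (if m = n then of_real pi * (of_real A + \<i> * of_real B) * c m else 0)) has_sum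
       (of_real pi * (of_real A - \<i> * of_real B) * c (- n) + of_real pi * (of_real A + \<i> * of_real B) * c n)) UNIV"
      by (intro has_sum_add has_sum_finite_neutralI[of "{- n}"] has_sum_finite_neutralI[of "{n}"]) auto
    moreover have "(\<lambda>m. c m * (test_coeff (?t A B n) m / of_real (2 * pi))) =
       (\<lambda>m. (if m = - n then of_real pi * (of_real A - \<i> * of_real B) * c m else 0) +
        (if m = n then of_real pi * (of_real A + \<i> * of_real B) * c m else 0))"
      unfolding test_coeff_trig by (auto simp: fun_eq_iff power2_eq_square field_simps)
    ultimately show ?thesis by (metis (no_types, lifting) distrib_left has_sum_unique mult.assoc)
  qed
  define a where "a n = u (?t 1 0 n) / pi" for n
  define b where "b n = u (?t 0 1 n) / pi" for n
  have ab: "of_real (a n) = c (- n) + c n" "of_real (b n) = \<i> * (c n - c (- n))" for n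
    using eq[where A = 1 and B = 0 and n = n] eq[where A = 0 and B = 1 and n = n] unfolding a_def b_def by (simp_all add: field_simps)
  have "\<i> * of_real (b n) = (\<i> * \<i>) * (c n - c (- n))" for n
    unfolding ab(2) by (simp only: mult.assoc)
  then have ib: "\<i> * of_real (b n) = c (- n) - c n" for n by simp
  have cn: "c n = (of_real (a n) - \<i> * of_real (b n)) / 2" "c (- n) = (of_real (a n) + \<i> * of_real (b n)) / 2" for n
    unfolding ab(1) ib by simp_all
  have ub: "\<bar>u (?t A B n)\<bar> \<le> \<bar>C\<bar> * jbracket n ^ k" if "\<bar>A\<bar> + \<bar>B\<bar> = 1" for A B n
  proof -
    have "\<bar>u (?t A B n)\<bar> \<le> C * Ck_norm k (?t A B n)" by (rule C[OF torus_test_trig])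
    also have "\<dots> \<le> \<bar>C\<bar> * Ck_norm k (?t A B n)"
      by (intro mult_right_mono Ck_norm_nonneg torus_test_trig) auto
    also have "\<dots> \<le> \<bar>C\<bar> * (jbracket n ^ k * (\<bar>A\<bar> + \<bar>B\<bar>))"
      by (intro mult_left_mono Ck_norm_trig) auto
    finally show ?thesis using that by simp
  qed
  have "norm (c n) \<le> real (nat \<lceil>\<bar>C\<bar>\<rceil>) * jbracket n ^ k" for n
  proof -
    have "norm (c n) = norm (of_real (a n) - \<i> * of_real (b n)) / 2" unfolding cn(1)[of n] by (simp add: norm_divide)
    also have "\<dots> \<le> (\<bar>a n\<bar> + \<bar>b n\<bar>) / 2"
      by (rule divide_right_mono, rule order_trans[OF norm_triangle_ineq4]) (auto simp: norm_mult)
    also have "\<dots> \<le> (\<bar>u (?t 1 0 n)\<bar> + \<bar>u (?t 0 1 n)\<bar>) / 2"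
      using pi_ge_two unfolding a_def b_def abs_divide
      by (intro divide_right_mono add_mono) (auto simp: divide_le_eq mult_le_cancel_left1)
    also have "\<dots> \<le> \<bar>C\<bar> * jbracket n ^ k" using ub[where A = 1 and B = 0 and n = n] ub[where A = 0 and B = 1 and n = n] by simp
    also have "\<dots> \<le> real (nat \<lceil>\<bar>C\<bar>\<rceil>) * jbracket n ^ k"
      by (intro mult_right_mono) (auto simp: less_imp_le real_nat_ceiling_ge)
    finally show ?thesis .
  qed
  moreover have "c (- n) = cnj (c n)" for n unfolding cn(2)[of n] unfolding cn(1)[of n] by simp
  ultimately show ?thesis unfolding poly_coeffs_def by blast
qed

text \<open>Replaces an existence statement over all distributions and a definite description by a
  countable condition on the coefficients and an explicit series; in this form measurability can be
  proved.\<close>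

lemma gff_series_eq:
  "gff_series g \<omega> =
    (if poly_coeffs (\<lambda>n. g n \<omega> / of_real (jbracket n)) then series_distribution (\<lambda>n. g n \<omega> / of_real (jbracket n))
     else (\<lambda>\<phi>\<in>torus_test. 0))"
proof -
  let ?c = "\<lambda>n. g n \<omega> / of_real (jbracket n)"
  have ex: "(\<exists>u\<in>torus_distributions. fourier_series_to ?c u) \<longleftrightarrow> poly_coeffs ?c"
  proof
    assume "poly_coeffs ?c"
    then have "fourier_series_to ?c (series_distribution ?c)"
      unfolding fourier_series_to_iff by (intro ballI has_sum_series_distribution)
    then show "\<exists>u\<in>torus_distributions. fourier_series_to ?c u"
      using series_distribution_in[OF \<open>poly_coeffs ?c\<close>] by blast
  qed (use poly_coeffs_of_distribution in blast)
  have "(THE u. u \<in> torus_distributions \<and> fourier_series_to ?c u) = series_distribution ?c" if "poly_coeffs ?c"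
  proof (rule the_equality)
    show *: "series_distribution ?c \<in> torus_distributions \<and> fourier_series_to ?c (series_distribution ?c)"
      unfolding fourier_series_to_iff
      by (intro conjI ballI series_distribution_in has_sum_series_distribution that)
    show "u = series_distribution ?c" if "u \<in> torus_distributions \<and> fourier_series_to ?c u" for u
      using fourier_series_to_unique[of u "series_distribution ?c" ?c] that * by blast
  qed
  then show ?thesis unfolding gff_series_def Let_def ex by simp
qed

text \<open>For a summable family the unordered sum is the limit of partial sums along an
  enumeration of the index type. Without summability the two may differ, which is why the value is
  replaced by 0 outside P.\<close>

lemma borel_measurable_infsum_countable:
  fixes F :: "'i::countable \<Rightarrow> 'a \<Rightarrow> 'b::{banach,second_countable_topology}"
  assumes inf: "infinite (UNIV :: 'i set)" and F: "\<And>n. F n \<in> borel_measurable M" and P: "Measurable.pred M P"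
    and sum: "\<And>x. x \<in> space M \<Longrightarrow> P x \<Longrightarrow> (\<lambda>n. F n x) summable_on UNIV"
  shows "(\<lambda>x. if P x then \<Sum>\<^sub>\<infinity>n. F n x else 0) \<in> borel_measurable M"
proof -
  let ?e = "from_nat_into (UNIV :: 'i set)"
  have bij: "bij_betw ?e UNIV UNIV" using bij_betw_from_nat_into[OF countableI_type inf] .
  have "(\<Sum>\<^sub>\<infinity>n. F n x) = (\<Sum>i. F (?e i) x)" if x: "x \<in> space M" "P x" for x
  proof -
    have "((\<lambda>i. F (?e i) x) has_sum (\<Sum>\<^sub>\<infinity>n. F n x)) UNIV"
      using has_sum_reindex_bij_betw[OF bij, of "\<lambda>n. F n x"] has_sum_infsum[OF sum[OF x]] by blast
    then show ?thesis using has_sum_imp_sums sums_unique by blast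
  qed
  then have "(\<lambda>x. if P x then \<Sum>\<^sub>\<infinity>n. F n x else 0) \<in> borel_measurable M \<longleftrightarrow>
      (\<lambda>x. if P x then \<Sum>i. F (?e i) x else 0) \<in> borel_measurable M"
    by (intro measurable_cong) auto
  moreover have "(\<lambda>x. if P x then \<Sum>i. F (?e i) x else 0) \<in> borel_measurable M"
    using F P by measurable
  ultimately show ?thesis by blast
qed

lemma infinite_lattice: "infinite (UNIV :: (int \<times> int) set)"
  using infinite_UNIV_char_0[where 'a=int] by (simp add: finite_prod)

lemma space_distribution_space: "space distribution_space = torus_distributions"
  by (auto simp: distribution_space_def space_restrict_space space_PiM torus_distributions_def extensional_def PiE_def)

lemma zero_in_torus_distributions: "(\<lambda>\<phi>\<in>torus_test. 0) \<in> torus_distributions"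
  unfolding torus_distributions_def
  by (auto intro!: exI[of _ 0] simp: torus_test_lincomb)

lemma measurable_gff_series:
  assumes g: "\<And>n. g n \<in> borel_measurable M"
  shows "gff_series g \<in> measurable M distribution_space"
  unfolding distribution_space_def
proof (rule measurable_restrict_space2)
  show "gff_series g \<in> space M \<rightarrow> torus_distributions"
    using series_distribution_in zero_in_torus_distributions by (auto simp: gff_series_eq)
  note g[measurable]
  define P where "P \<omega> = poly_coeffs (\<lambda>n. g n \<omega> / of_real (jbracket n))" for \<omega>
  have P: "Measurable.pred M P" unfolding P_def poly_coeffs_def by measurable
  show "gff_series g \<in> measurable M (PiM torus_test (\<lambda>_. borel))"
  proof (rule measurable_PiM_single')
    fix \<phi> :: "real \<times> real \<Rightarrow> real" assume \<phi>: "\<phi> \<in> torus_test"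
    let ?F = "\<lambda>n \<omega>. g n \<omega> / of_real (jbracket n) * (test_coeff \<phi> n / of_real (2 * pi))"
    have "(\<lambda>\<omega>. if P \<omega> then \<Sum>\<^sub>\<infinity>n. ?F n \<omega> else 0) \<in> borel_measurable M"
      by (rule borel_measurable_infsum_countable[OF infinite_lattice _ P])
         (use g in measurable, unfold P_def, rule abs_summable_summable[OF summable_on_test[OF _ \<phi>]])
    then have "(\<lambda>\<omega>. Re (if P \<omega> then \<Sum>\<^sub>\<infinity>n. ?F n \<omega> else 0)) \<in> borel_measurable M" by measurable
    also have "(\<lambda>\<omega>. Re (if P \<omega> then \<Sum>\<^sub>\<infinity>n. ?F n \<omega> else 0)) = (\<lambda>\<omega>. gff_series g \<omega> \<phi>)"
      using \<phi> by (auto simp: fun_eq_iff gff_series_eq P_def series_distribution_def)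
    finally show "(\<lambda>\<omega>. gff_series g \<omega> \<phi>) \<in> borel_measurable M" .
  next
    show "gff_series g \<in> space M \<rightarrow> (\<Pi>\<^sub>E i\<in>torus_test. space borel)"
      by (auto simp: gff_series_eq series_distribution_def)
  qed
qed

lemma measurable_eval_distribution:
  assumes "\<phi> \<in> torus_test" shows "(\<lambda>u. u \<phi>) \<in> borel_measurable distribution_space"
  unfolding distribution_space_def
  by (intro measurable_restrict_space1 measurable_component_singleton assms)

section \<open>Mollifiers\<close>

lemma wrap_unique: "- pi \<le> t - 2 * pi * of_int j \<Longrightarrow> t - 2 * pi * of_int j < pi \<Longrightarrow> wrap t = t - 2 * pi * of_int j"
proof -
  assume "- pi \<le> t - 2 * pi * of_int j" "t - 2 * pi * of_int j < pi"
  then have "\<lfloor>(t + pi) / (2 * pi)\<rfloor> = j"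
    by (intro floor_unique) (simp_all add: field_simps)
  then show ?thesis by (simp add: wrap_def)
qed

lemma wrap_ex: obtains j where "wrap t = t - 2 * pi * of_int j"
  by (auto simp: wrap_def)

lemma wrap_add: "wrap (t + 2 * pi) = wrap t"
proof -
  obtain j where j: "wrap t = t - 2 * pi * of_int j" by (rule wrap_ex)
  have "wrap (t + 2 * pi) = t + 2 * pi - 2 * pi * of_int (j + 1)"
    using wrap_bounds[of t] unfolding j by (intro wrap_unique) (simp_all add: algebra_simps)
  then show ?thesis by (simp add: j algebra_simps)
qed

text \<open>If \<open>wrap\<close> does not use the lattice point j, then both candidate
  representatives of t are at distance more than pi - d from 0. With d the margin of the support of
  the profile, the rescaled profile vanishes at both, so the jump of \<open>wrap\<close> is
  invisible.\<close>

lemma wrap_near: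
  assumes "\<bar>t - 2 * pi * of_int j\<bar> < pi + d" "d \<le> pi"
  shows "wrap t = t - 2 * pi * of_int j \<or> (pi - d < \<bar>wrap t\<bar> \<and> pi \<le> \<bar>t - 2 * pi * of_int j\<bar>)"
proof -
  let ?s = "t - 2 * pi * of_int j"
  consider "- pi \<le> ?s \<and> ?s < pi" | "pi \<le> ?s" | "?s < - pi" by linarith
  then show ?thesis
  proof cases
    case 1
    then show ?thesis using wrap_unique by blast
  next
    case 2
    then have "wrap t = t - 2 * pi * of_int (j + 1)"
      using assms by (intro wrap_unique) (simp_all add: algebra_simps)
    then have "wrap t = ?s - 2 * pi" by (simp add: algebra_simps)
    then have "pi - d < \<bar>wrap t\<bar>" "pi \<le> \<bar>?s\<bar>" using 2 assms(1) unfolding abs_less_iff by linarith+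
    then show ?thesis by blast
  next
    case 3
    then have "wrap t = t - 2 * pi * of_int (j - 1)"
      using assms by (intro wrap_unique) (simp_all add: algebra_simps)
    then have "wrap t = ?s + 2 * pi" by (simp add: algebra_simps)
    then have "pi - d < \<bar>wrap t\<bar>" "pi \<le> \<bar>?s\<bar>" using 3 assms(1) unfolding abs_less_iff by linarith+
    then show ?thesis by blast
  qed
qed

text \<open>The cell contains its left edges, so the inclusion of the support alone would let it
  touch them. Evenness makes the support symmetric and thus keeps it off all edges; compactness then
  gives a positive margin d.\<close>

lemma mollifier_profile_support:
  assumes "mollifier_profile \<rho>"
  obtains d where "0 < d" "d \<le> pi" "\<forall>x. \<rho> x \<noteq> 0 \<longrightarrow> \<bar>fst x\<bar> \<le> pi - d \<and> \<bar>snd x\<bar> \<le> pi - d"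
proof -
  let ?A = "{x. \<rho> x \<noteq> 0}" and ?S = "closure {x. \<rho> x \<noteq> 0}"
  have even: "\<rho> (- x) = \<rho> x" and comp: "compact ?S" and sub: "?S \<subseteq> torus_cell"
    and int: "(LINT x|lborel. \<rho> x) = 1" for x
    using assms unfolding mollifier_profile_def by blast+
  have "?A \<noteq> {}"
  proof
    assume "?A = {}"
    then have "\<rho> = (\<lambda>_. 0)" by auto
    then show False using int by simp
  qed
  then have ne: "?S \<noteq> {}" by simp
  have neg: "- x \<in> ?S" if "x \<in> ?S" for x
  proof -
    have "uminus ` ?A = ?A"
    proof
      show "?A \<subseteq> uminus ` ?A" using even by (auto intro!: image_eqI[of _ uminus "- _"])
    qed (use even in auto)
    then show ?thesis
      using that closure_bounded_linear_image_subset[OF bounded_linear_minus[OF bounded_linear_ident], of ?A] by auto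
  qed
  define m where "m x = max (abs (fst x)) (abs (snd x))" for x :: "real \<times> real"
  have lt: "m x < pi" if "x \<in> ?S" for x
    using subsetD[OF sub that] subsetD[OF sub neg[OF that]] by (auto simp: torus_cell_def m_def)
  have "continuous_on ?S m" unfolding m_def by (intro continuous_intros)
  from continuous_attains_sup[OF comp ne this] have "\<exists>z. z \<in> ?S \<and> (\<forall>x\<in>?S. m x \<le> m z)"
    unfolding Bex_def .
  then obtain z where z: "z \<in> ?S" "\<forall>x\<in>?S. m x \<le> m z" by (elim exE conjE)
  show ?thesis
  proof (rule that[of "pi - m z"])
   show "\<forall>x. \<rho> x \<noteq> 0 \<longrightarrow> \<bar>fst x\<bar> \<le> pi - (pi - m z) \<and> \<bar>snd x\<bar> \<le> pi - (pi - m z)"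
   proof (intro allI impI)
    fix x assume "\<rho> x \<noteq> 0"
    then have "x \<in> ?S" by (intro subsetD[OF closure_subset]) simp
    from bspec[OF z(2) this] show "\<bar>fst x\<bar> \<le> pi - (pi - m z) \<and> \<bar>snd x\<bar> \<le> pi - (pi - m z)"
      unfolding m_def[of x] by simp
   qed
  next
    show "0 < pi - m z" using lt[OF z(1)] by simp
    show "pi - m z \<le> pi" by (simp add: m_def)
  qed
qed

context
  fixes \<rho> :: "real \<times> real \<Rightarrow> real" and N :: nat
  assumes profile: "mollifier_profile \<rho>" and N: "N \<ge> 1"
begin

lemma profile_zero:
  assumes "\<forall>x. \<rho> x \<noteq> 0 \<longrightarrow> \<bar>fst x\<bar> \<le> pi - d \<and> \<bar>snd x\<bar> \<le> pi - d" "d \<le> pi"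
    "pi - d < \<bar>fst x\<bar> \<or> pi - d < \<bar>snd x\<bar>"
  shows "\<rho> (real N *\<^sub>R x) = 0"
proof (rule ccontr)
  assume "\<rho> (real N *\<^sub>R x) \<noteq> 0"
  from assms(1)[rule_format, OF this] have le: "real N * \<bar>fst x\<bar> \<le> pi - d" "real N * \<bar>snd x\<bar> \<le> pi - d"
    by (auto simp: abs_mult)
  have "1 * \<bar>fst x\<bar> \<le> real N * \<bar>fst x\<bar>" "1 * \<bar>snd x\<bar> \<le> real N * \<bar>snd x\<bar>"
    using N by (intro mult_right_mono; simp)+
  then show False using le assms(3) by linarith
qed

lemma mollifier_near:
  assumes d: "0 < d" "d \<le> pi" "\<forall>x. \<rho> x \<noteq> 0 \<longrightarrow> \<bar>fst x\<bar> \<le> pi - d \<and> \<bar>snd x\<bar> \<le> pi - d"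
    and z: "\<bar>fst z - 2 * pi * of_int j\<bar> < pi + d" "\<bar>snd z - 2 * pi * of_int k\<bar> < pi + d"
  shows "mollifier \<rho> N z = (real N)\<^sup>2 * \<rho> (real N *\<^sub>R (fst z - 2 * pi * of_int j, snd z - 2 * pi * of_int k))"
proof -
  note zero = profile_zero[OF d(3) d(2)]
  let ?p = "(fst z - 2 * pi * of_int j, snd z - 2 * pi * of_int k)" and ?w = "(wrap (fst z), wrap (snd z))"
  show ?thesis
  proof (cases "wrap (fst z) = fst ?p \<and> wrap (snd z) = snd ?p")
    case False
    then have "(pi - d < \<bar>fst ?w\<bar> \<and> pi \<le> \<bar>fst ?p\<bar>) \<or> (pi - d < \<bar>snd ?w\<bar> \<and> pi \<le> \<bar>snd ?p\<bar>)"
      using wrap_near[OF z(1) d(2)] wrap_near[OF z(2) d(2)] by auto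
    then have "pi - d < \<bar>fst ?w\<bar> \<or> pi - d < \<bar>snd ?w\<bar>" "pi - d < \<bar>fst ?p\<bar> \<or> pi - d < \<bar>snd ?p\<bar>"
      using d(1) by linarith+
    from zero[OF this(1)] zero[OF this(2)] show ?thesis by (simp add: mollifier_def)
  qed (simp add: mollifier_def)
qed

lemma mollifier_test: "mollifier \<rho> N \<in> torus_test"
proof -
  obtain d where d: "0 < d" "d \<le> pi" "\<forall>x. \<rho> x \<noteq> 0 \<longrightarrow> \<bar>fst x\<bar> \<le> pi - d \<and> \<bar>snd x\<bar> \<le> pi - d"
    using mollifier_profile_support[OF profile] by blast
  have "smooth_fun (mollifier \<rho> N)"
  proof (rule smooth_fun_local)
    fix z :: "real \<times> real"
    obtain j where j: "wrap (fst z) = fst z - 2 * pi * of_int j" by (rule wrap_ex)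
    obtain k where k: "wrap (snd z) = snd z - 2 * pi * of_int k" by (rule wrap_ex)
    define S where "S = {z :: real \<times> real. \<bar>fst z - 2 * pi * of_int j\<bar> < pi + d \<and> \<bar>snd z - 2 * pi * of_int k\<bar> < pi + d}"
    define g where "g z = (real N)\<^sup>2 * \<rho> (- (real N *\<^sub>R (2 * pi * of_int j, 2 * pi * of_int k)) + real N *\<^sub>R z)" for z
    have "open S" unfolding S_def by (intro open_Collect_conj open_Collect_less continuous_intros)
    moreover have "z \<in> S"
      using wrap_bounds[of "fst z"] wrap_bounds[of "snd z"] d(1) unfolding S_def j k by auto
    moreover have "smooth_fun g"
      unfolding g_def[abs_def] using profile by (intro smooth_fun_affine) (simp add: mollifier_profile_def)
    moreover have "mollifier \<rho> N y = g y" if "y \<in> S" for y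
    proof -
      have "mollifier \<rho> N y = (real N)\<^sup>2 * \<rho> (real N *\<^sub>R (fst y - 2 * pi * of_int j, snd y - 2 * pi * of_int k))"
        using that by (intro mollifier_near[OF d]) (auto simp: S_def)
      also have "real N *\<^sub>R (fst y - 2 * pi * of_int j, snd y - 2 * pi * of_int k) =
          - (real N *\<^sub>R (2 * pi * of_int j, 2 * pi * of_int k)) + real N *\<^sub>R y"
        by (cases y) (simp add: algebra_simps)
      finally show ?thesis by (simp add: g_def)
    qed
    ultimately show "\<exists>S g. open S \<and> z \<in> S \<and> smooth_fun g \<and> (\<forall>y\<in>S. mollifier \<rho> N y = g y)" by blast
  qed
  then show ?thesis by (simp add: torus_test_def torus_periodic_def mollifier_def wrap_add)
qed

text \<open>\<open>wrap\<close> fails to be odd on the edge, since both pi and - pi are sent to -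
  pi. Applying \<open>mollifier_near\<close> with the opposite lattice point covers that case
  too.\<close>

lemma mollifier_even: "mollifier \<rho> N (- z) = mollifier \<rho> N z"
proof -
  obtain d where d: "0 < d" "d \<le> pi" "\<forall>x. \<rho> x \<noteq> 0 \<longrightarrow> \<bar>fst x\<bar> \<le> pi - d \<and> \<bar>snd x\<bar> \<le> pi - d"
    using mollifier_profile_support[OF profile] by blast
  obtain j where j: "wrap (fst z) = fst z - 2 * pi * of_int j" by (rule wrap_ex)
  obtain k where k: "wrap (snd z) = snd z - 2 * pi * of_int k" by (rule wrap_ex)
  have "mollifier \<rho> N (- z) = (real N)\<^sup>2 * \<rho> (real N *\<^sub>R (fst (- z) - 2 * pi * of_int (- j), snd (- z) - 2 * pi * of_int (- k)))"
    using wrap_bounds[of "fst z"] wrap_bounds[of "snd z"] d(1) unfolding j k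
    by (intro mollifier_near[OF d]) auto
  also have "real N *\<^sub>R (fst (- z) - 2 * pi * of_int (- j), snd (- z) - 2 * pi * of_int (- k)) =
      - (real N *\<^sub>R (wrap (fst z), wrap (snd z)))"
    unfolding j k by (simp add: algebra_simps)
  finally show ?thesis using profile by (simp add: mollifier_def mollifier_profile_def)
qed

lemma mollifier_nonneg: "0 \<le> mollifier \<rho> N z"
  using profile by (simp add: mollifier_def mollifier_profile_def)

lemma mollifier_cell: "z \<in> torus_cell \<Longrightarrow> mollifier \<rho> N z = (real N)\<^sup>2 * \<rho> (real N *\<^sub>R z)"
proof -
  assume "z \<in> torus_cell"
  then have "wrap (fst z) = fst z" "wrap (snd z) = snd z"
    using wrap_unique[of "fst z" 0] wrap_unique[of "snd z" 0] by (auto simp: torus_cell_def)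
  then show ?thesis by (simp add: mollifier_def)
qed

lemma mollifier_support:
  assumes "z \<in> torus_cell" "mollifier \<rho> N z \<noteq> 0"
  shows "\<bar>fst z\<bar> \<le> pi / real N" "\<bar>snd z\<bar> \<le> pi / real N"
proof -
  obtain d where d: "0 < d" "d \<le> pi" "\<forall>x. \<rho> x \<noteq> 0 \<longrightarrow> \<bar>fst x\<bar> \<le> pi - d \<and> \<bar>snd x\<bar> \<le> pi - d"
    using mollifier_profile_support[OF profile] by blast
  have "\<rho> (real N *\<^sub>R z) \<noteq> 0" using assms mollifier_cell by auto
  from d(3)[rule_format, OF this] d(1) have "real N * \<bar>fst z\<bar> \<le> pi" "real N * \<bar>snd z\<bar> \<le> pi" by (auto simp: abs_mult)
  then show "\<bar>fst z\<bar> \<le> pi / real N" "\<bar>snd z\<bar> \<le> pi / real N" using N by (simp_all add: field_simps)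
qed

lemmas mollifier_measurable [measurable] = torus_test_measurable[OF mollifier_test]

lemma integral_mollifier: "(\<integral>z. mollifier \<rho> N z \<partial>torusM) = 1"
proof -
  obtain d where d: "0 < d" "d \<le> pi" "\<forall>x. \<rho> x \<noteq> 0 \<longrightarrow> \<bar>fst x\<bar> \<le> pi - d \<and> \<bar>snd x\<bar> \<le> pi - d"
    using mollifier_profile_support[OF profile] by blast
  have [measurable]: "\<rho> \<in> borel_measurable borel"
    using profile by (intro borel_measurable_continuous_onI smooth_fun_continuous_on) (simp add: mollifier_profile_def)
  have "(\<integral>z. mollifier \<rho> N z \<partial>torusM) = (LINT z|lborel. indicator torus_cell z *\<^sub>R mollifier \<rho> N z)"
    by (subst set_integral_torus[symmetric]) (auto simp: set_lebesgue_integral_def)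
  also have "\<dots> = (LINT z|lborel. (real N)\<^sup>2 * \<rho> (real N *\<^sub>R z))"
  proof (rule Bochner_Integration.integral_cong[OF refl])
    fix z :: "real \<times> real"
    show "indicator torus_cell z *\<^sub>R mollifier \<rho> N z = (real N)\<^sup>2 * \<rho> (real N *\<^sub>R z)"
    proof (cases "z \<in> torus_cell")
      case False
      then have "pi - d < \<bar>fst z\<bar> \<or> pi - d < \<bar>snd z\<bar>"
        using d(1) by (cases z) (auto simp: torus_cell_def)
      from profile_zero[OF d(3) d(2) this] show ?thesis using False by simp
    qed (simp add: mollifier_cell)
  qed
  also have "\<dots> = (LINT x|density (distr lborel borel (\<lambda>x. 0 + real N *\<^sub>R x)) (\<lambda>_. \<bar>real N\<bar> ^ DIM(real \<times> real)). \<rho> x)"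
    by (subst integral_density) (auto simp: integral_distr power2_eq_square)
  also have "\<dots> = (LINT x|lborel. \<rho> x)"
    using lborel_affine[of "real N" "0 :: real \<times> real"] N by simp
  finally show ?thesis using profile by (simp add: mollifier_profile_def)
qed

lemma integrable_mollifier: "integrable torusM (mollifier \<rho> N)"
  using integral_mollifier not_integrable_integral_eq by fastforce

text \<open>The Fourier multiplier of \<open>mollify \<rho> N\<close>; the integral is real because
  the mollifier is even.\<close>

definition mol_coeff :: "int \<times> int \<Rightarrow> real" where
  "mol_coeff n = Re (test_coeff (mollifier \<rho> N) n)"

lemma test_coeff_mollifier: "test_coeff (mollifier \<rho> N) n = of_real (mol_coeff n)"
proof -
  let ?f = "\<lambda>z. of_real (mollifier \<rho> N z) * cis (freq n \<bullet> z)"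
  have "(\<integral>z. ?f (0 - z) \<partial>torusM) = (\<integral>z. ?f z \<partial>torusM)"
  proof (rule integral_torusM_shift(2))
    show "continuous_on UNIV ?f" using torus_test_continuous[OF mollifier_test, of UNIV]
      by (intro continuous_intros)
    show "torus_periodic ?f" using mollifier_test torus_periodic_cis[of n]
      by (auto simp: torus_test_def torus_periodic_def)
  qed
  also have "(\<integral>z. ?f (0 - z) \<partial>torusM) = test_coeff (mollifier \<rho> N) (- n)"
    by (simp add: mollifier_even freq_minus)
  finally have "cnj (test_coeff (mollifier \<rho> N) n) = test_coeff (mollifier \<rho> N) n"
    by (simp only: test_coeff_minus)
  then show ?thesis by (simp add: mol_coeff_def complex_eq_iff)
qed

lemma mol_coeff_minus [simp]: "mol_coeff (- n) = mol_coeff n"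
  unfolding mol_coeff_def test_coeff_minus by simp

lemma mol_coeff_le_1: "\<bar>mol_coeff n\<bar> \<le> 1"
proof -
  have "norm (test_coeff (mollifier \<rho> N) n) \<le> (\<integral>z. norm (of_real (mollifier \<rho> N z) * cis (freq n \<bullet> z)) \<partial>torusM)"
    by (rule integral_norm_bound)
  also have "\<dots> = 1" using mollifier_nonneg by (simp add: norm_mult integral_mollifier)
  finally show ?thesis unfolding test_coeff_mollifier by simp
qed

text \<open>The mollifier is a probability density living on |z_i| \<le> pi / N, and there |cis
  (freq n . z) - 1| is at most |freq n . z|.\<close>

lemma mol_coeff_near_1: "\<bar>mol_coeff n - 1\<bar> \<le> (\<bar>of_int (fst n)\<bar> + \<bar>of_int (snd n)\<bar>) * pi / real N"
proof -
  let ?m = "mollifier \<rho> N" and ?K = "(\<bar>of_int (fst n)\<bar> + \<bar>of_int (snd n)\<bar>) * pi / real N"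
  have int: "integrable torusM (\<lambda>z. of_real (?m z) * cis (freq n \<bullet> z))"
    by (rule Bochner_Integration.integrable_bound[OF integrable_mollifier]) (auto simp: norm_mult)
  have intm: "integrable torusM (\<lambda>z. of_real (?m z) :: complex)" using integrable_mollifier by simp
  have "of_real (mol_coeff n - 1) = (\<integral>z. of_real (?m z) * cis (freq n \<bullet> z) - of_real (?m z) \<partial>torusM)"
    by (subst Bochner_Integration.integral_diff[OF int intm]) (simp add: test_coeff_mollifier integral_mollifier)
  then have "\<bar>mol_coeff n - 1\<bar> = norm (\<integral>z. of_real (?m z) * cis (freq n \<bullet> z) - of_real (?m z) \<partial>torusM)"
    by (metis norm_of_real)
  also have "\<dots> \<le> (\<integral>z. norm (of_real (?m z) * cis (freq n \<bullet> z) - of_real (?m z)) \<partial>torusM)"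
    by (rule integral_norm_bound)
  also have "\<dots> \<le> (\<integral>z. ?m z * ?K \<partial>torusM)"
  proof (rule integral_mono_AE)
    show "AE z in torusM. norm (of_real (?m z) * cis (freq n \<bullet> z) - of_real (?m z)) \<le> ?m z * ?K"
      using AE_torusM_cell
    proof eventually_elim
      case (elim z)
      have "norm (of_real (?m z) * cis (freq n \<bullet> z) - of_real (?m z)) = ?m z * norm (cis (freq n \<bullet> z) - 1)"
      proof -
        have "of_real (?m z) * cis (freq n \<bullet> z) - of_real (?m z) = of_real (?m z) * (cis (freq n \<bullet> z) - 1)"
          by (simp add: algebra_simps)
        then show ?thesis using mollifier_nonneg[of z] by (simp only: norm_mult norm_of_real abs_of_nonneg)
      qed
      also have "\<dots> \<le> ?m z * ?K"
      proof (cases "?m z = 0")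
        case False
        from mollifier_support[OF elim False]
        have "\<bar>of_int (fst n) * fst z\<bar> \<le> \<bar>of_int (fst n)\<bar> * (pi / real N)"
          "\<bar>of_int (snd n) * snd z\<bar> \<le> \<bar>of_int (snd n)\<bar> * (pi / real N)"
          unfolding abs_mult by (simp_all only: mult_left_mono abs_ge_zero)
        then have "\<bar>of_int (fst n) * fst z + of_int (snd n) * snd z\<bar> \<le> \<bar>of_int (fst n)\<bar> * (pi / real N) + \<bar>of_int (snd n)\<bar> * (pi / real N)"
          by linarith
        also have "\<dots> = ?K" by (simp add: add_divide_distrib distrib_right)
        finally have "\<bar>freq n \<bullet> z\<bar> \<le> ?K" unfolding freq_inner .
        moreover have "norm (cis (freq n \<bullet> z) - 1) \<le> \<bar>freq n \<bullet> z\<bar>"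
          using iexp_approx1[of "freq n \<bullet> z" 0] by (simp add: cis_conv_exp)
        ultimately show ?thesis using mollifier_nonneg[of z] by (intro mult_left_mono) auto
      qed simp
      finally show ?case .
    qed
  qed (use int intm integrable_mollifier in auto)
  also have "\<dots> = ?K" by (simp add: integral_mollifier)
  finally show ?thesis .
qed

lemma mollifier_translate_test: "(\<lambda>y. mollifier \<rho> N (x - y)) \<in> torus_test"
proof -
  have "smooth_fun (\<lambda>y. 1 * mollifier \<rho> N (x + (-1) *\<^sub>R y))"
    using mollifier_test by (intro smooth_fun_affine) (simp add: torus_test_def)
  moreover have "mollifier \<rho> N (a - 2 * pi, b) = mollifier \<rho> N (a, b)" "mollifier \<rho> N (a, b - 2 * pi) = mollifier \<rho> N (a, b)" for a b
    using torus_periodic_int[of "mollifier \<rho> N" a "-1" b 0] torus_periodic_int[of "mollifier \<rho> N" a 0 b "-1"] mollifier_test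
    by (auto simp: torus_test_def)
  ultimately show ?thesis
    by (cases x) (simp add: torus_test_def torus_periodic_def diff_diff_eq[symmetric])
qed

lemma test_coeff_translate:
  "test_coeff (\<lambda>y. mollifier \<rho> N (x - y)) n = of_real (mol_coeff n) * cis (freq n \<bullet> x)"
proof -
  let ?f = "\<lambda>w. of_real (mollifier \<rho> N w) * cis (freq n \<bullet> (x - w))"
  have "(\<integral>y. ?f (x - y) \<partial>torusM) = (\<integral>w. ?f w \<partial>torusM)"
  proof (rule integral_torusM_shift(2))
    show "continuous_on UNIV ?f" using torus_test_continuous[OF mollifier_test, of UNIV]
      by (intro continuous_intros)
    show "torus_periodic ?f" using mollifier_test torus_periodic_cis[of n]
      by (auto simp: torus_test_def torus_periodic_def cis_freq_diff)
  qed
  also have "(\<integral>w. ?f w \<partial>torusM) = (\<integral>w. (of_real (mollifier \<rho> N w) * cis (freq (- n) \<bullet> w)) * cis (freq n \<bullet> x) \<partial>torusM)"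
    by (simp add: cis_freq_diff freq_minus cis_cnj mult_ac)
  also have "\<dots> = test_coeff (mollifier \<rho> N) (- n) * cis (freq n \<bullet> x)" by simp
  finally show ?thesis by (simp add: test_coeff_mollifier)
qed

lemma fourier_coeff_mollifier: "2 * pi * Re (fourier_coeff (mollifier \<rho> N) n) = mol_coeff n"
proof -
  have "fourier_coeff (mollifier \<rho> N) n = (\<integral>x. of_real (mollifier \<rho> N x) * cnj (ebasis n x) \<partial>torusM)"
    unfolding fourier_coeff_def by (rule set_integral_torus) (simp add: ebasis_cis)
  also have "\<dots> = (\<integral>x. of_real (mollifier \<rho> N x) * cis (freq (- n) \<bullet> x) / of_real (2 * pi) \<partial>torusM)"
    by (simp add: ebasis_cis freq_minus cis_cnj)
  also have "\<dots> = test_coeff (mollifier \<rho> N) (- n) / of_real (2 * pi)" by (rule integral_divide_zero)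
  finally show ?thesis by (simp add: test_coeff_mollifier)
qed

lemma summable_on_mol_coeff: "(\<lambda>n. jbracket n ^ k * \<bar>mol_coeff n\<bar>) summable_on UNIV"
proof (rule summable_on_comparison_test)
  let ?B = "4 * pi\<^sup>2 * 3 ^ (k + 2) * Ck_norm (2 * (k + 2)) (mollifier \<rho> N)"
  show "(\<lambda>n. ?B * (1 / jbracket n ^ 4)) summable_on UNIV"
    by (intro summable_on_cmult_right summable_on_jbracket4)
  fix n
  have e: "2 * (k + 2) = 2 * k + 4" by simp
  have J: "jbracket n ^ (2 * (k + 2)) = jbracket n ^ (2 * k) * jbracket n ^ 4" unfolding e power_add ..
  have "jbracket n ^ k * \<bar>mol_coeff n\<bar> * jbracket n ^ 4 \<le> jbracket n ^ (2 * k) * \<bar>mol_coeff n\<bar> * jbracket n ^ 4"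
    using jbracket_ge_1[of n] by (intro mult_right_mono power_increasing) auto
  also have "\<dots> = jbracket n ^ (2 * (k + 2)) * norm (test_coeff (mollifier \<rho> N) n)"
    unfolding J test_coeff_mollifier by (simp add: mult_ac)
  also have "\<dots> \<le> ?B" by (rule test_coeff_decay[OF mollifier_test])
  finally show "jbracket n ^ k * \<bar>mol_coeff n\<bar> \<le> ?B * (1 / jbracket n ^ 4)"
    by (simp add: pos_le_divide_eq)
qed (simp add: less_imp_le)

text \<open>A distribution u has a finite order k, so the oscillation of
  \<open>mollify \<rho> N u\<close> is controlled by the \<open>Ck_norm\<close> of a difference of
  two translates of the mollifier. It is small because the finitely many derivatives of order at
  most k are uniformly continuous.\<close>

lemma mollify_continuous:
  assumes u: "u \<in> torus_distributions"
  shows "continuous_on UNIV (mollify \<rho> N u)"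
proof -
  let ?m = "mollifier \<rho> N" and ?\<phi> = "\<lambda>x y. mollifier \<rho> N (x - y)"
  obtain C k where C: "\<And>\<phi>. \<phi> \<in> torus_test \<Longrightarrow> \<bar>u \<phi>\<bar> \<le> C * Ck_norm k \<phi>"
    using u unfolding torus_distributions_def by blast
  have lin: "u (\<lambda>y. a * \<phi> y + b * \<psi> y) = a * u \<phi> + b * u \<psi>" if "\<phi> \<in> torus_test" "\<psi> \<in> torus_test" for \<phi> \<psi> a b
    using u that unfolding torus_distributions_def by blast
  have sm: "smooth_fun ?m" using mollifier_test by (simp add: torus_test_def)
  let ?L = "{bs :: (real \<times> real) list. set bs \<subseteq> Basis \<and> length bs \<le> k}"
  have fin: "finite ?L" by (rule finite_lists_length_le) simp
  show ?thesis unfolding continuous_on_iff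
  proof (intro ballI allI impI)
    fix x :: "real \<times> real" and e :: real assume e: "e > 0"
    define e' where "e' = e / (\<bar>C\<bar> + 1)"
    have e': "e' > 0" using e by (simp add: e'_def)
    have "\<exists>d>0. \<forall>x y. dist x y < d \<longrightarrow> dist (iter_partial bs ?m x) (iter_partial bs ?m y) < e'" if bs: "bs \<in> ?L" for bs
    proof -
      have t: "iter_partial bs ?m \<in> torus_test" using torus_test_iter_partial[OF mollifier_test] bs by simp
      then have "torus_periodic (iter_partial bs ?m)" by (simp add: torus_test_def)
      show ?thesis
      proof (rule torus_periodic_uniformly_continuous[OF \<open>torus_periodic (iter_partial bs ?m)\<close> torus_test_continuous[OF t] e'])
        fix d assume "d > 0" "\<And>x y. dist x y < d \<Longrightarrow> dist (iter_partial bs ?m x) (iter_partial bs ?m y) < e'"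
        then show ?thesis by (intro exI[of _ d]) simp
      qed
    qed
    then have "\<forall>bs\<in>?L. \<exists>d. d > 0 \<and> (\<forall>x y. dist x y < d \<longrightarrow> dist (iter_partial bs ?m x) (iter_partial bs ?m y) < e')"
      by simp
    from bchoice[OF this] obtain D
      where D': "\<forall>bs\<in>?L. D bs > 0 \<and> (\<forall>x y. dist x y < D bs \<longrightarrow> dist (iter_partial bs ?m x) (iter_partial bs ?m y) < e')" ..
    have D: "D bs > 0" "dist x y < D bs \<Longrightarrow> dist (iter_partial bs ?m x) (iter_partial bs ?m y) < e'"
      if "bs \<in> ?L" for bs x y
      by (rule conjunct1[OF bspec[OF D' that]])
         (rule conjunct2[OF bspec[OF D' that], rule_format])
    have ne: "?L \<noteq> {}"
    proof -
      have "[] \<in> ?L" by simp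
      then show ?thesis by (metis empty_iff)
    qed
    define d where "d = Min (D ` ?L)"
    have "d > 0" unfolding d_def using fin ne D(1) by (subst Min_gr_iff) auto
    moreover have "dist (mollify \<rho> N u x') (mollify \<rho> N u x) < e" if x': "dist x' x < d" for x'
    proof -
      let ?\<delta> = "\<lambda>y. 1 * ?\<phi> x' y + (-1) * ?\<phi> x y"
      note t = mollifier_translate_test[of x'] mollifier_translate_test[of x]
      have "Ck_norm k ?\<delta> \<le> e'"
      proof (rule Ck_norm_least)
        fix bs :: "(real \<times> real) list" and y assume bs: "set bs \<subseteq> Basis" "length bs \<le> k"
        have it: "iter_partial bs (?\<phi> z) y = (-1) ^ length bs * iter_partial bs ?m (z - y)" for z
          using fun_cong[OF iter_partial_affine[OF sm bs(1), of 1 z "-1"], of y] by simp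
        have "iter_partial bs ?\<delta> y = 1 * iter_partial bs (?\<phi> x') y + (-1) * iter_partial bs (?\<phi> x) y"
          by (subst iter_partial_lincomb) (use t bs in \<open>auto simp: torus_test_def\<close>)
        also have "\<bar>\<dots>\<bar> = \<bar>(-1) ^ length bs * (iter_partial bs ?m (x' - y) - iter_partial bs ?m (x - y))\<bar>"
          unfolding it by (simp add: algebra_simps)
        also have "\<dots> = dist (iter_partial bs ?m (x' - y)) (iter_partial bs ?m (x - y))"
          by (simp add: abs_mult dist_real_def power_abs)
        also have "\<dots> < e'"
        proof (rule D(2))
          show "bs \<in> ?L" using bs by simp
          then have "d \<le> D bs" unfolding d_def using fin by simp
          then show "dist (x' - y) (x - y) < D bs" using x' by (simp add: dist_norm)
        qed
        finally show "\<bar>iter_partial bs ?\<delta> y\<bar> \<le> e'" by simp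
      qed
      then have "\<bar>C\<bar> * Ck_norm k ?\<delta> \<le> \<bar>C\<bar> * e'" by (intro mult_left_mono) auto
      moreover have "C * Ck_norm k ?\<delta> \<le> \<bar>C\<bar> * Ck_norm k ?\<delta>"
        by (intro mult_right_mono Ck_norm_nonneg torus_test_lincomb t) auto
      moreover have "dist (mollify \<rho> N u x') (mollify \<rho> N u x) = \<bar>u ?\<delta>\<bar>"
        unfolding lin[OF t] by (simp add: mollify_def dist_real_def)
      moreover have "\<bar>u ?\<delta>\<bar> \<le> C * Ck_norm k ?\<delta>" by (rule C[OF torus_test_lincomb[OF t]])
      moreover have "\<bar>C\<bar> * e' < e"
      proof -
        have "\<bar>C\<bar> * e' < (\<bar>C\<bar> + 1) * e'" using e' by simp
        also have "\<dots> = e" using abs_ge_zero[of C] by (simp add: e'_def)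
        finally show ?thesis .
      qed
      ultimately show ?thesis by linarith
    qed
    ultimately show "\<exists>d>0. \<forall>x'\<in>UNIV. dist x' x < d \<longrightarrow> dist (mollify \<rho> N u x') (mollify \<rho> N u x) < e"
      by blast
  qed
qed

end

text \<open>Rounding x down to the grid of mesh 1 / (i + 1) leaves countably many points, at each of
  which f is measurable in w; continuity in x lets the mesh go to 0.\<close>

lemma caratheodory_measurable:
  fixes f :: "'a \<Rightarrow> real \<times> real \<Rightarrow> 'b::{second_countable_topology,metric_space}"
  assumes meas: "\<And>x. (\<lambda>w. f w x) \<in> borel_measurable M"
    and cont: "\<And>w. w \<in> space M \<Longrightarrow> continuous_on UNIV (f w)"
  shows "(\<lambda>p. f (fst p) (snd p)) \<in> borel_measurable (M \<Otimes>\<^sub>M borel)"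
proof (rule borel_measurable_LIMSEQ_metric)
  let ?q = "\<lambda>i (a, b). (of_int a / real (Suc i), of_int b / real (Suc i)) :: real \<times> real"
  let ?r = "\<lambda>i x. (\<lfloor>real (Suc i) * fst x\<rfloor>, \<lfloor>real (Suc i) * snd x\<rfloor>) :: int \<times> int"
  fix i
  have "(\<lambda>p :: 'a \<times> real \<times> real. (\<lambda>n p. f (fst p) (?q i n)) (?r i (snd p)) p) \<in> borel_measurable (M \<Otimes>\<^sub>M borel)"
  proof (rule measurable_compose_countable)
    show "(\<lambda>p. f (fst p) (?q i n)) \<in> borel_measurable (M \<Otimes>\<^sub>M borel)" for n
      using measurable_compose[OF measurable_fst meas] by simp
    have m: "(\<lambda>p. \<lfloor>real (Suc i) * h (snd p)\<rfloor>) \<in> measurable (M \<Otimes>\<^sub>M borel) (count_space UNIV)"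
      if "continuous_on UNIV h" for h :: "real \<times> real \<Rightarrow> real"
    proof -
      have "h \<in> borel_measurable borel" using that by (rule borel_measurable_continuous_onI)
      from measurable_compose[OF measurable_snd this]
      have "(\<lambda>p. h (snd p)) \<in> borel_measurable (M \<Otimes>\<^sub>M borel)" .
      then show ?thesis by measurable
    qed
    have "(\<lambda>p :: 'a \<times> real \<times> real. ?r i (snd p)) \<in> measurable (M \<Otimes>\<^sub>M borel) (count_space UNIV \<Otimes>\<^sub>M count_space UNIV)"
      by (intro measurable_Pair m continuous_intros)
    then show "(\<lambda>p :: 'a \<times> real \<times> real. ?r i (snd p)) \<in> measurable (M \<Otimes>\<^sub>M borel) (count_space UNIV)"
      by (simp add: pair_measure_countable)
  qed
  then show "(\<lambda>p. f (fst p) (?q i (?r i (snd p)))) \<in> borel_measurable (M \<Otimes>\<^sub>M borel)" by simp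
next
  fix p assume p: "p \<in> space (M \<Otimes>\<^sub>M (borel :: (real \<times> real) measure))"
  have 1: "(\<lambda>i. of_int \<lfloor>real (Suc i) * t\<rfloor> / real (Suc i)) \<longlonglongrightarrow> t" for t
  proof (rule tendsto_sandwich)
    show "(\<lambda>i. t - 1 / real (Suc i)) \<longlonglongrightarrow> t"
      using tendsto_diff[OF tendsto_const[of t] LIMSEQ_inverse_real_of_nat] by (simp add: inverse_eq_divide)
    show "\<forall>\<^sub>F i in sequentially. t - 1 / real (Suc i) \<le> of_int \<lfloor>real (Suc i) * t\<rfloor> / real (Suc i)"
    proof (rule always_eventually, rule allI)
      fix i
      have "real (Suc i) * t - 1 \<le> of_int \<lfloor>real (Suc i) * t\<rfloor>" by linarith
      then have "(real (Suc i) * t - 1) / real (Suc i) \<le> of_int \<lfloor>real (Suc i) * t\<rfloor> / real (Suc i)"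
        by (rule divide_right_mono) simp
      then show "t - 1 / real (Suc i) \<le> of_int \<lfloor>real (Suc i) * t\<rfloor> / real (Suc i)"
        by (simp add: diff_divide_distrib del: of_nat_Suc)
    qed
    show "\<forall>\<^sub>F i in sequentially. of_int \<lfloor>real (Suc i) * t\<rfloor> / real (Suc i) \<le> t"
    proof (rule always_eventually, rule allI)
      fix i
      have "of_int \<lfloor>real (Suc i) * t\<rfloor> \<le> real (Suc i) * t" by linarith
      then show "of_int \<lfloor>real (Suc i) * t\<rfloor> / real (Suc i) \<le> t"
        by (simp add: pos_divide_le_eq mult.commute del: of_nat_Suc)
    qed
  qed simp
  have "isCont (f (fst p)) (snd p)"
    using cont[of "fst p"] p by (auto simp: continuous_on_eq_continuous_at space_pair_measure)
  from isCont_tendsto_compose[OF this tendsto_Pair[OF 1[of "fst (snd p)"] 1[of "snd (snd p)"], unfolded prod.collapse]]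
  show "(\<lambda>i. f (fst p) (case (\<lfloor>real (Suc i) * fst (snd p)\<rfloor>, \<lfloor>real (Suc i) * snd (snd p)\<rfloor>) of
      (a, b) \<Rightarrow> (of_int a / real (Suc i), of_int b / real (Suc i)))) \<longlonglongrightarrow> f (fst p) (snd p)"
    by simp
qed

lemma measurable_mollify:
  assumes "mollifier_profile \<rho>" "N \<ge> 1"
  shows "(\<lambda>p. mollify \<rho> N (fst p) (snd p)) \<in> borel_measurable (distribution_space \<Otimes>\<^sub>M borel)"
proof (rule caratheodory_measurable)
  show "(\<lambda>u. mollify \<rho> N u x) \<in> borel_measurable distribution_space" for x
    unfolding mollify_def by (rule measurable_eval_distribution[OF mollifier_translate_test[OF assms]])
  show "continuous_on UNIV (mollify \<rho> N u)" if "u \<in> space distribution_space" for u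
    by (rule mollify_continuous[OF assms that[unfolded space_distribution_space]])
qed

section \<open>Exponential moments of Gaussian series\<close>

text \<open>Above the level R, exp (b s) = exp (- (c - b) s) exp (c s), and the first factor is at
  most exp (- (c - b) R): a larger exponent controls the tail of a smaller one.\<close>

lemma exp_truncate:
  fixes b c s R :: real
  assumes "0 \<le> b" "b \<le> c"
  shows "exp (b * min s R) \<le> exp (b * s)" "exp (b * s) - exp (b * min s R) \<le> exp (- (c - b) * R) * exp (c * s)"
proof -
  show "exp (b * min s R) \<le> exp (b * s)" using assms by (simp add: mult_left_mono)
  show "exp (b * s) - exp (b * min s R) \<le> exp (- (c - b) * R) * exp (c * s)"
  proof (cases "s \<le> R")
    case False
    then have "(c - b) * R \<le> (c - b) * s" using assms by (intro mult_left_mono) auto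
    then have "b * s \<le> - (c - b) * R + c * s" by (simp add: algebra_simps)
    then have "exp (b * s) \<le> exp (- (c - b) * R) * exp (c * s)" unfolding exp_add[symmetric] by simp
    moreover have "0 \<le> exp (b * min s R)" by simp
    ultimately show ?thesis by linarith
  qed (simp add: min_def)
qed

lemma exp_diff_le:
  fixes u v :: real
  assumes "u \<le> R" "v \<le> R"
  shows "\<bar>exp u - exp v\<bar> \<le> exp R * \<bar>u - v\<bar>"
proof -
  have *: "exp u - exp v \<le> exp R * (u - v)" if "v \<le> u" "u \<le> R" for u v :: real
  proof -
    have "1 - exp (v - u) \<le> u - v" using exp_ge_add_one_self[of "v - u"] by linarith
    then have "exp u * (1 - exp (v - u)) \<le> exp R * (u - v)" using that by (intro mult_mono) auto
    then show ?thesis by (simp add: right_diff_distrib flip: exp_add)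
  qed
  show ?thesis
    using *[of u v] *[of v u] assms by (cases "u \<le> v") (auto simp: abs_if)
qed

text \<open>
  Truncation at level \<open>R\<close>: a bound on \<open>exp (c * s)\<close> for some \<open>c > b\<close> turns \<open>L\<^sup>1\<close> closeness of exponents
  into \<open>L\<^sup>1\<close> closeness of exponentials.
\<close>

lemma exp_diff_bound:
  fixes b c s t R :: real
  assumes "0 \<le> b" "b \<le> c"
  shows "\<bar>exp (b * s) - exp (b * t)\<bar> \<le> b * exp (b * R) * \<bar>s - t\<bar> + exp (- (c - b) * R) * (exp (c * s) + exp (c * t))"
proof -
  have "\<bar>exp (b * min s R) - exp (b * min t R)\<bar> \<le> exp (b * R) * \<bar>b * min s R - b * min t R\<bar>"
    using assms by (intro exp_diff_le mult_left_mono) auto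
  also have "\<bar>b * min s R - b * min t R\<bar> = b * \<bar>min s R - min t R\<bar>"
    using assms by (simp add: abs_mult flip: right_diff_distrib)
  also have "exp (b * R) * (b * \<bar>min s R - min t R\<bar>) \<le> exp (b * R) * (b * \<bar>s - t\<bar>)"
    using assms by (intro mult_left_mono) auto
  finally have 1: "\<bar>exp (b * min s R) - exp (b * min t R)\<bar> \<le> b * exp (b * R) * \<bar>s - t\<bar>"
    by (simp only: mult_ac)
  show ?thesis
    using 1 exp_truncate[OF assms, of s R] exp_truncate[OF assms, of t R]
    unfolding distrib_left by linarith
qed

text \<open>Vitali's theorem for exponentials: the bound on exp (2 T) gives uniform integrability of
  exp T. Fatou carries this bound over to the limit, dominated convergence handles the exponents
  truncated at R, and the truncation error is exp (- R) B.\<close>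

lemma exp_integral_tendsto:
  fixes T :: "nat \<Rightarrow> 'a \<Rightarrow> real" and S :: "'a \<Rightarrow> real"
  assumes "finite_measure M" and [measurable]: "\<And>j. T j \<in> borel_measurable M" "S \<in> borel_measurable M"
    and lim: "AE w in M. (\<lambda>j. T j w) \<longlonglongrightarrow> S w"
    and bound: "\<And>j. (\<integral>\<^sup>+w. ennreal (exp (2 * T j w)) \<partial>M) \<le> ennreal B" and B: "0 \<le> B"
  shows "integrable M (\<lambda>w. exp (S w))" "(\<lambda>j. \<integral>w. exp (T j w) \<partial>M) \<longlonglongrightarrow> (\<integral>w. exp (S w) \<partial>M)"
proof -
  interpret finite_measure M by fact
  have "(\<integral>\<^sup>+w. ennreal (exp (2 * S w)) \<partial>M) = (\<integral>\<^sup>+w. liminf (\<lambda>j. ennreal (exp (2 * T j w))) \<partial>M)"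
  proof (rule nn_integral_cong_AE)
    show "AE w in M. ennreal (exp (2 * S w)) = liminf (\<lambda>j. ennreal (exp (2 * T j w)))"
      using lim
    proof eventually_elim
      case (elim w)
      then have "(\<lambda>j. ennreal (exp (2 * T j w))) \<longlonglongrightarrow> ennreal (exp (2 * S w))"
        by (intro tendsto_intros)
      then show ?case by (intro lim_imp_Liminf[symmetric]) auto
    qed
  qed
  also have "\<dots> \<le> liminf (\<lambda>j. \<integral>\<^sup>+w. ennreal (exp (2 * T j w)) \<partial>M)"
    by (rule nn_integral_liminf) simp
  also have "\<dots> \<le> liminf (\<lambda>j. ennreal B)"
    by (intro Liminf_mono always_eventually allI bound)
  also have "liminf (\<lambda>j. ennreal B) = ennreal B" by (rule Liminf_const) simp
  finally have boundS: "(\<integral>\<^sup>+w. ennreal (exp (2 * S w)) \<partial>M) \<le> ennreal B" .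
  have both: "integrable M (\<lambda>w. exp (U w))" "integrable M (\<lambda>w. exp (2 * U w))" "(\<integral>w. exp (2 * U w) \<partial>M) \<le> B"
    if [measurable]: "U \<in> borel_measurable M" and U: "(\<integral>\<^sup>+w. ennreal (exp (2 * U w)) \<partial>M) \<le> ennreal B" for U
  proof -
    show 2: "integrable M (\<lambda>w. exp (2 * U w))"
      by (rule integrableI_bounded) (use U in \<open>auto intro: le_less_trans\<close>)
    have "ennreal (\<integral>w. exp (2 * U w) \<partial>M) = (\<integral>\<^sup>+w. ennreal (exp (2 * U w)) \<partial>M)"
      by (rule nn_integral_eq_integral[OF 2, symmetric]) simp
    then have "ennreal (\<integral>w. exp (2 * U w) \<partial>M) \<le> ennreal B" using U by simp
    then show "(\<integral>w. exp (2 * U w) \<partial>M) \<le> B" using B by (simp add: ennreal_le_iff)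
    have le: "exp x \<le> 1 + exp (2 * x)" for x :: real
    proof (cases "0 \<le> x")
      case True
      then have "exp x \<le> exp (2 * x)" by simp
      then show ?thesis by linarith
    next
      case False
      then have "exp x \<le> 1" by simp
      then show ?thesis using exp_gt_zero[of "2 * x"] by linarith
    qed
    show "integrable M (\<lambda>w. exp (U w))"
    proof (rule Bochner_Integration.integrable_bound)
      show "integrable M (\<lambda>w. 1 + exp (2 * U w))" using 2 by simp
      show "AE w in M. norm (exp (U w)) \<le> norm (1 + exp (2 * U w))"
        using le by (intro AE_I2) (simp add: abs_of_nonneg add_nonneg_nonneg)
    qed simp
  qed
  note bS = both[OF assms(3) boundS] and bT = both[OF assms(2) bound]
  show "integrable M (\<lambda>w. exp (S w))" by (rule bS(1))
  have trunc: "\<bar>(\<integral>w. exp (U w) \<partial>M) - (\<integral>w. exp (min (U w) R) \<partial>M)\<bar> \<le> exp (- R) * B"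
    if [measurable]: "U \<in> borel_measurable M" and U: "(\<integral>\<^sup>+w. ennreal (exp (2 * U w)) \<partial>M) \<le> ennreal B" for U R
  proof -
    note b = both[OF that]
    have i: "integrable M (\<lambda>w. exp (min (U w) R))"
      by (rule Bochner_Integration.integrable_bound[OF b(1)]) auto
    have "(\<integral>w. exp (U w) \<partial>M) - (\<integral>w. exp (min (U w) R) \<partial>M) = (\<integral>w. exp (U w) - exp (min (U w) R) \<partial>M)"
      using b(1) i by simp
    also have "\<bar>\<dots>\<bar> \<le> (\<integral>w. \<bar>exp (U w) - exp (min (U w) R)\<bar> \<partial>M)" by (rule integral_abs_bound)
    also have "\<dots> \<le> (\<integral>w. exp (- R) * exp (2 * U w) \<partial>M)"
    proof (rule integral_mono)
      show "\<bar>exp (U w) - exp (min (U w) R)\<bar> \<le> exp (- R) * exp (2 * U w)" for w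
        using exp_truncate[of 1 2 "U w" R] by simp
    qed (use b i in auto)
    also have "\<dots> \<le> exp (- R) * B" using b(3) by simp
    finally show ?thesis .
  qed
  show "(\<lambda>j. \<integral>w. exp (T j w) \<partial>M) \<longlonglongrightarrow> (\<integral>w. exp (S w) \<partial>M)"
  proof (rule LIMSEQ_I)
    fix e :: real assume e: "e > 0"
    \<comment> \<open>Solves exp (- R) (B + 1) = e / 4; the summand 1 covers B = 0. The error below
      e / 3 then enters twice, once for T and once for S.\<close>
    define R where "R = ln (4 * (B + 1) / e)"
    have "exp (- R) = e / (4 * (B + 1))" using e B by (simp add: R_def exp_minus)
    then have "exp (- R) * (B + 1) = e / 4" using B by (simp add: field_simps)
    moreover have "exp (- R) * B \<le> exp (- R) * (B + 1)" by (intro mult_left_mono) auto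
    ultimately have eR: "exp (- R) * B < e / 3" using e by linarith
    have "(\<lambda>j. \<integral>w. exp (min (T j w) R) \<partial>M) \<longlonglongrightarrow> (\<integral>w. exp (min (S w) R) \<partial>M)"
    proof (rule integral_dominated_convergence[where w = "\<lambda>_. exp R"])
      show "AE w in M. (\<lambda>j. exp (min (T j w) R)) \<longlonglongrightarrow> exp (min (S w) R)"
        using lim by eventually_elim (intro tendsto_intros)
    qed auto
    from LIMSEQ_D[OF this, of "e / 3"] e obtain j0 where
      j0: "\<And>j. j \<ge> j0 \<Longrightarrow> norm ((\<integral>w. exp (min (T j w) R) \<partial>M) - (\<integral>w. exp (min (S w) R) \<partial>M)) < e / 3" by auto
    show "\<exists>no. \<forall>n\<ge>no. norm ((\<integral>w. exp (T n w) \<partial>M) - (\<integral>w. exp (S w) \<partial>M)) < e"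
    proof (intro exI allI impI)
      fix j assume "j \<ge> j0"
      from j0[OF this] trunc[OF assms(2) bound, of j R] trunc[OF assms(3) boundS, of R] eR
      show "norm ((\<integral>w. exp (T j w) \<partial>M) - (\<integral>w. exp (S w) \<partial>M)) < e"
        unfolding real_norm_def by linarith
    qed
  qed
qed

section \<open>Moment generating functions of Gaussian variables and of finite Gaussian sums\<close>

lemma nn_integral_lborel_shift:
  fixes f :: "'a::euclidean_space \<Rightarrow> ennreal"
  assumes [measurable]: "f \<in> borel_measurable borel"
  shows "(\<integral>\<^sup>+x. f (c + x) \<partial>lborel) = (\<integral>\<^sup>+x. f x \<partial>lborel)"
proof -
  have "(\<integral>\<^sup>+x. f x \<partial>lborel) = (\<integral>\<^sup>+x. f x \<partial>distr lborel borel ((+) c))" by (simp only: lborel_distr_plus)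
  then show ?thesis by (simp add: nn_integral_distr)
qed

text \<open>Completing the square around cnj w / 2. The exponent is |w|^2 / 4 because the real and
  imaginary parts of Z have variance 1/2 each. That the density has mass one is read off from Z
  having this law.\<close>

lemma complex_gaussian_mgf:
  assumes "prob_space M" and Z: "distributed M lborel Z (\<lambda>z::complex. ennreal (exp (- (norm z)\<^sup>2) / pi))"
  shows "(\<integral>\<^sup>+\<omega>. ennreal (exp (Re (Z \<omega> * w))) \<partial>M) = ennreal (exp ((norm w)\<^sup>2 / 4))"
proof -
  interpret prob_space M by fact
  let ?f = "\<lambda>z::complex. ennreal (exp (- (norm z)\<^sup>2) / pi)"
  have one: "(\<integral>\<^sup>+z. ?f z \<partial>lborel) = 1"
    using distributed_nn_integral[OF Z, of "\<lambda>_. 1"] by (simp add: emeasure_space_1)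
  have "(\<integral>\<^sup>+\<omega>. ennreal (exp (Re (Z \<omega> * w))) \<partial>M) = (\<integral>\<^sup>+z. ?f z * ennreal (exp (Re (z * w))) \<partial>lborel)"
  proof (rule distributed_nn_integral[OF Z, symmetric])
    have [measurable]: "(\<lambda>z. Re (z * w)) \<in> borel_measurable borel"
      by (intro borel_measurable_continuous_onI continuous_intros)
    show "(\<lambda>z. ennreal (exp (Re (z * w)))) \<in> borel_measurable lborel" by simp
  qed
  also have "\<dots> = (\<integral>\<^sup>+z. ennreal (exp ((norm w)\<^sup>2 / 4)) * ?f (- (cnj w / 2) + z) \<partial>lborel)"
  proof (rule nn_integral_cong)
    fix z
    have "- (norm z)\<^sup>2 + Re (z * w) = (norm w)\<^sup>2 / 4 + - (norm (- (cnj w / 2) + z))\<^sup>2"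
      unfolding cmod_power2 by (simp add: power2_eq_square field_simps)
    then have "exp (- (norm z)\<^sup>2) / pi * exp (Re (z * w)) = exp ((norm w)\<^sup>2 / 4) * (exp (- (norm (- (cnj w / 2) + z))\<^sup>2) / pi)"
      by (simp add: exp_add[symmetric] del: add_uminus_conv_diff)
    then show "?f z * ennreal (exp (Re (z * w))) = ennreal (exp ((norm w)\<^sup>2 / 4)) * ?f (- (cnj w / 2) + z)"
      by (simp add: ennreal_mult[symmetric] del: add_uminus_conv_diff)
  qed
  also have "\<dots> = ennreal (exp ((norm w)\<^sup>2 / 4)) * (\<integral>\<^sup>+z. ?f (- (cnj w / 2) + z) \<partial>lborel)"
    by (rule nn_integral_cmult) simp
  also have "(\<integral>\<^sup>+z. ?f (- (cnj w / 2) + z) \<partial>lborel) = 1"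
    by (subst nn_integral_lborel_shift) (simp_all add: one)
  finally show ?thesis by simp
qed

lemma std_normal_mgf:
  assumes "prob_space M" and X: "distributed M lborel X (\<lambda>t. ennreal (std_normal_density t))"
  shows "(\<integral>\<^sup>+\<omega>. ennreal (exp (a * X \<omega>)) \<partial>M) = ennreal (exp (a\<^sup>2 / 2))"
proof -
  interpret prob_space M by fact
  let ?f = "\<lambda>t. ennreal (std_normal_density t)"
  have one: "(\<integral>\<^sup>+t. ?f t \<partial>lborel) = 1"
    using distributed_nn_integral[OF X, of "\<lambda>_. 1"] by (simp add: emeasure_space_1)
  have "(\<integral>\<^sup>+\<omega>. ennreal (exp (a * X \<omega>)) \<partial>M) = (\<integral>\<^sup>+t. ?f t * ennreal (exp (a * t)) \<partial>lborel)"
    by (rule distributed_nn_integral[OF X, symmetric]) simp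
  also have "\<dots> = (\<integral>\<^sup>+t. ennreal (exp (a\<^sup>2 / 2)) * ?f (- a + t) \<partial>lborel)"
  proof (rule nn_integral_cong)
    fix t
    have "- t\<^sup>2 / 2 + a * t = a\<^sup>2 / 2 + - (- a + t)\<^sup>2 / 2"
      by (simp add: power2_eq_square field_simps)
    then have "exp (- t\<^sup>2 / 2) * exp (a * t) = exp (a\<^sup>2 / 2) * exp (- (- a + t)\<^sup>2 / 2)"
      unfolding exp_add[symmetric] by simp
    then have "std_normal_density t * exp (a * t) = exp (a\<^sup>2 / 2) * std_normal_density (- a + t)"
      unfolding std_normal_density_def by (simp add: field_simps)
    then show "?f t * ennreal (exp (a * t)) = ennreal (exp (a\<^sup>2 / 2)) * ?f (- a + t)"
      by (simp add: ennreal_mult[symmetric] del: add_uminus_conv_diff)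
  qed
  also have "\<dots> = ennreal (exp (a\<^sup>2 / 2)) * (\<integral>\<^sup>+t. ?f (- a + t) \<partial>lborel)"
    by (rule nn_integral_cmult) simp
  also have "(\<integral>\<^sup>+t. ?f (- a + t) \<partial>lborel) = 1"
    by (subst nn_integral_lborel_shift) (simp_all add: one)
  finally show ?thesis by simp
qed

text \<open>Tonelli: the sum has a finite integral, hence is finite almost everywhere.\<close>

lemma AE_summable_on:
  fixes F :: "'i::countable \<Rightarrow> 'a \<Rightarrow> real"
  assumes inf: "infinite (UNIV :: 'i set)" and [measurable]: "\<And>n. F n \<in> borel_measurable M"
    and nonneg: "\<And>n w. 0 \<le> F n w" and le: "\<And>n. (\<integral>\<^sup>+w. ennreal (F n w) \<partial>M) \<le> ennreal (B n)"
    and B: "B summable_on UNIV" "\<And>n. 0 \<le> B n"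
  shows "AE w in M. (\<lambda>n. F n w) summable_on UNIV"
proof -
  let ?e = "from_nat_into (UNIV :: 'i set)"
  have bij: "bij_betw ?e UNIV UNIV" using bij_betw_from_nat_into[OF countableI_type inf] .
  have "(\<lambda>i. B (?e i)) summable_on UNIV" using summable_on_reindex_bij_betw[OF bij, of B] B(1) by blast
  then have sB: "summable (\<lambda>i. B (?e i))" by (rule summable_on_imp_summable)
  have "(\<integral>\<^sup>+w. (\<Sum>i. ennreal (F (?e i) w)) \<partial>M) = (\<Sum>i. \<integral>\<^sup>+w. ennreal (F (?e i) w) \<partial>M)"
    by (rule nn_integral_suminf) simp
  also have "\<dots> \<le> (\<Sum>i. ennreal (B (?e i)))" by (intro suminf_le le) auto
  also have "\<dots> < \<infinity>" using suminf_ennreal_eq[OF B(2) summable_sums[OF sB]] by simp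
  finally have "AE w in M. (\<Sum>i. ennreal (F (?e i) w)) \<noteq> \<infinity>"
    by (intro nn_integral_PInf_AE) auto
  then show ?thesis
  proof eventually_elim
    case (elim w)
    then have "summable (\<lambda>i. F (?e i) w)"
      by (intro summable_suminf_not_top) (use nonneg in auto)
    then have "(\<lambda>i. F (?e i) w) summable_on UNIV"
      by (rule summable_nonneg_imp_summable_on) (use nonneg in auto)
    then show ?case using summable_on_reindex_bij_betw[OF bij, of "\<lambda>n. F n w"] by blast
  qed
qed

text \<open>
  \<open>half_term b n (g n)\<close> collects the terms \<open>g n * b n\<close> and \<open>g (- n) * b (- n)\<close> of a series with
  \<open>b (- n) = cnj (b n)\<close>, so that summing it over \<open>half_lattice\<close> gives the whole series.
\<close>

definition half_term :: "(int \<times> int \<Rightarrow> complex) \<Rightarrow> int \<times> int \<Rightarrow> complex \<Rightarrow> real" where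
  "half_term b n z = (if n = 0 then Re (b 0) * Re z else Re (z * (2 * b n)))"

text \<open>Half of the variance, that is, the exponent in the moment generating function:
  \<open>half_term b n\<close> at a Gaussian coefficient has variance 2 |b n|^2 for nonzero n and
  (Re (b 0))^2 for n = 0.\<close>

definition half_variance :: "(int \<times> int \<Rightarrow> complex) \<Rightarrow> int \<times> int \<Rightarrow> real" where
  "half_variance b n = (if n = 0 then (Re (b 0))\<^sup>2 / 2 else (norm (b n))\<^sup>2)"

lemma half_term_measurable [measurable]: "half_term b n \<in> borel_measurable borel"
  unfolding half_term_def by (cases "n = 0") (auto intro!: borel_measurable_continuous_onI continuous_intros)

context
  fixes M :: "'a measure" and g :: "int \<times> int \<Rightarrow> 'a \<Rightarrow> complex"
  assumes gauss: "gaussian_family M g"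
begin

lemma gaussian_prob_space: "prob_space M" and gaussian_measurable [measurable]: "g n \<in> borel_measurable M"
  and gaussian_indep: "prob_space.indep_vars M (\<lambda>_. borel) g half_lattice"
  and gaussian_cnj: "AE \<omega> in M. g (- n) \<omega> = cnj (g n \<omega>)"
  and gaussian_complex: "n \<noteq> 0 \<Longrightarrow> distributed M lborel (g n) (\<lambda>z. ennreal (exp (- (norm z)\<^sup>2) / pi))"
  and gaussian_real: "distributed M lborel (\<lambda>\<omega>. Re (g 0 \<omega>)) (\<lambda>t. ennreal (std_normal_density t))"
  using gauss unfolding gaussian_family_def by blast+

text \<open>A crude first moment, uniform in n, from |t| \<le> exp t + exp (- t), so that the moment
  generating functions are the only Gaussian integrals used. There are two exponentials for n = 0
  and four otherwise.\<close>

lemma gaussian_norm_integral: "(\<integral>\<^sup>+\<omega>. ennreal (norm (g n \<omega>)) \<partial>M) \<le> ennreal (4 * exp 1)"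
proof (cases "n = 0")
  case True
  have "AE \<omega> in M. ennreal (norm (g n \<omega>)) \<le> ennreal (exp (1 * Re (g 0 \<omega>))) + ennreal (exp ((-1) * Re (g 0 \<omega>)))"
    using gaussian_cnj[of 0]
  proof eventually_elim
    case (elim \<omega>)
    then have "Im (g 0 \<omega>) = 0" by (simp add: complex_eq_iff)
    then have "norm (g n \<omega>) = \<bar>Re (g 0 \<omega>)\<bar>" using True by (simp add: cmod_eq_Re)
    also have "\<dots> \<le> exp (1 * Re (g 0 \<omega>)) + exp ((-1) * Re (g 0 \<omega>))"
      using exp_ge_add_one_self[of "Re (g 0 \<omega>)"] exp_ge_add_one_self[of "- Re (g 0 \<omega>)"]
        exp_gt_zero[of "Re (g 0 \<omega>)"] exp_gt_zero[of "- Re (g 0 \<omega>)"]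
      unfolding mult_1_left mult_minus1 by linarith
    finally show ?case by (simp flip: ennreal_plus)
  qed
  then have "(\<integral>\<^sup>+\<omega>. ennreal (norm (g n \<omega>)) \<partial>M)
      \<le> (\<integral>\<^sup>+\<omega>. ennreal (exp (1 * Re (g 0 \<omega>))) + ennreal (exp ((-1) * Re (g 0 \<omega>))) \<partial>M)"
    by (rule nn_integral_mono_AE)
  also have "\<dots> = ennreal (exp (1\<^sup>2 / 2)) + ennreal (exp ((-1)\<^sup>2 / 2))"
    by (subst nn_integral_add) (simp_all only: std_normal_mgf[OF gaussian_prob_space gaussian_real], measurable)
  also have "\<dots> \<le> ennreal (4 * exp 1)"
  proof -
    have "exp (1 / 2) \<le> exp (1 :: real)" by simp
    then have "exp (1 / 2) \<le> 2 * exp (1 :: real)" using exp_gt_zero[of "1 :: real"] by linarith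
    then show ?thesis by (simp flip: ennreal_plus)
  qed
  finally show ?thesis .
next
  case False
  note mgf = complex_gaussian_mgf[OF gaussian_prob_space gaussian_complex[OF False]]
  let ?E = "\<lambda>w \<omega>. ennreal (exp (Re (g n \<omega> * w)))"
  have "ennreal (norm (g n \<omega>)) \<le> (?E 1 \<omega> + ?E (-1) \<omega>) + (?E \<i> \<omega> + ?E (-\<i>) \<omega>)" for \<omega>
  proof -
    have *: "\<bar>t\<bar> \<le> exp t + exp (- t)" for t :: real
      using exp_ge_add_one_self[of t] exp_ge_add_one_self[of "- t"] exp_gt_zero[of t] exp_gt_zero[of "- t"]
      by linarith
    have "norm (g n \<omega>) \<le> (exp (Re (g n \<omega> * 1)) + exp (Re (g n \<omega> * (-1)))) + (exp (Re (g n \<omega> * \<i>)) + exp (Re (g n \<omega> * (-\<i>))))"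
      using cmod_le[of "g n \<omega>"] *[of "Re (g n \<omega>)"] *[of "Im (g n \<omega>)"] by simp
    then show ?thesis by (simp flip: ennreal_plus)
  qed
  then have "(\<integral>\<^sup>+\<omega>. ennreal (norm (g n \<omega>)) \<partial>M) \<le> (\<integral>\<^sup>+\<omega>. (?E 1 \<omega> + ?E (-1) \<omega>) + (?E \<i> \<omega> + ?E (-\<i>) \<omega>) \<partial>M)"
    by (rule nn_integral_mono)
  also have "\<dots> = (ennreal (exp (1/4)) + ennreal (exp (1/4))) + (ennreal (exp (1/4)) + ennreal (exp (1/4)))"
    using mgf[of 1] mgf[of "-1"] mgf[of "\<i>"] mgf[of "-\<i>"] by (simp add: nn_integral_add)
  also have "\<dots> \<le> ennreal (4 * exp 1)" by (simp flip: ennreal_plus)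
  finally show ?thesis .
qed

lemma AE_gaussian_cnj: "AE \<omega> in M. \<forall>n. g (- n) \<omega> = cnj (g n \<omega>)"
  unfolding AE_all_countable using gaussian_cnj by blast

text \<open>The expected sum of |g n| / jbracket n ^ 4 is finite. Almost surely the sum S itself is
  then finite, and it bounds each of its terms, so |g n| \<le> S jbracket n ^ 4.\<close>

lemma AE_poly_coeffs: "AE \<omega> in M. poly_coeffs (\<lambda>n. g n \<omega> / of_real (jbracket n))"
proof -
  have "AE \<omega> in M. (\<lambda>n. norm (g n \<omega>) / jbracket n ^ 4) summable_on UNIV"
  proof (rule AE_summable_on[OF infinite_lattice])
    show "(\<lambda>n. 4 * exp 1 * (1 / jbracket n ^ 4)) summable_on UNIV"
      by (intro summable_on_cmult_right summable_on_jbracket4)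
    fix n
    have "(\<integral>\<^sup>+\<omega>. ennreal (norm (g n \<omega>) / jbracket n ^ 4) \<partial>M) = (\<integral>\<^sup>+\<omega>. ennreal (norm (g n \<omega>)) * ennreal (1 / jbracket n ^ 4) \<partial>M)"
      by (simp add: ennreal_mult[symmetric] less_imp_le)
    also have "\<dots> = (\<integral>\<^sup>+\<omega>. ennreal (norm (g n \<omega>)) \<partial>M) * ennreal (1 / jbracket n ^ 4)"
      by (rule nn_integral_multc) simp
    also have "\<dots> \<le> ennreal (4 * exp 1) * ennreal (1 / jbracket n ^ 4)"
      by (intro mult_right_mono gaussian_norm_integral) simp
    also have "\<dots> = ennreal (4 * exp 1 * (1 / jbracket n ^ 4))"
      by (rule ennreal_mult[symmetric]) (simp_all add: less_imp_le)
    finally show "(\<integral>\<^sup>+\<omega>. ennreal (norm (g n \<omega>) / jbracket n ^ 4) \<partial>M) \<le> ennreal (4 * exp 1 * (1 / jbracket n ^ 4))" .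
  qed (simp_all add: less_imp_le)
  then show ?thesis using AE_gaussian_cnj
  proof eventually_elim
    case (elim \<omega>)
    define S where "S = (\<Sum>\<^sub>\<infinity>n. norm (g n \<omega>) / jbracket n ^ 4)"
    have "norm (g n \<omega> / of_real (jbracket n)) \<le> real (nat \<lceil>S\<rceil>) * jbracket n ^ 4" for n
    proof -
      have "norm (g n \<omega> / of_real (jbracket n)) \<le> norm (g n \<omega>)"
        using jbracket_ge_1[of n] by (simp add: norm_divide divide_le_eq mult_le_cancel_left1)
      moreover have "norm (g n \<omega>) / jbracket n ^ 4 \<le> S"
        using finite_sum_le_infsum[OF elim(1), of "{n}"] by (simp add: S_def less_imp_le)
      then have "norm (g n \<omega>) \<le> S * jbracket n ^ 4" by (simp add: pos_divide_le_eq)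
      moreover have "S * jbracket n ^ 4 \<le> real (nat \<lceil>S\<rceil>) * jbracket n ^ 4"
        by (intro mult_right_mono) (auto simp: less_imp_le real_nat_ceiling_ge)
      ultimately show ?thesis by linarith
    qed
    then show ?case unfolding poly_coeffs_def using elim(2) by auto
  qed
qed

text \<open>Independence is available on the half lattice only, where the product formula turns the
  expectation of the exponential into a product over frequencies.\<close>

lemma half_sum_mgf:
  assumes A: "finite A" "A \<subseteq> half_lattice"
  shows "(\<integral>\<^sup>+\<omega>. ennreal (exp (\<Sum>n\<in>A. half_term b n (g n \<omega>))) \<partial>M) = ennreal (exp (\<Sum>n\<in>A. half_variance b n))"
proof -
  interpret prob_space M by (rule gaussian_prob_space)
  have "indep_vars (\<lambda>_. borel) (\<lambda>n \<omega>. ennreal (exp (half_term b n (g n \<omega>)))) A"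
    by (rule indep_vars_compose2[OF indep_vars_subset[OF gaussian_indep A(2)]]) measurable
  from indep_vars_nn_integral[OF A(1) this]
  have "(\<integral>\<^sup>+\<omega>. (\<Prod>n\<in>A. ennreal (exp (half_term b n (g n \<omega>)))) \<partial>M) = (\<Prod>n\<in>A. \<integral>\<^sup>+\<omega>. ennreal (exp (half_term b n (g n \<omega>))) \<partial>M)"
    by simp
  also have "\<dots> = (\<Prod>n\<in>A. ennreal (exp (half_variance b n)))"
  proof (rule prod.cong[OF refl])
    fix n
    show "(\<integral>\<^sup>+\<omega>. ennreal (exp (half_term b n (g n \<omega>))) \<partial>M) = ennreal (exp (half_variance b n))"
      using std_normal_mgf[OF gaussian_prob_space gaussian_real, of "Re (b 0)"]
        complex_gaussian_mgf[OF gaussian_prob_space gaussian_complex, of n "2 * b n"]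
      by (cases "n = 0") (simp_all add: half_term_def half_variance_def norm_mult power_mult_distrib)
  qed
  finally show ?thesis using A(1) by (simp add: prod_ennreal exp_sum)
qed

end

text \<open>Squares are symmetric under n to - n, so a sum over them folds onto the half lattice,
  and they exhaust the finite subsets, so sums along them converge to the unordered sum.\<close>

definition lattice_box :: "nat \<Rightarrow> (int \<times> int) set" where
  "lattice_box j = {- int j..int j} \<times> {- int j..int j}"

lemma finite_lattice_box [simp]: "finite (lattice_box j)"
  by (simp add: lattice_box_def)

lemma filterlim_lattice_box: "filterlim lattice_box (finite_subsets_at_top UNIV) sequentially"
  unfolding filterlim_finite_subsets_at_top
proof (intro allI impI)
  fix X :: "(int \<times> int) set" assume X: "finite X \<and> X \<subseteq> UNIV"
  define m where "m = nat (\<Sum>n\<in>X. \<bar>fst n\<bar> + \<bar>snd n\<bar>)"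
  have "X \<subseteq> lattice_box j" if "j \<ge> m" for j
  proof
    fix n assume "n \<in> X"
    then have "\<bar>fst n\<bar> + \<bar>snd n\<bar> \<le> (\<Sum>n\<in>X. \<bar>fst n\<bar> + \<bar>snd n\<bar>)"
      using X member_le_sum[of n X "\<lambda>n. \<bar>fst n\<bar> + \<bar>snd n\<bar>"] by fastforce
    then have "\<bar>fst n\<bar> + \<bar>snd n\<bar> \<le> int j" using that unfolding m_def by linarith
    then have "\<bar>fst n\<bar> \<le> int j" "\<bar>snd n\<bar> \<le> int j" by linarith+
    then show "n \<in> lattice_box j" by (cases n) (auto simp: lattice_box_def abs_le_iff)
  qed
  then show "\<forall>\<^sub>F j in sequentially. finite (lattice_box j) \<and> X \<subseteq> lattice_box j \<and> lattice_box j \<subseteq> UNIV"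
    by (auto simp: eventually_sequentially)
qed

lemma lattice_box_split:
  fixes f :: "int \<times> int \<Rightarrow> 'b::comm_monoid_add"
  shows "(\<Sum>n\<in>lattice_box j. f n) = (\<Sum>n\<in>lattice_box j \<inter> half_lattice. if n = 0 then f 0 else f n + f (- n))"
proof -
  let ?H = "lattice_box j \<inter> half_lattice - {0}"
  have 0: "0 \<in> lattice_box j" "0 \<in> half_lattice" by (auto simp: lattice_box_def half_lattice_def zero_prod_def)
  have split: "lattice_box j = insert 0 (?H \<union> uminus ` ?H)"
  proof (rule set_eqI)
    fix n :: "int \<times> int"
    obtain a b where [simp]: "n = (a, b)" by (cases n)
    have "n \<in> uminus ` ?H \<longleftrightarrow> - n \<in> ?H" by (auto intro: image_eqI[of _ _ "- n"])
    then show "n \<in> lattice_box j \<longleftrightarrow> n \<in> insert 0 (?H \<union> uminus ` ?H)"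
      by (auto simp: lattice_box_def half_lattice_def zero_prod_def)
  qed
  have disj: "?H \<inter> uminus ` ?H = {}" by (auto simp: half_lattice_def zero_prod_def)
  have "(\<Sum>n\<in>lattice_box j. f n) = f 0 + (\<Sum>n\<in>?H \<union> uminus ` ?H. f n)"
    by (subst split, subst sum.insert) (auto simp: zero_prod_def)
  also have "(\<Sum>n\<in>?H \<union> uminus ` ?H. f n) = (\<Sum>n\<in>?H. f n) + (\<Sum>n\<in>uminus ` ?H. f n)"
    by (rule sum.union_disjoint) (use disj in auto)
  also have "(\<Sum>n\<in>uminus ` ?H. f n) = (\<Sum>n\<in>?H. f (- n))"
    by (subst sum.reindex) (auto simp: inj_on_def)
  also have "(\<Sum>n\<in>?H. f n) + (\<Sum>n\<in>?H. f (- n)) = (\<Sum>n\<in>?H. if n = 0 then f 0 else f n + f (- n))"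
    unfolding sum.distrib[symmetric] by (rule sum.cong) auto
  also have "f 0 + \<dots> = (\<Sum>n\<in>insert 0 ?H. if n = 0 then f 0 else f n + f (- n))"
    by (subst sum.insert) auto
  also have "insert 0 ?H = lattice_box j \<inter> half_lattice" using 0 by auto
  finally show ?thesis .
qed

text \<open>The sums over boxes have explicit exponential moments and converge almost surely to S.
  The moment with factor r = 1 is the one whose limit is wanted; the one with r = 2 provides the
  uniform bound for \<open>exp_integral_tendsto\<close>.\<close>

lemma gaussian_series_mgf:
  assumes gauss: "gaussian_family M g" and b: "(\<lambda>n. (norm (b n))\<^sup>2) summable_on UNIV" "\<And>n. b (- n) = cnj (b n)"
    and S: "S \<in> borel_measurable M" "AE \<omega> in M. ((\<lambda>n. g n \<omega> * b n) has_sum of_real (S \<omega>)) UNIV"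
  shows "integrable M (\<lambda>\<omega>. exp (S \<omega>))" "(\<integral>\<omega>. exp (S \<omega>) \<partial>M) = exp ((\<Sum>\<^sub>\<infinity>n. (norm (b n))\<^sup>2) / 2)"
proof -
  interpret prob_space M by (rule gaussian_prob_space[OF gauss])
  note [measurable] = gaussian_measurable[OF gauss]
  let ?A = "\<lambda>j. lattice_box j \<inter> half_lattice"
  define T where "T j \<omega> = (\<Sum>n\<in>?A j. half_term b n (g n \<omega>))" for j \<omega>
  define V where "V = (\<Sum>\<^sub>\<infinity>n. (norm (b n))\<^sup>2) / 2"
  have Tm [measurable]: "T j \<in> borel_measurable M" for j unfolding T_def by measurable
  have b0: "Im (b 0) = 0" using b(2)[of 0] by (simp add: complex_eq_iff)
  have var: "(\<Sum>n\<in>?A j. half_variance c n) = (\<Sum>n\<in>lattice_box j. (norm (c n))\<^sup>2) / 2"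
    if "Im (c 0) = 0" "\<And>n. c (- n) = cnj (c n)" for c j
    unfolding lattice_box_split sum_divide_distrib
    by (rule sum.cong[OF refl]) (use that in \<open>auto simp: half_variance_def cmod_power2\<close>)
  have mgf: "(\<integral>\<^sup>+\<omega>. ennreal (exp (r * T j \<omega>)) \<partial>M) = ennreal (exp (r\<^sup>2 * (\<Sum>n\<in>lattice_box j. (norm (b n))\<^sup>2) / 2))" for r :: real and j
  proof -
    have "r * T j \<omega> = (\<Sum>n\<in>?A j. half_term (\<lambda>n. of_real r * b n) n (g n \<omega>))" for \<omega>
      unfolding T_def sum_distrib_left by (rule sum.cong[OF refl]) (auto simp: half_term_def algebra_simps)
    moreover have "(\<Sum>n\<in>?A j. half_variance (\<lambda>n. of_real r * b n) n) = r\<^sup>2 * (\<Sum>n\<in>lattice_box j. (norm (b n))\<^sup>2) / 2"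
      by (subst var) (use b0 b(2) in \<open>auto simp: norm_mult power_mult_distrib sum_distrib_left\<close>)
    ultimately show ?thesis using half_sum_mgf[OF gauss, of "?A j" "\<lambda>n. of_real r * b n"] by simp
  qed
  have sum_le: "(\<Sum>n\<in>lattice_box j. (norm (b n))\<^sup>2) / 2 \<le> V" for j
    unfolding V_def by (intro divide_right_mono finite_sum_le_infsum b(1)) auto
  have lim: "AE \<omega> in M. (\<lambda>j. T j \<omega>) \<longlonglongrightarrow> S \<omega>"
    using S(2) AE_gaussian_cnj[OF gauss]
  proof eventually_elim
    case (elim \<omega>)
    have "of_real (T j \<omega>) = (\<Sum>n\<in>lattice_box j. g n \<omega> * b n)" for j
    proof -
      have g0: "Im (g 0 \<omega>) = 0" using elim(2)[rule_format, of 0] by (simp add: complex_eq_iff)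
      show ?thesis unfolding T_def lattice_box_split of_real_sum
        by (rule sum.cong[OF refl]) (use g0 b0 b(2) elim(2) in \<open>auto simp: half_term_def complex_eq_iff\<close>)
    qed
    moreover have "(\<lambda>j. \<Sum>n\<in>lattice_box j. g n \<omega> * b n) \<longlonglongrightarrow> of_real (S \<omega>)"
      using filterlim_compose[OF elim(1)[unfolded has_sum_def] filterlim_lattice_box] .
    ultimately have "(\<lambda>j. of_real (T j \<omega>) :: complex) \<longlonglongrightarrow> of_real (S \<omega>)" by simp
    then show ?case by (simp only: tendsto_of_real_iff)
  qed
  \<comment> \<open>Doubling the exponent multiplies the variance by 4.\<close>
  have bound: "(\<integral>\<^sup>+\<omega>. ennreal (exp (2 * T j \<omega>)) \<partial>M) \<le> ennreal (exp (4 * V))" for j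
    unfolding mgf using sum_le[of j] by (intro ennreal_leI) simp
  note conv = exp_integral_tendsto[OF finite_measure_axioms Tm S(1) lim bound]
  show "integrable M (\<lambda>\<omega>. exp (S \<omega>))" by (rule conv(1)) simp
  have "(\<integral>\<omega>. exp (T j \<omega>) \<partial>M) = exp ((\<Sum>n\<in>lattice_box j. (norm (b n))\<^sup>2) / 2)" for j
    using mgf[of 1 j] by (subst integral_eq_nn_integral) auto
  moreover have "(\<lambda>j. \<integral>\<omega>. exp (T j \<omega>) \<partial>M) \<longlonglongrightarrow> (\<integral>\<omega>. exp (S \<omega>) \<partial>M)" by (rule conv(2)) simp
  moreover have "(\<lambda>j. exp ((\<Sum>n\<in>lattice_box j. (norm (b n))\<^sup>2) / 2)) \<longlonglongrightarrow> exp ((\<Sum>\<^sub>\<infinity>n. (norm (b n))\<^sup>2) / 2)"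
    using filterlim_compose[OF infsum_tendsto[OF b(1)] filterlim_lattice_box]
    by (intro tendsto_intros) simp_all
  ultimately show "(\<integral>\<omega>. exp (S \<omega>) \<partial>M) = exp ((\<Sum>\<^sub>\<infinity>n. (norm (b n))\<^sup>2) / 2)"
    using LIMSEQ_unique by simp
qed

section \<open>Jensen's inequality for doubly stochastic kernels\<close>

text \<open>For fixed x, Jensen applies to the probability density \<open>p x\<close>. Integrating
  over x and exchanging the order, the other marginal removes the kernel. Boundedness of p and F
  serves for all integrability conditions.\<close>

lemma jensen_kernel:
  fixes p :: "'a \<Rightarrow> 'a \<Rightarrow> real" and F :: "'a \<Rightarrow> real"
  assumes "finite_measure A"
    and p [measurable]: "case_prod p \<in> borel_measurable (A \<Otimes>\<^sub>M A)"
    and p_bd: "\<And>x w. 0 \<le> p x w" "\<And>x w. p x w \<le> P"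
    and p1: "\<And>x. (\<integral>w. p x w \<partial>A) = 1" and p2: "\<And>w. (\<integral>x. p x w \<partial>A) = 1"
    and F [measurable]: "F \<in> borel_measurable A" and F_bd: "\<And>w. \<bar>F w\<bar> \<le> B"
  shows "(\<integral>x. exp (\<integral>w. p x w * F w \<partial>A) \<partial>A) \<le> (\<integral>w. exp (F w) \<partial>A)"
proof -
  interpret finite_measure A by fact
  interpret pair_sigma_finite A A ..
  interpret AA: finite_measure "A \<Otimes>\<^sub>M A" by (rule finite_measure_pair_measure[OF assms(1) assms(1)])
  have Fexp: "exp (F w) \<le> exp B" for w using F_bd[of w] by simp
  have jens: "exp (\<integral>w. p x w * F w \<partial>A) \<le> (\<integral>w. p x w * exp (F w) \<partial>A)" if x: "x \<in> space A" for x
  proof -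
    have [measurable]: "(\<lambda>w. p x w) \<in> borel_measurable A"
      using measurable_Pair2[OF p x] by simp
    define \<nu> where "\<nu> = density A (\<lambda>w. ennreal (p x w))"
    have intp: "integrable A (\<lambda>w. p x w)" using p1[of x] not_integrable_integral_eq by fastforce
    interpret \<nu>: prob_space \<nu>
    proof
      have "emeasure \<nu> (space \<nu>) = (\<integral>\<^sup>+w. ennreal (p x w) \<partial>A)"
        by (simp add: \<nu>_def emeasure_density)
      also have "\<dots> = ennreal 1" using p_bd(1) intp p1[of x] by (simp add: nn_integral_eq_integral)
      finally show "emeasure \<nu> (space \<nu>) = 1" by simp
    qed
    have [measurable_cong]: "sets \<nu> = sets A" by (simp add: \<nu>_def)
    have dens: "(\<integral>w. G w \<partial>\<nu>) = (\<integral>w. p x w * G w \<partial>A)" if [measurable]: "G \<in> borel_measurable A" for G :: "'a \<Rightarrow> real"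
      unfolding \<nu>_def by (subst integral_density) (auto simp: p_bd)
    have "exp (\<nu>.expectation F) \<le> \<nu>.expectation (\<lambda>w. exp (F w))"
    proof (rule \<nu>.jensens_inequality[where I = UNIV])
      show "integrable \<nu> F" by (rule \<nu>.integrable_const_bound[of _ B]) (use F_bd in auto)
      show "integrable \<nu> (\<lambda>w. exp (F w))" by (rule \<nu>.integrable_const_bound[of _ "exp B"]) (use Fexp in auto)
    qed (auto intro: exp_convex)
    then show ?thesis by (simp add: dens)
  qed
  have bd: "p x w * exp (F w) \<le> P * exp B" for x w
    using p_bd[of x w] Fexp[of w] by (intro mult_mono) (auto intro: order_trans)
  have int2: "integrable (A \<Otimes>\<^sub>M A) (\<lambda>(x, w). p x w * exp (F w))"
  proof (rule AA.integrable_const_bound[of _ "P * exp B"])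
    show "AE z in A \<Otimes>\<^sub>M A. norm (case z of (x, w) \<Rightarrow> p x w * exp (F w)) \<le> P * exp B"
      using bd p_bd(1) by (intro AE_I2) (auto simp: abs_mult)
  qed measurable
  have "(\<integral>x. exp (\<integral>w. p x w * F w \<partial>A) \<partial>A) \<le> (\<integral>x. (\<integral>w. p x w * exp (F w) \<partial>A) \<partial>A)"
  proof (rule integral_mono)
    show "integrable A (\<lambda>x. \<integral>w. p x w * exp (F w) \<partial>A)" by (rule integrable_fst[OF int2])
    then show "integrable A (\<lambda>x. exp (\<integral>w. p x w * F w \<partial>A))"
      by (rule Bochner_Integration.integrable_bound) (use jens in \<open>auto intro: order_trans[OF _ abs_ge_self]\<close>)
  qed (rule jens)
  also have "\<dots> = (\<integral>w. (\<integral>x. p x w * exp (F w) \<partial>A) \<partial>A)"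
    using integral_fst[OF int2] integral_snd[OF int2] by simp
  also have "\<dots> = (\<integral>w. exp (F w) \<partial>A)" by (simp add: p2)
  finally show ?thesis .
qed

lemma trig_series_bounded_exp:
  assumes "(\<lambda>n. norm (c n)) summable_on UNIV"
  shows "integrable torusM (\<lambda>z. exp (a * Re (trig_series c z)))"
proof (rule torusM.integrable_const_bound[of _ "exp (\<bar>a\<bar> * (\<Sum>\<^sub>\<infinity>n. norm (c n)))"])
  have "a * Re (trig_series c z) \<le> \<bar>a\<bar> * (\<Sum>\<^sub>\<infinity>n. norm (c n))" for z
  proof -
    have "a * Re (trig_series c z) \<le> \<bar>a\<bar> * norm (trig_series c z)"
      using abs_Re_le_cmod[of "trig_series c z"] by (metis abs_ge_self abs_ge_zero abs_mult mult_left_mono order_trans)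
    also have "\<dots> \<le> \<bar>a\<bar> * (\<Sum>\<^sub>\<infinity>n. norm (c n))" by (intro mult_left_mono trig_series_norm_le assms) auto
    finally show ?thesis .
  qed
  then show "AE z in torusM. norm (exp (a * Re (trig_series c z))) \<le> exp (\<bar>a\<bar> * (\<Sum>\<^sub>\<infinity>n. norm (c n)))" by simp
qed (use trig_series_measurable[OF assms] in measurable)

lemma sets_torusM_pair: "sets (torusM \<Otimes>\<^sub>M torusM) = sets borel"
  unfolding sets_pair_measure_cong[OF sets_torusM sets_torusM] borel_prod ..

text \<open>Multiplying the coefficients by \<open>mol_coeff\<close> is convolution with the
  mollifier, a probability density in either variable. Hence mollification can only lower the
  exponential integral, whatever the signs of the multipliers.\<close>

lemma jensen_mollifier:
  assumes profile: "mollifier_profile \<rho>" and N: "N \<ge> 1" and c: "(\<lambda>n. norm (c n)) summable_on UNIV"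
  shows "(\<integral>z. exp (a * Re (trig_series (\<lambda>n. of_real (mol_coeff \<rho> N n) * c n) z)) \<partial>torusM)
    \<le> (\<integral>z. exp (a * Re (trig_series c z)) \<partial>torusM)"
proof -
  let ?m = "mollifier \<rho> N"
  note mt = mollifier_test[OF profile N]
  have mper: "torus_periodic ?m" using mt by (simp add: torus_test_def)
  note mcont = torus_test_continuous[OF mt, of UNIV]
  obtain P where P: "\<And>x. \<bar>?m x\<bar> \<le> P" using torus_test_bounded[OF mt] by blast
  obtain B where B: "\<And>z. norm (trig_series c z) \<le> B" using trig_series_norm_le[OF c] by blast
  have [measurable]: "trig_series c \<in> borel_measurable borel" by (rule trig_series_measurable[OF c])
  have conv: "Re (trig_series (\<lambda>n. of_real (mol_coeff \<rho> N n) * c n) z) = (\<integral>w. ?m (z - w) * Re (trig_series c w) \<partial>torusM)" for z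
  proof -
    have [measurable]: "(\<lambda>w. ?m (z - w)) \<in> borel_measurable borel"
      by (rule torus_test_measurable[OF mollifier_translate_test[OF profile N]])
    have "((\<lambda>n. c n * (\<integral>w. cis (freq n \<bullet> w) * of_real (?m (z - w)) \<partial>torusM)) has_sum
        (\<integral>w. trig_series c w * of_real (?m (z - w)) \<partial>torusM)) UNIV"
      by (rule has_sum_integral_trig_series[OF c, of _ P]) (use P in auto)
    also have "(\<lambda>n. c n * (\<integral>w. cis (freq n \<bullet> w) * of_real (?m (z - w)) \<partial>torusM)) =
        (\<lambda>n. of_real (mol_coeff \<rho> N n) * c n * cis (freq n \<bullet> z))"
      using test_coeff_translate[OF profile N, of z] by (simp add: mult.commute fun_eq_iff mult.left_commute)
    finally have "trig_series (\<lambda>n. of_real (mol_coeff \<rho> N n) * c n) z = (\<integral>w. trig_series c w * of_real (?m (z - w)) \<partial>torusM)"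
      unfolding trig_series_def[of "\<lambda>n. of_real (mol_coeff \<rho> N n) * c n"] by (rule infsumI)
    moreover have "integrable torusM (\<lambda>w. trig_series c w * of_real (?m (z - w)))"
    proof (rule torusM.integrable_const_bound[of _ "B * P"])
      show "AE w in torusM. norm (trig_series c w * of_real (?m (z - w))) \<le> B * P"
      proof (rule AE_I2)
        fix w show "norm (trig_series c w * of_real (?m (z - w))) \<le> B * P"
          unfolding norm_mult norm_of_real
          by (intro mult_mono B P abs_ge_zero order_trans[OF norm_ge_zero B])
      qed
    qed simp
    ultimately show ?thesis by (simp add: integral_Re[symmetric] mult.commute)
  qed
  have "(\<integral>z. exp (\<integral>w. ?m (z - w) * (a * Re (trig_series c w)) \<partial>torusM) \<partial>torusM) \<le> (\<integral>w. exp (a * Re (trig_series c w)) \<partial>torusM)"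
  proof (rule jensen_kernel[where P = P and B = "\<bar>a\<bar> * B"])
    show "finite_measure torusM" by (rule torusM.finite_measure_axioms)
    have "(\<lambda>(z, w). ?m (z - w)) \<in> borel_measurable borel"
      unfolding case_prod_unfold
      by (intro borel_measurable_continuous_onI continuous_on_compose2[OF mcont] continuous_intros) auto
    then show "(\<lambda>(z, w). ?m (z - w)) \<in> borel_measurable (torusM \<Otimes>\<^sub>M torusM)"
      unfolding measurable_cong_sets[OF sets_torusM_pair refl] .
    show "0 \<le> ?m (z - w)" for z w by (rule mollifier_nonneg[OF profile N])
    show "?m (z - w) \<le> P" for z w using P[of "z - w"] by simp
    show "(\<integral>w. ?m (z - w) \<partial>torusM) = 1" for z
      using integral_torusM_shift(2)[OF mcont mper, of z] integral_mollifier[OF profile N] by simp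
    show "(\<integral>z. ?m (z - w) \<partial>torusM) = 1" for w
      using integral_torusM_shift(1)[OF mcont mper, of "- w"] integral_mollifier[OF profile N] by simp
    show "\<bar>a * Re (trig_series c w)\<bar> \<le> \<bar>a\<bar> * B" for w
      unfolding abs_mult using abs_Re_le_cmod[of "trig_series c w"] B[of w] by (intro mult_left_mono) auto
  qed measurable
  moreover have "(\<integral>w. ?m (z - w) * (a * Re (trig_series c w)) \<partial>torusM) = a * (\<integral>w. ?m (z - w) * Re (trig_series c w) \<partial>torusM)" for z
    by (subst integral_mult_right_zero[symmetric]) (simp only: mult.left_commute)
  ultimately show ?thesis by (simp add: conv)
qed

section \<open>The logarithmic kernel\<close>

lemma integral_circM_even:
  fixes f G :: "real \<Rightarrow> real"
  assumes cont: "continuous_on UNIV f" and even: "\<And>x. f (- x) = f x"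
    and G: "\<And>x. 0 \<le> x \<Longrightarrow> x \<le> pi \<Longrightarrow> (G has_real_derivative f x) (at x)"
  shows "(\<integral>x. f x \<partial>circM) = 2 * (G pi - G 0)"
proof -
  have [measurable]: "f \<in> borel_measurable borel" using cont by (rule borel_measurable_continuous_onI)
  have "(\<integral>x. f x \<partial>circM) = (\<integral>x. f x \<partial>density lborel (\<lambda>x. ennreal (indicator {-pi..pi} x)))"
    unfolding circM_closed by (simp add: ennreal_indicator)
  also have "\<dots> = (LINT x:{-pi..pi}|lborel. f x)"
    unfolding set_lebesgue_integral_def by (rule integral_density) auto
  also have "\<dots> = integral {-pi..pi} f"
    by (rule set_borel_integral_eq_integral(2)) (intro borel_integrable_atLeastAtMost' continuous_on_subset[OF cont], simp)
  also have "\<dots> = integral {-pi..0} f + integral {0..pi} f"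
    by (rule Henstock_Kurzweil_Integration.integral_combine[symmetric])
       (auto intro!: integrable_continuous_interval continuous_on_subset[OF cont])
  also have "integral {-pi..0} f = integral {0..pi} f"
    using Henstock_Kurzweil_Integration.integral_reflect_real[of pi 0 f] by (simp add: even)
  also have "integral {0..pi} f = G pi - G 0"
    by (rule integral_unique, rule fundamental_theorem_of_calculus)
       (use G in \<open>auto simp: has_real_derivative_iff_has_vector_derivative[symmetric] intro: has_field_derivative_at_within\<close>)
  finally show ?thesis by simp
qed

text \<open>The Fourier transform of exp (- a |s|), cut off to one period. The cutoff leaves the
  term exp (- a pi) cos (k pi), exponentially small in a; the sine part drops out by oddness, and
  its boundary term at pi because k is an integer.\<close>

lemma integral_circM_exp_cis:
  assumes a: "a > 0"
  shows "(\<integral>s. of_real (exp (- a * \<bar>s\<bar>)) * cis (- (of_int k * s)) \<partial>circM)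
    = of_real (2 * a * (1 - exp (- a * pi) * cos (of_int k * pi)) / (a\<^sup>2 + (of_int k)\<^sup>2))"
proof -
  let ?k = "of_int k :: real"
  define G where "G s = exp (- a * s) * (?k * sin (?k * s) - a * cos (?k * s)) / (a\<^sup>2 + ?k\<^sup>2)" for s
  have pos: "a\<^sup>2 + ?k\<^sup>2 > 0" using a by (intro add_pos_nonneg) auto
  have "(\<integral>s. exp (- a * \<bar>s\<bar>) * cos (?k * s) \<partial>circM) = 2 * (G pi - G 0)"
  proof (rule integral_circM_even)
    fix x :: real assume x: "0 \<le> x"
    have "((\<lambda>s. exp (- a * s) * (?k * sin (?k * s) - a * cos (?k * s))) has_real_derivative
       (exp (- a * x) * (- a) * (?k * sin (?k * x) - a * cos (?k * x)) + exp (- a * x) * (?k * (cos (?k * x) * ?k) - a * (- sin (?k * x) * ?k)))) (at x)"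
      by (auto intro!: derivative_eq_intros simp: algebra_simps)
    also have "(exp (- a * x) * (- a) * (?k * sin (?k * x) - a * cos (?k * x)) + exp (- a * x) * (?k * (cos (?k * x) * ?k) - a * (- sin (?k * x) * ?k)))
       = exp (- a * x) * cos (?k * x) * (a\<^sup>2 + ?k\<^sup>2)"
      by (simp add: algebra_simps power2_eq_square)
    finally have "(G has_real_derivative exp (- a * x) * cos (?k * x) * (a\<^sup>2 + ?k\<^sup>2) / (a\<^sup>2 + ?k\<^sup>2)) (at x)"
      unfolding G_def by (rule DERIV_cdivide)
    then show "(G has_real_derivative exp (- a * \<bar>x\<bar>) * cos (?k * x)) (at x)" using pos x a by simp
  qed (auto intro!: continuous_intros)
  also have "2 * (G pi - G 0) = 2 * a * (1 - exp (- a * pi) * cos (?k * pi)) / (a\<^sup>2 + ?k\<^sup>2)"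
    unfolding G_def using pos by (simp add: mult.commute[of _ pi] diff_divide_distrib[symmetric] algebra_simps)
  finally have cosint: "(\<integral>s. exp (- a * \<bar>s\<bar>) * cos (?k * s) \<partial>circM) = 2 * a * (1 - exp (- a * pi) * cos (?k * pi)) / (a\<^sup>2 + ?k\<^sup>2)" .
  have "(\<integral>s. exp (- a * \<bar>- s\<bar>) * sin (?k * - s) \<partial>circM) = (\<integral>s. exp (- a * \<bar>s\<bar>) * sin (?k * s) \<partial>circM)"
    by (rule integral_circM_reflect[of "\<lambda>s. exp (- a * \<bar>s\<bar>) * sin (?k * s)"]) simp
  then have sinint: "(\<integral>s. exp (- a * \<bar>s\<bar>) * sin (?k * s) \<partial>circM) = 0" by simp
  have exp1: "exp (- a * \<bar>s\<bar>) \<le> 1" for s using a by simp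
  have le1: "\<bar>exp (- a * \<bar>s\<bar>) * t\<bar> \<le> 1" if "\<bar>t\<bar> \<le> 1" for s t :: real
    unfolding abs_mult using exp1[of s] that mult_mono[of "exp (- a * \<bar>s\<bar>)" 1 "\<bar>t\<bar>" 1] by simp
  have int: "integrable circM (\<lambda>s. exp (- a * \<bar>s\<bar>) * cos (?k * s))" "integrable circM (\<lambda>s. exp (- a * \<bar>s\<bar>) * sin (?k * s))"
    by (rule circM.integrable_const_bound[of _ 1], use le1 in \<open>simp_all add: AE_I2\<close>)+
  have "(\<integral>s. of_real (exp (- a * \<bar>s\<bar>)) * cis (- (?k * s)) \<partial>circM) =
     (\<integral>s. of_real (exp (- a * \<bar>s\<bar>) * cos (?k * s)) - \<i> * of_real (exp (- a * \<bar>s\<bar>) * sin (?k * s)) \<partial>circM)"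
    by (intro Bochner_Integration.integral_cong) (auto simp: complex_eq_iff)
  also have "\<dots> = of_real (\<integral>s. exp (- a * \<bar>s\<bar>) * cos (?k * s) \<partial>circM) - \<i> * of_real (\<integral>s. exp (- a * \<bar>s\<bar>) * sin (?k * s) \<partial>circM)"
    by (subst Bochner_Integration.integral_diff)
       (use int in \<open>auto simp del: of_real_mult simp: integral_complex_of_real\<close>)
  also have "\<dots> = of_real (2 * a * (1 - exp (- a * pi) * cos (?k * pi)) / (a\<^sup>2 + ?k\<^sup>2))"
    unfolding cosint sinint by simp
  finally show ?thesis .
qed

lemma has_sum_int_split:
  fixes f :: "int \<Rightarrow> 'b::{topological_comm_monoid_add,t2_space}"
  assumes a: "((\<lambda>n. f (int n)) has_sum a) {1..}" and b: "((\<lambda>n. f (- int n)) has_sum b) {1..}"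
  shows "(f has_sum (f 0 + a + b)) UNIV"
proof -
  have "(f has_sum a) (int ` {1..})"
    by (subst has_sum_reindex) (use a in \<open>auto simp: o_def\<close>)
  moreover have "(f has_sum b) ((\<lambda>n. - int n) ` {1..})"
    by (subst has_sum_reindex) (use b in \<open>auto simp: o_def inj_on_def\<close>)
  moreover have "(f has_sum f 0) {0}" by (simp add: has_sum_finite_iff)
  ultimately have "(f has_sum ((f 0 + a) + b)) (({0} \<union> int ` {1..}) \<union> (\<lambda>n. - int n) ` {1..})"
    by (intro has_sum_Un_disjoint) auto
  also have "({0} \<union> int ` {1..}) \<union> (\<lambda>n. - int n) ` {1..} = (UNIV :: int set)"
  proof -
    have "m \<in> ({0} \<union> int ` {1..}) \<union> (\<lambda>n. - int n) ` {1..}" for m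
      by (cases m rule: int_cases3) (auto simp: image_iff intro: bexI[of _ "nat \<bar>m\<bar>"])
    then show ?thesis by blast
  qed
  finally show ?thesis .
qed

lemma summable_on_int_geometric:
  assumes "0 \<le> q" "q < (1::real)" shows "(\<lambda>k::int. q ^ nat \<bar>k\<bar>) summable_on UNIV"
proof -
  have "((\<lambda>n. q ^ n) has_sum (q / (1 - q))) {1..}" by (rule has_sum_geometric_from_1) (use assms in simp)
  then have "((\<lambda>k::int. q ^ nat \<bar>k\<bar>) has_sum (q ^ nat \<bar>0\<bar> + q / (1 - q) + q / (1 - q))) UNIV"
    by (intro has_sum_int_split) simp_all
  then show ?thesis by (rule has_sum_imp_summable)
qed

section \<open>The Poisson kernel and the logarithmic kernel as Fourier series\<close>

definition poisson :: "real \<Rightarrow> real \<Rightarrow> real" where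
  "poisson q y = (1 - q\<^sup>2) / (norm (1 - of_real q * cis y))\<^sup>2"

definition logker :: "real \<Rightarrow> real \<Rightarrow> real \<Rightarrow> real" where
  "logker q x s = - ln (norm (1 - of_real (q * exp (- \<bar>s\<bar>)) * cis x))"

text \<open>
  For \<open>n = (m, k)\<close> with \<open>m \<noteq> 0\<close> this is \<open>1 / (2 \<bar>m\<bar>)\<close> times the integral of \<open>exp (- \<bar>m\<bar> \<bar>s\<bar>) * cos (k * s)\<close>
  over \<open>[-pi, pi]\<close>, that is, the coefficient of \<open>- log \<bar>1 - exp (i x - \<bar>s\<bar>)\<bar>\<close> up to a constant; it differs
  from \<open>1 / (jbracket n)\<^sup>2\<close> by a summable amount.  The terms with \<open>m = 0\<close> are summable and dropped.
\<close>

definition logcoef :: "int \<times> int \<Rightarrow> real" where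
  "logcoef n = (if fst n = 0 then 0 else
     (1 - exp (- \<bar>of_int (fst n)\<bar> * pi) * cos (of_int (snd n) * pi)) / ((of_int (fst n))\<^sup>2 + (of_int (snd n))\<^sup>2))"

context
  fixes q :: real
  assumes q: "0 \<le> q" "q < 1"
begin

lemma norm_one_minus_ge: "0 \<le> r \<Longrightarrow> r \<le> q \<Longrightarrow> 1 - q \<le> norm (1 - of_real r * cis y)"
  using norm_triangle_ineq2[of 1 "of_real r * cis y"] by (simp add: norm_mult)

lemma poisson_nonneg: "0 \<le> poisson q y"
  using q by (simp add: poisson_def abs_square_le_1)

lemma poisson_le: "poisson q y \<le> (1 - q\<^sup>2) / (1 - q)\<^sup>2"
  unfolding poisson_def using q norm_one_minus_ge[of q y]
  by (intro divide_left_mono mult_pos_pos zero_less_power power_mono) (auto simp: abs_square_le_1)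

lemma continuous_poisson: "continuous_on UNIV (poisson q)"
proof -
  have "norm (1 - of_real q * cis y) \<noteq> 0" for y using norm_one_minus_ge[of q y] q by linarith
  then show ?thesis unfolding poisson_def by (intro continuous_intros) auto
qed

lemma poisson_minus: "poisson q (- y) = poisson q y"
proof -
  have "1 - of_real q * cis (- y) = cnj (1 - of_real q * cis y)" by (simp add: cis_cnj)
  then show ?thesis unfolding poisson_def by (simp only: complex_mod_cnj)
qed

lemma has_sum_poisson: "((\<lambda>k::int. of_real (q ^ nat \<bar>k\<bar>) * cis (of_int k * y)) has_sum of_real (poisson q y)) UNIV"
proof -
  define z where "z = of_real q * cis y"
  have nz: "norm z < 1" using q by (simp add: z_def norm_mult)
  then have z1: "1 - z \<noteq> 0" "1 - cnj z \<noteq> 0" by (auto simp: complex_eq_iff) (metis norm_one less_irrefl complex_surj one_complex.code)+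
  have geo: "((\<lambda>n. z ^ n) has_sum (z / (1 - z))) {1..}" by (rule has_sum_geometric_from_1[OF nz])
  have geo': "((\<lambda>n. cnj (z ^ n)) has_sum cnj (z / (1 - z))) {1..}" using geo by (simp only: has_sum_cnj_iff)
  have zn: "z ^ n = of_real (q ^ n) * cis (of_int (int n) * y)" for n
    by (simp add: z_def power_mult_distrib Complex.DeMoivre)
  have "((\<lambda>k::int. of_real (q ^ nat \<bar>k\<bar>) * cis (of_int k * y)) has_sum
     (of_real (q ^ nat \<bar>0\<bar>) * cis (of_int 0 * y) + z / (1 - z) + cnj (z / (1 - z)))) UNIV"
  proof (rule has_sum_int_split)
    show "((\<lambda>n. of_real (q ^ nat \<bar>int n\<bar>) * cis (of_int (int n) * y)) has_sum z / (1 - z)) {1..}"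
      using geo unfolding zn by simp
    show "((\<lambda>n. of_real (q ^ nat \<bar>- int n\<bar>) * cis (of_int (- int n) * y)) has_sum cnj (z / (1 - z))) {1..}"
      using geo' unfolding zn by (simp add: cis_cnj)
  qed
  also have "of_real (q ^ nat \<bar>0\<bar>) * cis (of_int 0 * y) + z / (1 - z) + cnj (z / (1 - z)) = of_real (poisson q y)"
  proof -
    have "of_real ((norm z)\<^sup>2) = (of_real (q\<^sup>2) :: complex)" using q by (simp add: z_def norm_mult)
    then have zz: "z * cnj z = of_real (q\<^sup>2)" by (simp only: complex_norm_square)
    have "1 + z / (1 - z) + cnj z / (1 - cnj z) = (1 - z * cnj z) / ((1 - z) * (1 - cnj z))"
      using z1 by (simp add: field_simps)
    also have "\<dots> = of_real (1 - q\<^sup>2) / of_real ((norm (1 - z))\<^sup>2)"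
      unfolding zz complex_norm_square by simp
    finally show ?thesis unfolding poisson_def z_def[symmetric] by simp
  qed
  finally show ?thesis .
qed

lemma integral_poisson: "(\<integral>y. poisson q (y - s) \<partial>circM) = 2 * pi" "(\<integral>s. poisson q (y - s) \<partial>circM) = 2 * pi"
proof -
  have *: "(\<integral>y. poisson q (y - s) \<partial>circM) = 2 * pi" for s
  proof -
    have [measurable]: "(\<lambda>y. poisson q (y - s)) \<in> borel_measurable borel"
      by (intro borel_measurable_continuous_onI continuous_on_compose2[OF continuous_poisson] continuous_intros) auto
    have h1: "((\<lambda>k::int. \<integral>y. of_real (q ^ nat \<bar>k\<bar>) * cis (of_int k * (y - s)) \<partial>circM) has_sum (\<integral>y. of_real (poisson q (y - s)) \<partial>circM)) UNIV"
    proof (rule has_sum_integral_dominated[OF circM.finite_measure_axioms _ _ summable_on_int_geometric[OF q]])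
      show "(\<lambda>y. of_real (q ^ nat \<bar>k\<bar>) * cis (of_int k * (y - s))) \<in> borel_measurable circM" for k :: int
        unfolding measurable_cong_sets[OF sets_circM refl] by (intro borel_measurable_continuous_onI continuous_intros)
    qed (use q has_sum_poisson in \<open>auto simp: norm_mult norm_power\<close>)
    have h2: "(\<integral>y. of_real (q ^ nat \<bar>k\<bar>) * cis (of_int k * (y - s)) \<partial>circM) = (if k = 0 then of_real (2 * pi) else 0)" for k :: int
    proof -
      have "(\<integral>y. of_real (q ^ nat \<bar>k\<bar>) * cis (of_int k * (y - s)) \<partial>circM)
         = (\<integral>y. (of_real (q ^ nat \<bar>k\<bar>) * cis (- (of_int k * s))) * cis (of_int k * y) \<partial>circM)"
        by (simp add: right_diff_distrib mult.assoc cis_mult)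
      also have "\<dots> = (of_real (q ^ nat \<bar>k\<bar>) * cis (- (of_int k * s))) * (\<integral>y. cis (of_int k * y) \<partial>circM)"
        by (rule integral_mult_right_zero)
      also have "\<dots> = (if k = 0 then of_real (2 * pi) else 0)" unfolding integral_circM_cis by simp
      finally show ?thesis .
    qed
    have h3: "((\<lambda>k::int. if k = 0 then of_real (2 * pi) else 0 :: complex) has_sum of_real (2 * pi)) UNIV"
      by (rule has_sum_finite_neutralI[of "{0}"]) auto
    have "(\<integral>y. of_real (poisson q (y - s)) \<partial>circM) = (of_real (2 * pi) :: complex)"
      by (rule has_sum_unique[OF h1[unfolded h2] h3])
    then have "of_real (\<integral>y. poisson q (y - s) \<partial>circM) = (of_real (2 * pi) :: complex)"
      by (simp only: integral_complex_of_real)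
    then show ?thesis unfolding of_real_eq_iff .
  qed
  then show "(\<integral>y. poisson q (y - s) \<partial>circM) = 2 * pi" .
  have "poisson q (y - s) = poisson q (s - y)" for s using poisson_minus[of "y - s"] by simp
  then show "(\<integral>s. poisson q (y - s) \<partial>circM) = 2 * pi" using *[of y] by simp
qed

lemma logker_arg: "1 - q \<le> norm (1 - of_real (q * exp (- \<bar>s\<bar>)) * cis x)"
  by (rule norm_one_minus_ge) (use q in \<open>auto simp: mult_left_le\<close>)

lemma logker_bounded: "\<bar>logker q x s\<bar> \<le> \<bar>ln (1 - q)\<bar> + ln 2"
proof -
  let ?v = "norm (1 - of_real (q * exp (- \<bar>s\<bar>)) * cis x)"
  have "?v \<le> 1 + q * exp (- \<bar>s\<bar>)"
    using norm_triangle_ineq4[of 1 "of_real (q * exp (- \<bar>s\<bar>)) * cis x"] q by (simp add: norm_mult)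
  also have "\<dots> \<le> 1 + 1 * 1" using q by (intro add_mono mult_mono) auto
  finally have "ln ?v \<le> ln 2" using logker_arg[of s x] q by (intro ln_mono) auto
  moreover have "ln (1 - q) \<le> ln ?v" using logker_arg[of s x] q by (intro ln_mono) auto
  moreover have "0 \<le> ln (2 :: real)" by simp
  ultimately show ?thesis unfolding logker_def by linarith
qed

lemma continuous_logker: "continuous_on UNIV (\<lambda>p. logker q (fst p) (snd p))"
proof -
  have "norm (1 - of_real (q * exp (- \<bar>snd p\<bar>)) * cis (fst p)) \<noteq> 0" for p
    using logker_arg[of "snd p" "fst p"] q by linarith
  then show ?thesis unfolding logker_def by (intro continuous_intros) auto
qed

text \<open>The power series of - ln (1 - z) at z = q exp (- |s|) cis x. Positive m carry half of
  it, negative m half of its conjugate, which adds up to the real part.\<close>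

lemma has_sum_logker:
  "((\<lambda>m::int. if m = 0 then 0 else of_real ((q * exp (- \<bar>s\<bar>)) ^ nat \<bar>m\<bar> / (2 * \<bar>of_int m\<bar>)) * cis (of_int m * x))
     has_sum of_real (logker q x s)) UNIV" (is "(?f has_sum _) UNIV")
proof -
  define r where "r = q * exp (- \<bar>s\<bar>)"
  define z where "z = of_real r * cis x"
  have r: "0 \<le> r" "r \<le> q" unfolding r_def using q by (auto simp: mult_left_le)
  have nz: "norm z < 1" using q r by (simp add: z_def norm_mult)
  have zn: "z ^ n = of_real (r ^ n) * cis (of_int (int n) * x)" for n
    by (simp add: z_def power_mult_distrib Complex.DeMoivre)
  have "(\<lambda>n. - ((- (- z)) ^ n) / of_nat n) sums ln (1 + - z)"
    by (rule Ln_series') (use nz in simp)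
  then have "(\<lambda>n. z ^ n / of_nat n) sums (- ln (1 - z))"
    using sums_minus by fastforce
  moreover have "summable (\<lambda>n. norm (z ^ n / of_nat n))"
  proof (rule summable_comparison_test')
    show "summable (\<lambda>n. norm z ^ n)" using nz by (intro summable_geometric) simp
    show "norm (norm (z ^ n / of_nat n)) \<le> norm z ^ n" if "n \<ge> 1" for n
      using that by (simp add: norm_divide norm_power divide_le_eq mult_le_cancel_left1)
  qed
  ultimately have "((\<lambda>n. z ^ n / of_nat n) has_sum (- ln (1 - z))) UNIV"
    by (intro norm_summable_imp_has_sum)
  also have "?this \<longleftrightarrow> ((\<lambda>n. z ^ n / of_nat n) has_sum (- ln (1 - z))) {1..}"
    by (rule has_sum_cong_neutral) (auto simp: not_le)
  finally have L: "((\<lambda>n. z ^ n / of_nat n * (1 / 2)) has_sum (- ln (1 - z) * (1 / 2))) {1..}"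
    by (rule has_sum_cmult_left)
  have L': "((\<lambda>n. cnj (z ^ n / of_nat n * (1 / 2))) has_sum cnj (- ln (1 - z) * (1 / 2))) {1..}"
    using L by (simp only: has_sum_cnj_iff)
  have "(?f has_sum (?f 0 + (- ln (1 - z) * (1 / 2)) + cnj (- ln (1 - z) * (1 / 2)))) UNIV"
  proof (rule has_sum_int_split)
    show "((\<lambda>n. ?f (int n)) has_sum (- ln (1 - z) * (1 / 2))) {1..}"
      by (rule has_sum_cong[THEN iffD1, OF _ L]) (simp add: zn r_def[symmetric])
    show "((\<lambda>n. ?f (- int n)) has_sum cnj (- ln (1 - z) * (1 / 2))) {1..}"
      by (rule has_sum_cong[THEN iffD1, OF _ L']) (simp add: zn r_def[symmetric] cis_cnj)
  qed
  also have "?f 0 + (- ln (1 - z) * (1 / 2)) + cnj (- ln (1 - z) * (1 / 2)) = of_real (- Re (ln (1 - z)))"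
    by (simp add: complex_eq_iff)
  also have "- Re (ln (1 - z)) = logker q x s"
  proof -
    have "1 - z \<noteq> 0" using logker_arg[of s x] q unfolding z_def r_def by auto
    then show ?thesis by (simp add: logker_def z_def r_def)
  qed
  finally show ?thesis .
qed

lemma summable_on_geometric2:
  "(\<lambda>n::int \<times> int. q ^ nat \<bar>fst n\<bar> * q ^ nat \<bar>snd n\<bar>) summable_on UNIV"
  using summable_on_product_real[OF summable_on_int_geometric[OF q] summable_on_int_geometric[OF q]] q
  by (simp add: case_prod_unfold)

text \<open>Both factors under the integral are expanded, the logarithm in x and the Poisson kernel
  in y - s. The double series is dominated by q^(|m| + |k|) uniformly in s and may be integrated
  term by term; the integral over s is \<open>integral_circM_exp_cis\<close> with a = |m|, which
  produces \<open>logcoef\<close>.\<close>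

lemma trig_series_logcoef:
  "trig_series (\<lambda>n. of_real (q ^ nat \<bar>fst n\<bar> * q ^ nat \<bar>snd n\<bar> * logcoef n)) (x, y)
    = of_real (\<integral>s. logker q x s * poisson q (y - s) \<partial>circM)"
proof -
  define A where "A s m = (if m = 0 then 0 else of_real ((q * exp (- \<bar>s\<bar>)) ^ nat \<bar>m\<bar> / (2 * \<bar>of_int m\<bar>)) * cis (of_int m * x))" for s and m :: int
  define B where "B s k = of_real (q ^ nat \<bar>k\<bar>) * cis (of_int k * (y - s))" for s and k :: int
  have A_le: "norm (A s m) \<le> q ^ nat \<bar>m\<bar>" for s m
  proof (cases "m = 0")
    case False
    have "(q * exp (- \<bar>s\<bar>)) ^ nat \<bar>m\<bar> / (2 * \<bar>of_int m\<bar>) \<le> q ^ nat \<bar>m\<bar> / 1"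
      using q False by (intro frac_le power_mono) (auto simp: mult_left_le)
    then show ?thesis using False q by (simp add: A_def norm_mult norm_divide norm_power abs_mult)
  qed (use q in \<open>simp add: A_def\<close>)
  have B_le: "norm (B s k) \<le> q ^ nat \<bar>k\<bar>" for s k using q by (simp add: B_def norm_mult norm_power)
  have AB_le: "norm (A s (fst n) * B s (snd n)) \<le> q ^ nat \<bar>fst n\<bar> * q ^ nat \<bar>snd n\<bar>" for s n
    unfolding norm_mult using q by (intro mult_mono A_le B_le) auto
  have [measurable]: "(\<lambda>s. logker q x s) \<in> borel_measurable borel" "(\<lambda>s. poisson q (y - s)) \<in> borel_measurable borel"
    using continuous_on_Pair2[OF continuous_logker, of x]
    by (auto intro!: borel_measurable_continuous_onI continuous_on_compose2[OF continuous_poisson] continuous_intros)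
  have "((\<lambda>n. \<integral>s. A s (fst n) * B s (snd n) \<partial>circM) has_sum (\<integral>s. of_real (logker q x s * poisson q (y - s)) \<partial>circM)) UNIV"
  proof (rule has_sum_integral_dominated[OF circM.finite_measure_axioms _ AB_le summable_on_geometric2])
    show "(\<lambda>s. A s (fst n) * B s (snd n)) \<in> borel_measurable circM" for n
    proof (cases "fst n = 0")
      case False
      then have eq: "(\<lambda>s. A s (fst n) * B s (snd n)) = (\<lambda>s. of_real ((q * exp (- \<bar>s\<bar>)) ^ nat \<bar>fst n\<bar> / (2 * \<bar>of_int (fst n)\<bar>)) *
          cis (of_int (fst n) * x) * (of_real (q ^ nat \<bar>snd n\<bar>) * cis (of_int (snd n) * (y - s))))"
        by (simp add: A_def B_def)
      show ?thesis unfolding eq measurable_cong_sets[OF sets_circM refl]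
        using False by (intro borel_measurable_continuous_onI continuous_intros) auto
    qed (simp add: A_def)
    fix s
    have sm: "(\<lambda>n. A s (fst n) * B s (snd n)) summable_on UNIV \<times> UNIV"
      using abs_summable_summable[OF Infinite_Sum.abs_summable_on_comparison_test'[OF summable_on_geometric2 AB_le]] by simp
    \<comment> \<open>The sum over pairs is evaluated as an iterated sum: first over k, giving the
      Poisson kernel, then over m, giving the logarithm.\<close>
    have "((\<lambda>n. A s (fst n) * B s (snd n)) has_sum (of_real (logker q x s) * of_real (poisson q (y - s)))) (UNIV \<times> UNIV)"
    proof (rule has_sum_SigmaI[OF _ _ sm])
      show "((\<lambda>k. A s (fst (m, k)) * B s (snd (m, k))) has_sum (A s m * of_real (poisson q (y - s)))) UNIV" for m
        unfolding fst_conv snd_conv B_def by (intro has_sum_cmult_right has_sum_poisson)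
      show "((\<lambda>m. A s m * of_real (poisson q (y - s))) has_sum of_real (logker q x s) * of_real (poisson q (y - s))) UNIV"
        unfolding A_def by (intro has_sum_cmult_left has_sum_logker)
    qed
    then show "((\<lambda>n. A s (fst n) * B s (snd n)) has_sum of_real (logker q x s * poisson q (y - s))) UNIV" by simp
  qed simp
  moreover have "(\<integral>s. A s (fst n) * B s (snd n) \<partial>circM)
      = of_real (q ^ nat \<bar>fst n\<bar> * q ^ nat \<bar>snd n\<bar> * logcoef n) * cis (freq n \<bullet> (x, y))" for n
  proof (cases "fst n = 0")
    case False
    obtain m k where n: "n = (m, k)" by (cases n)
    let ?a = "\<bar>of_int m\<bar> :: real"
    have m: "m \<noteq> 0" "?a > 0" using False n by auto
    have e: "(q * exp (- \<bar>s\<bar>)) ^ nat \<bar>m\<bar> = q ^ nat \<bar>m\<bar> * exp (- ?a * \<bar>s\<bar>)" for s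
      by (simp add: power_mult_distrib exp_of_nat_mult[symmetric])
    have "A s m * B s k = (of_real (q ^ nat \<bar>m\<bar> * q ^ nat \<bar>k\<bar> / (2 * ?a)) * cis (freq n \<bullet> (x, y))) *
         (of_real (exp (- ?a * \<bar>s\<bar>)) * cis (- (of_int k * s)))" for s
    proof -
      have "cis (of_int m * x) * cis (of_int k * (y - s)) = cis (freq n \<bullet> (x, y)) * cis (- (of_int k * s))"
        by (simp add: n freq_inner cis_mult algebra_simps)
      then show ?thesis using m unfolding A_def B_def e by (simp add: mult_ac)
    qed
    then have "(\<integral>s. A s m * B s k \<partial>circM) = (of_real (q ^ nat \<bar>m\<bar> * q ^ nat \<bar>k\<bar> / (2 * ?a)) * cis (freq n \<bullet> (x, y))) *
        (\<integral>s. of_real (exp (- ?a * \<bar>s\<bar>)) * cis (- (of_int k * s)) \<partial>circM)"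
      by simp
    also have "\<dots> = of_real (q ^ nat \<bar>m\<bar> * q ^ nat \<bar>k\<bar> / (2 * ?a) *
        (2 * ?a * (1 - exp (- ?a * pi) * cos (of_int k * pi)) / (?a\<^sup>2 + (of_int k)\<^sup>2))) * cis (freq n \<bullet> (x, y))"
      unfolding integral_circM_exp_cis[OF m(2)] of_real_mult by (simp only: mult_ac)
    also have "q ^ nat \<bar>m\<bar> * q ^ nat \<bar>k\<bar> / (2 * ?a) *
        (2 * ?a * (1 - exp (- ?a * pi) * cos (of_int k * pi)) / (?a\<^sup>2 + (of_int k)\<^sup>2))
      = q ^ nat \<bar>m\<bar> * q ^ nat \<bar>k\<bar> * ((1 - exp (- ?a * pi) * cos (of_int k * pi)) / (?a\<^sup>2 + (of_int k)\<^sup>2))"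
      using m by simp
    also have "(1 - exp (- ?a * pi) * cos (of_int k * pi)) / (?a\<^sup>2 + (of_int k)\<^sup>2) = logcoef n"
      using m by (simp add: logcoef_def n)
    finally show ?thesis by (simp add: n)
  qed (simp add: A_def logcoef_def)
  ultimately show ?thesis
    unfolding trig_series_def by (simp add: infsumI integral_complex_of_real del: of_real_mult)
qed

end

section \<open>The size of the logarithmic singularity\<close>

lemma abs_sin_half_ge:
  assumes "\<bar>x\<bar> \<le> pi" shows "\<bar>x\<bar> / 6 \<le> \<bar>sin (x / 2)\<bar>"
proof -
  define t where "t = x / 2"
  \<comment> \<open>The cubic error |t|^3 / 6 is at most 2/3 |t| for |t| \<le> 2, which leaves |sin
    t| \<ge> |t| / 3. The crude pi < 4 is good enough.\<close>
  have t: "\<bar>t\<bar> \<le> 2" using assms pi_less_4 unfolding t_def by linarith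
  have "\<bar>sin t - (\<Sum>m<3. sin_coeff m * t ^ m)\<bar> \<le> inverse (fact 3) * \<bar>t\<bar> ^ 3"
    by (rule Maclaurin_sin_bound)
  moreover have "(\<Sum>m<3. sin_coeff m * t ^ m) = t"
    by (simp add: numeral_3_eq_3 sin_coeff_def)
  moreover have "inverse (fact 3) * \<bar>t\<bar> ^ 3 \<le> 2 / 3 * \<bar>t\<bar>"
  proof -
    have "\<bar>t\<bar> * \<bar>t\<bar> \<le> 2 * 2" using t by (intro mult_mono) auto
    then have "\<bar>t\<bar> * \<bar>t\<bar> * \<bar>t\<bar> \<le> 4 * \<bar>t\<bar>" by (intro mult_right_mono) auto
    then show ?thesis by (simp add: fact_numeral power3_eq_cube)
  qed
  ultimately have "\<bar>t\<bar> / 3 \<le> \<bar>sin t\<bar>" by linarith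
  then show ?thesis by (simp add: t_def)
qed

lemma norm_cis_minus_1: "norm (cis x - 1) = 2 * \<bar>sin (x / 2)\<bar>"
proof -
  have "(norm (cis x - 1))\<^sup>2 = (cos x - 1)\<^sup>2 + (sin x)\<^sup>2" by (simp add: cmod_power2)
  also have "\<dots> = 2 - 2 * cos x" using sin_cos_squared_add[of x] by (simp add: power2_eq_square algebra_simps)
  also have "\<dots> = (2 * \<bar>sin (x / 2)\<bar>)\<^sup>2"
    using cos_double_sin[of "x / 2"] by (simp add: power_mult_distrib)
  finally show ?thesis by (rule power2_eq_imp_eq) auto
qed

text \<open>Moving r cis x radially to the unit circle costs 1 - r, which is itself at most |1 - r
  cis x|. Hence the distance of cis x to 1 is at most twice the quantity in question.\<close>

lemma norm_one_minus_ge_arg: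
  assumes "\<bar>x\<bar> \<le> pi" "0 \<le> r" "r \<le> 1" shows "\<bar>x\<bar> / 6 \<le> norm (1 - of_real r * cis x)"
proof -
  have "norm (cis x - 1) \<le> norm (cis x - of_real r * cis x) + norm (of_real r * cis x - 1)"
    using norm_triangle_ineq[of "cis x - of_real r * cis x" "of_real r * cis x - 1"] by simp
  also have "cis x - of_real r * cis x = of_real (1 - r) * cis x" by (simp add: algebra_simps)
  also have "norm (of_real (1 - r) * cis x) = 1 - r" using assms by (simp add: norm_mult del: of_real_diff)
  also have "1 - r \<le> norm (1 - of_real r * cis x)"
    using norm_triangle_ineq2[of 1 "of_real r * cis x"] assms by (simp add: norm_mult)
  finally have "norm (cis x - 1) \<le> 2 * norm (1 - of_real r * cis x)" by (simp add: norm_minus_commute)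
  then show ?thesis using abs_sin_half_ge[OF assms(1)] unfolding norm_cis_minus_1 by linarith
qed

text \<open>The modulus v under the logarithm is bounded below both by |x| / 6 and by |s| exp (-
  pi), so v^2 dominates their product. This is why the exponent is written as 2 kappa: the bound
  factorizes into powers - kappa in one variable each, uniformly in q.\<close>

lemma exp_logker_le:
  assumes q: "0 \<le> q" "q < 1" and x: "x \<noteq> 0" "\<bar>x\<bar> \<le> pi" and s: "s \<noteq> 0" "\<bar>s\<bar> \<le> pi" and \<kappa>: "0 \<le> \<kappa>"
  shows "exp (2 * \<kappa> * logker q x s) \<le> (6 * exp pi) powr \<kappa> * (\<bar>x\<bar> powr - \<kappa> * \<bar>s\<bar> powr - \<kappa>)"
proof -
  define r where "r = q * exp (- \<bar>s\<bar>)"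
  define v where "v = norm (1 - of_real r * cis x)"
  have r: "0 \<le> r" "r \<le> exp (- \<bar>s\<bar>)" "r \<le> 1" using q by (auto simp: r_def mult_left_le_one_le intro: order_trans[OF mult_left_le_one_le])
  have v1: "\<bar>x\<bar> / 6 \<le> v" unfolding v_def by (rule norm_one_minus_ge_arg[OF x(2) r(1,3)])
  \<comment> \<open>From exp |s| \<ge> 1 + |s| one gets 1 - exp (- |s|) \<ge> |s| exp (- |s|), and
    |s| \<le> pi turns the last factor into a constant.\<close>
  have "\<bar>s\<bar> * exp (- pi) \<le> \<bar>s\<bar> * exp (- \<bar>s\<bar>)" using s by (intro mult_left_mono) auto
  also have "\<dots> \<le> 1 - exp (- \<bar>s\<bar>)"
  proof -
    have "(1 + \<bar>s\<bar>) * exp (- \<bar>s\<bar>) \<le> exp \<bar>s\<bar> * exp (- \<bar>s\<bar>)"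
      by (intro mult_right_mono exp_ge_add_one_self) auto
    then show ?thesis by (simp add: algebra_simps flip: exp_add)
  qed
  also have "\<dots> \<le> 1 - r" using r by simp
  also have "\<dots> \<le> v" unfolding v_def
    using norm_triangle_ineq2[of 1 "of_real r * cis x"] r by (simp add: norm_mult)
  finally have v2: "\<bar>s\<bar> * exp (- pi) \<le> v" .
  have x6: "0 < \<bar>x\<bar> / 6" and sp: "0 < \<bar>s\<bar> * exp (- pi)" using x s by auto
  have v: "v > 0" using v1 x6 by linarith
  have "ln (\<bar>x\<bar> / 6) \<le> ln v" "ln (\<bar>s\<bar> * exp (- pi)) \<le> ln v"
    using v1 v2 x6 sp by (auto intro: ln_mono)
  then have "ln \<bar>x\<bar> - ln 6 + ln \<bar>s\<bar> - pi \<le> 2 * ln v"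
    using x s by (simp add: ln_div ln_mult)
  then have "\<kappa> * (ln \<bar>x\<bar> - ln 6 + ln \<bar>s\<bar> - pi) \<le> \<kappa> * (2 * ln v)" using \<kappa> by (rule mult_left_mono)
  then have "2 * \<kappa> * logker q x s \<le> \<kappa> * (ln 6 + pi) + (- \<kappa> * ln \<bar>x\<bar> + - \<kappa> * ln \<bar>s\<bar>)"
    unfolding logker_def r_def[symmetric] v_def[symmetric] by (simp add: algebra_simps)
  then have "exp (2 * \<kappa> * logker q x s) \<le> exp (\<kappa> * (ln 6 + pi) + (- \<kappa> * ln \<bar>x\<bar> + - \<kappa> * ln \<bar>s\<bar>))" by simp
  also have "\<dots> = (6 * exp pi) powr \<kappa> * (\<bar>x\<bar> powr - \<kappa> * \<bar>s\<bar> powr - \<kappa>)"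
  proof -
    have "(6 * exp pi) powr \<kappa> = exp (\<kappa> * (ln 6 + pi))" by (simp add: powr_def ln_mult)
    moreover have "\<bar>x\<bar> powr - \<kappa> = exp (- \<kappa> * ln \<bar>x\<bar>)" "\<bar>s\<bar> powr - \<kappa> = exp (- \<kappa> * ln \<bar>s\<bar>)"
      using x s by (simp_all add: powr_def)
    ultimately show ?thesis by (simp only: exp_add)
  qed
  finally show ?thesis .
qed

lemma AE_circM: "AE x in circM. x \<noteq> 0 \<and> \<bar>x\<bar> \<le> pi"
proof -
  have "AE x in lborel. (x :: real) \<noteq> 0" by (rule AE_lborel_singleton)
  then show ?thesis unfolding circM_closed
    by (subst AE_density) (auto split: split_indicator)
qed

lemma nn_integral_circM_powr:
  assumes "\<kappa> < 1" shows "(\<integral>\<^sup>+x. ennreal (\<bar>x\<bar> powr - \<kappa>) \<partial>circM) < \<infinity>"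
proof -
  let ?f = "\<lambda>x::real. indicator {0..pi} x * (x powr - \<kappa>)"
  have "((\<lambda>x. x powr - \<kappa>) has_integral (pi powr (- \<kappa> + 1) / (- \<kappa> + 1))) {0..pi}"
    by (rule has_integral_powr_from_0) (use assms in auto)
  then have "(?f has_integral (pi powr (- \<kappa> + 1) / (- \<kappa> + 1))) UNIV"
  proof (subst (asm) has_integral_restrict_UNIV[symmetric])
    have "(\<lambda>x. if x \<in> {0..pi} then x powr - \<kappa> else 0) = ?f" by (auto simp: fun_eq_iff indicator_def)
    then show "((\<lambda>x. if x \<in> {0..pi} then x powr - \<kappa> else 0) has_integral (pi powr (- \<kappa> + 1) / (- \<kappa> + 1))) UNIV \<Longrightarrow> ?thesis"
      by simp
  qed
  then have fin: "(\<integral>\<^sup>+x. ennreal (?f x) \<partial>lborel) = ennreal (pi powr (- \<kappa> + 1) / (- \<kappa> + 1))"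
    by (intro nn_integral_has_integral_lborel) auto
  have refl: "(\<integral>\<^sup>+x. ennreal (?f (- x)) \<partial>lborel) = (\<integral>\<^sup>+x. ennreal (?f x) \<partial>lborel)"
    using nn_integral_real_affine[of "\<lambda>x. ennreal (?f x)" "-1" 0] by simp
  have "(\<integral>\<^sup>+x. ennreal (\<bar>x\<bar> powr - \<kappa>) \<partial>circM) = (\<integral>\<^sup>+x. indicator {-pi..pi} x * ennreal (\<bar>x\<bar> powr - \<kappa>) \<partial>lborel)"
    unfolding circM_closed by (rule nn_integral_density) auto
  also have "\<dots> \<le> (\<integral>\<^sup>+x. ennreal (?f x) + ennreal (?f (- x)) \<partial>lborel)"
    by (rule nn_integral_mono) (auto split: split_indicator simp flip: ennreal_plus)
  also have "\<dots> = (\<integral>\<^sup>+x. ennreal (?f x) \<partial>lborel) + (\<integral>\<^sup>+x. ennreal (?f (- x)) \<partial>lborel)"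
    by (rule nn_integral_add) auto
  also have "\<dots> < \<infinity>" unfolding refl fin by simp
  finally show ?thesis .
qed

text \<open>After \<open>exp_logker_le\<close> the integrand is a product, so Tonelli gives the
  square of a one-dimensional integral, finite for kappa < 1 and free of q. The bound by
  \<open>logker_bounded\<close> depends on q and is used for integrability only.\<close>

lemma integral_exp_logker_le:
  assumes \<kappa>: "0 \<le> \<kappa>" "\<kappa> < 1"
  obtains B where "0 \<le> B"
    "\<And>q. 0 \<le> q \<Longrightarrow> q < 1 \<Longrightarrow> (\<integral>x. (\<integral>s. exp (2 * \<kappa> * logker q x s) \<partial>circM) \<partial>circM) \<le> B"
proof -
  define I where "I = (\<integral>\<^sup>+x. ennreal (\<bar>x\<bar> powr - \<kappa>) \<partial>circM)"
  define C where "C = (6 * exp pi) powr \<kappa>"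
  define B where "B = enn2real (ennreal C * (I * I))"
  have I: "I < \<infinity>" unfolding I_def by (rule nn_integral_circM_powr[OF \<kappa>(2)])
  have C: "0 \<le> C" by (simp add: C_def)
  have B: "ennreal B = ennreal C * (I * I)"
    unfolding B_def using I by (simp add: ennreal_mult_less_top)
  have "(\<integral>x. (\<integral>s. exp (2 * \<kappa> * logker q x s) \<partial>circM) \<partial>circM) \<le> B" if q: "0 \<le> q" "q < 1" for q
  proof -
    let ?f = "\<lambda>p. exp (2 * \<kappa> * logker q (fst p) (snd p))"
    have cont: "continuous_on UNIV ?f" by (intro continuous_intros continuous_logker[OF q])
    then have [measurable]: "?f \<in> borel_measurable borel" by (rule borel_measurable_continuous_onI)
    have bd: "norm (?f p) \<le> exp (2 * \<kappa> * (\<bar>ln (1 - q)\<bar> + ln 2))" for p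
    proof -
      have "logker q (fst p) (snd p) \<le> \<bar>ln (1 - q)\<bar> + ln 2" using logker_bounded[OF q, of "fst p" "snd p"] by linarith
      then have "2 * \<kappa> * logker q (fst p) (snd p) \<le> 2 * \<kappa> * (\<bar>ln (1 - q)\<bar> + ln 2)" using \<kappa> by (intro mult_left_mono) auto
      then show ?thesis by simp
    qed
    have int: "integrable torusM ?f" by (rule torusM.integrable_const_bound[of _ "exp (2 * \<kappa> * (\<bar>ln (1 - q)\<bar> + ln 2))"]) (use bd in auto)
    have "ennreal (\<integral>p. ?f p \<partial>torusM) = (\<integral>\<^sup>+p. ennreal (?f p) \<partial>torusM)"
      by (rule nn_integral_eq_integral[OF int, symmetric]) simp
    also have "\<dots> = (\<integral>\<^sup>+x. (\<integral>\<^sup>+s. ennreal (?f (x, s)) \<partial>circM) \<partial>circM)"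
    proof -
      have m: "(\<lambda>p. ennreal (?f p)) \<in> borel_measurable (circM \<Otimes>\<^sub>M circM)"
        unfolding torusM_def[symmetric] measurable_cong_sets[OF sets_torusM refl] by simp
      show ?thesis unfolding torusM_def by (rule circM.nn_integral_fst[OF m, symmetric])
    qed
    also have "\<dots> \<le> (\<integral>\<^sup>+x. (\<integral>\<^sup>+s. ennreal C * ennreal (\<bar>x\<bar> powr - \<kappa>) * ennreal (\<bar>s\<bar> powr - \<kappa>) \<partial>circM) \<partial>circM)"
    proof (rule nn_integral_mono_AE)
      show "AE x in circM. (\<integral>\<^sup>+s. ennreal (?f (x, s)) \<partial>circM) \<le> (\<integral>\<^sup>+s. ennreal C * ennreal (\<bar>x\<bar> powr - \<kappa>) * ennreal (\<bar>s\<bar> powr - \<kappa>) \<partial>circM)"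
        using AE_circM
      proof eventually_elim
        case x: (elim x)
        show ?case
        proof (rule nn_integral_mono_AE)
          show "AE s in circM. ennreal (?f (x, s)) \<le> ennreal C * ennreal (\<bar>x\<bar> powr - \<kappa>) * ennreal (\<bar>s\<bar> powr - \<kappa>)"
            using AE_circM
          proof eventually_elim
            case (elim s)
            have "exp (2 * \<kappa> * logker q x s) \<le> C * (\<bar>x\<bar> powr - \<kappa> * \<bar>s\<bar> powr - \<kappa>)"
              unfolding C_def using x elim by (intro exp_logker_le q \<kappa>(1)) auto
            then show ?case using C by (simp add: ennreal_mult[symmetric] mult.assoc)
          qed
        qed
      qed
    qed
    also have "\<dots> = (\<integral>\<^sup>+x. ennreal C * ennreal (\<bar>x\<bar> powr - \<kappa>) * I \<partial>circM)"
      unfolding I_def by (intro nn_integral_cong nn_integral_cmult) simp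
    also have "\<dots> = (\<integral>\<^sup>+x. ennreal (\<bar>x\<bar> powr - \<kappa>) * (ennreal C * I) \<partial>circM)"
      by (simp only: mult_ac)
    also have "\<dots> = I * (ennreal C * I)" unfolding I_def[symmetric] by (subst nn_integral_multc) (simp_all add: I_def)
    also have "\<dots> = ennreal B" unfolding B by (simp only: mult_ac)
    finally have "(\<integral>p. ?f p \<partial>torusM) \<le> B" by (simp add: B_def ennreal_le_iff)
    moreover have "(\<integral>p. ?f p \<partial>torusM) = (\<integral>x. (\<integral>s. exp (2 * \<kappa> * logker q x s) \<partial>circM) \<partial>circM)"
      by (subst integral_torusM_iterated(1)[OF _ bd]) simp_all
    ultimately show ?thesis by simp
  qed
  moreover have "0 \<le> B" by (simp add: B_def)
  ultimately show ?thesis using that by blast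
qed

section \<open>Comparison of the logarithmic kernel with the Green function\<close>

abbreviation regularized_logcoef :: "real \<Rightarrow> int \<times> int \<Rightarrow> complex" where
  "regularized_logcoef q n \<equiv> of_real (q ^ nat \<bar>fst n\<bar> * q ^ nat \<bar>snd n\<bar> * logcoef n)"

text \<open>Brings the boundary term of \<open>integral_circM_exp_cis\<close> into the form of one
  factor of \<open>product_weight\<close>; the other factor comes from the denominator of
  \<open>logcoef\<close>.\<close>

lemma exp_minus_pi_le: "exp (- \<bar>of_int m\<bar> * pi) \<le> 1 / (1 + (of_int m)\<^sup>2 :: real)"
proof -
  let ?u = "\<bar>of_int m\<bar> :: real"
  have "1 + ?u\<^sup>2 \<le> (1 + ?u)\<^sup>2" by (simp add: power2_eq_square algebra_simps)
  also have "\<dots> \<le> (exp ?u)\<^sup>2" by (intro power_mono) auto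
  also have "\<dots> = exp (?u * 2)" by (simp add: exp_double[symmetric] mult.commute)
  also have "\<dots> \<le> exp (?u * pi)" using pi_ge_two by (simp add: mult_left_mono)
  finally have "1 + (of_int m)\<^sup>2 \<le> exp (?u * pi)" by simp
  then have "1 / exp (?u * pi) \<le> 1 / (1 + (of_int m)\<^sup>2)"
    by (intro divide_left_mono mult_pos_pos add_pos_nonneg) auto
  then show ?thesis by (simp add: exp_minus inverse_eq_divide)
qed

definition product_weight :: "int \<times> int \<Rightarrow> real" where
  "product_weight n = 1 / ((1 + (of_int (fst n))\<^sup>2) * (1 + (of_int (snd n))\<^sup>2))"

lemma summable_on_product_weight: "product_weight summable_on UNIV"
  using summable_on_product_real[OF summable_on_int_inverse_square summable_on_int_inverse_square]
  by (simp add: product_weight_def[abs_def] case_prod_unfold)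

lemma product_weight_bounds: "0 \<le> product_weight n" "product_weight n \<le> 1"
proof -
  have "1 * 1 \<le> (1 + (of_int (fst n))\<^sup>2) * (1 + (of_int (snd n))\<^sup>2 :: real)" by (intro mult_mono) auto
  then show "0 \<le> product_weight n" "product_weight n \<le> 1" by (simp_all add: product_weight_def divide_le_eq_1)
qed

text \<open>Off the axis m = 0 there are two errors: the missing mass, 1 / (r (1 + r)), at most
  twice the weight, and the boundary term theta / r, at most once the weight; hence the 3. On the
  axis the discarded 1 / (1 + k^2) is the weight itself.\<close>

lemma logcoef_approx: "\<bar>1 / (jbracket n)\<^sup>2 - logcoef n\<bar> \<le> 3 * product_weight n"
proof -
  obtain m k where n: "n = (m, k)" by (cases n)
  let ?m = "of_int m :: real" and ?k = "of_int k :: real"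
  have J: "(jbracket n)\<^sup>2 = 1 + ?m\<^sup>2 + ?k\<^sup>2" by (simp add: jbracket_square n)
  show ?thesis
  proof (cases "m = 0")
    case True
    then show ?thesis using J unfolding logcoef_def product_weight_def n
      by (simp add: divide_right_mono add_nonneg_nonneg)
  next
    case False
    define r where "r = ?m\<^sup>2 + ?k\<^sup>2"
    define \<theta> where "\<theta> = exp (- \<bar>?m\<bar> * pi) * cos (?k * pi)"
    have m1: "1 \<le> ?m\<^sup>2"
    proof -
      \<comment> \<open>m is a nonzero integer. Only through this does r dominate 1 + k^2, so that
        dividing by r still leaves decay in k.\<close>
      have "1 \<le> m\<^sup>2" using False by (simp add: int_one_le_iff_zero_less)
      then show ?thesis by (metis of_int_1 of_int_le_iff of_int_power)
    qed
    have r1: "1 \<le> r" "1 + ?k\<^sup>2 \<le> r" using m1 by (auto simp: r_def add_increasing2)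
    have "\<bar>\<theta>\<bar> \<le> exp (- \<bar>?m\<bar> * pi) * 1" unfolding \<theta>_def abs_mult by (intro mult_mono) auto
    also have "\<dots> \<le> 1 / (1 + ?m\<^sup>2)" using exp_minus_pi_le[of m] by simp
    finally have \<theta>: "\<bar>\<theta>\<bar> \<le> 1 / (1 + ?m\<^sup>2)" .
    have "1 / (jbracket n)\<^sup>2 - logcoef n = - (1 / (r * (1 + r))) + \<theta> / r"
    proof -
      have lc: "logcoef n = (1 - \<theta>) / r" using False by (simp add: logcoef_def n \<theta>_def r_def)
      have J2: "(jbracket n)\<^sup>2 = 1 + r" by (simp add: J r_def)
      have "1 / (1 + r) - 1 / r = - (1 / (r * (1 + r)))" using r1 by (simp add: field_simps)
      then show ?thesis unfolding lc J2 diff_divide_distrib by simp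
    qed
    also have "\<bar>\<dots>\<bar> \<le> 1 / (r * (1 + r)) + \<bar>\<theta>\<bar> / r"
      using r1 by (intro order_trans[OF abs_triangle_ineq]) (auto simp: abs_mult)
    also have "1 / (r * (1 + r)) \<le> 2 * product_weight n"
    proof -
      have "(1 + ?m\<^sup>2) * (1 + ?k\<^sup>2) \<le> (1 + r) * (1 + r)" by (intro mult_mono) (auto simp: r_def)
      also have "\<dots> \<le> 2 * r * (1 + r)" using r1 by (intro mult_right_mono) auto
      finally have pw: "1 / (2 * (r * (1 + r))) \<le> product_weight n" unfolding product_weight_def n
        using r1 by (intro divide_left_mono mult_pos_pos add_pos_nonneg) auto
      have "1 / (r * (1 + r)) = 2 * (1 / (2 * (r * (1 + r))))" by simp
      also have "\<dots> \<le> 2 * product_weight n" by (rule mult_left_mono[OF pw]) simp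
      finally show ?thesis .
    qed
    also have "\<bar>\<theta>\<bar> / r \<le> (1 / (1 + ?m\<^sup>2)) / (1 + ?k\<^sup>2)"
      using \<theta> r1 by (intro frac_le add_pos_nonneg) auto
    also have "\<dots> = product_weight n" by (simp add: product_weight_def n)
    finally show ?thesis by simp
  qed
qed

lemma abs_logcoef_le: "\<bar>logcoef n\<bar> \<le> 4"
proof -
  have "1 / (jbracket n)\<^sup>2 \<le> 1" "0 \<le> 1 / (jbracket n)\<^sup>2"
    using jbracket_ge_1[of n] by (simp_all add: divide_le_eq_1)
  then show ?thesis using logcoef_approx[of n] product_weight_bounds(2)[of n] by linarith
qed

text \<open>Jensen is applied in y alone, with x as a parameter: for fixed x the series is the
  Poisson average over s of the logarithmic kernel. What remains is
  \<open>integral_exp_logker_le\<close>, whose bound does not see q.\<close>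

lemma regularized_bound:
  assumes a: "0 \<le> a" "a < 1 / pi"
  obtains B where "0 \<le> B"
    "\<And>q. 0 \<le> q \<Longrightarrow> q < 1 \<Longrightarrow> (\<integral>z. exp (a * Re (trig_series (regularized_logcoef q) z)) \<partial>torusM) \<le> B"
proof -
  define \<kappa> where "\<kappa> = pi * a"
  have \<kappa>: "0 \<le> \<kappa>" "\<kappa> < 1" using a by (auto simp: \<kappa>_def field_simps)
  obtain B where B: "0 \<le> B" and
    le: "\<And>q. 0 \<le> q \<Longrightarrow> q < 1 \<Longrightarrow> (\<integral>x. (\<integral>s. exp (2 * \<kappa> * logker q x s) \<partial>circM) \<partial>circM) \<le> B"
    using integral_exp_logker_le[OF \<kappa>] by blast
  have "(\<integral>z. exp (a * Re (trig_series (regularized_logcoef q) z)) \<partial>torusM) \<le> B" if q: "0 \<le> q" "q < 1" for q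
  proof -
    have sm: "(\<lambda>n. norm (regularized_logcoef q n)) summable_on UNIV"
    proof (rule Infinite_Sum.abs_summable_on_comparison_test')
      show "(\<lambda>n. (q ^ nat \<bar>fst n\<bar> * q ^ nat \<bar>snd n\<bar>) * 4) summable_on UNIV"
        by (intro summable_on_cmult_left summable_on_geometric2[OF q])
      show "norm (regularized_logcoef q n) \<le> (q ^ nat \<bar>fst n\<bar> * q ^ nat \<bar>snd n\<bar>) * 4" for n
        unfolding norm_of_real abs_mult[of _ "logcoef n"] using q abs_logcoef_le[of n]
        by (intro mult_mono) (auto simp: abs_mult)
    qed
    obtain D where D: "\<And>z. exp (a * Re (trig_series (regularized_logcoef q) z)) \<le> D"
    proof
      show "exp (a * Re (trig_series (regularized_logcoef q) z)) \<le> exp (a * (\<Sum>\<^sub>\<infinity>n. norm (regularized_logcoef q n)))" for z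
        using a(1) complex_Re_le_cmod[of "trig_series (regularized_logcoef q) z"] trig_series_norm_le[OF sm, of z]
        by (auto intro!: mult_left_mono)
    qed
    have [measurable]: "trig_series (regularized_logcoef q) \<in> borel_measurable borel" by (rule trig_series_measurable[OF sm])
    have cm: "continuous_on UNIV (\<lambda>s. logker q x s)" for x
      using continuous_on_Pair2[OF continuous_logker[OF q], of x] by simp
    have [measurable]: "(\<lambda>s. logker q x s) \<in> borel_measurable borel" for x
      using cm by (rule borel_measurable_continuous_onI)
    \<comment> \<open>b = 2 pi a: the factor 2 pi normalizes the Poisson kernel to a probability
      density. The kernel is thus raised to the power 2 kappa with kappa = pi a, and a < 1 / pi is
      the condition kappa < 1.\<close>
    define b where "b = 2 * \<kappa>"
    have jen: "(\<integral>y. exp (a * Re (trig_series (regularized_logcoef q) (x, y))) \<partial>circM) \<le> (\<integral>s. exp (b * logker q x s) \<partial>circM)" for x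
    proof -
      have "a * Re (trig_series (regularized_logcoef q) (x, y)) = (\<integral>s. poisson q (y - s) / (2 * pi) * (b * logker q x s) \<partial>circM)" for y
      proof -
        have "(\<integral>s. poisson q (y - s) / (2 * pi) * (b * logker q x s) \<partial>circM) = (\<integral>s. a * (logker q x s * poisson q (y - s)) \<partial>circM)"
          by (intro Bochner_Integration.integral_cong) (auto simp: b_def \<kappa>_def)
        then show ?thesis unfolding trig_series_logcoef[OF q] by simp
      qed
      moreover have "(\<integral>y. exp (\<integral>s. poisson q (y - s) / (2 * pi) * (b * logker q x s) \<partial>circM) \<partial>circM) \<le> (\<integral>s. exp (b * logker q x s) \<partial>circM)"
      proof (rule jensen_kernel[where P = "(1 - q\<^sup>2) / (1 - q)\<^sup>2 / (2 * pi)" and B = "\<bar>b\<bar> * (\<bar>ln (1 - q)\<bar> + ln 2)"])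
        show "finite_measure circM" by (rule circM.finite_measure_axioms)
        show "(\<lambda>(y, s). poisson q (y - s) / (2 * pi)) \<in> borel_measurable (circM \<Otimes>\<^sub>M circM)"
          unfolding torusM_def[symmetric] measurable_cong_sets[OF sets_torusM refl] case_prod_unfold
          by (intro borel_measurable_continuous_onI continuous_on_divide continuous_on_compose2[OF continuous_poisson[OF q]] continuous_intros) auto
        show "0 \<le> poisson q (y - s) / (2 * pi)" for y s using poisson_nonneg[OF q] by simp
        show "poisson q (y - s) / (2 * pi) \<le> (1 - q\<^sup>2) / (1 - q)\<^sup>2 / (2 * pi)" for y s
          by (intro divide_right_mono poisson_le[OF q]) simp
        show "(\<integral>s. poisson q (y - s) / (2 * pi) \<partial>circM) = 1" for y using integral_poisson(2)[OF q, of y] by simp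
        show "(\<integral>y. poisson q (y - s) / (2 * pi) \<partial>circM) = 1" for s using integral_poisson(1)[OF q, of s] by simp
        show "\<bar>b * logker q x s\<bar> \<le> \<bar>b\<bar> * (\<bar>ln (1 - q)\<bar> + ln 2)" for s
          unfolding abs_mult by (intro mult_left_mono logker_bounded[OF q]) auto
      qed measurable
      ultimately show ?thesis by simp
    qed
    have "(\<integral>z. exp (a * Re (trig_series (regularized_logcoef q) z)) \<partial>torusM)
       = (\<integral>x. (\<integral>y. exp (a * Re (trig_series (regularized_logcoef q) (x, y))) \<partial>circM) \<partial>circM)"
    proof (rule integral_torusM_iterated(1))
      show "(\<lambda>z. exp (a * Re (trig_series (regularized_logcoef q) z))) \<in> borel_measurable borel" by measurable
      show "norm (exp (a * Re (trig_series (regularized_logcoef q) z))) \<le> D" for z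
        unfolding real_norm_def abs_exp_cancel by (rule D)
    qed
    also have "\<dots> \<le> (\<integral>x. (\<integral>s. exp (b * logker q x s) \<partial>circM) \<partial>circM)"
    proof (rule integral_mono)
      let ?c = "\<lambda>p. exp (b * logker q (fst p) (snd p))"
      have m: "?c \<in> borel_measurable borel" "(\<lambda>z. exp (a * Re (trig_series (regularized_logcoef q) z))) \<in> borel_measurable borel"
        by (intro borel_measurable_continuous_onI continuous_intros continuous_logker[OF q]) measurable
      have i1: "integrable torusM ?c"
      proof (rule torusM.integrable_const_bound[of _ "exp (\<bar>b\<bar> * (\<bar>ln (1 - q)\<bar> + ln 2))"])
        show "AE p in torusM. norm (?c p) \<le> exp (\<bar>b\<bar> * (\<bar>ln (1 - q)\<bar> + ln 2))"
        proof (rule AE_I2)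
          fix p
          have "b * logker q (fst p) (snd p) \<le> \<bar>b\<bar> * \<bar>logker q (fst p) (snd p)\<bar>" unfolding abs_mult[symmetric] by simp
          also have "\<dots> \<le> \<bar>b\<bar> * (\<bar>ln (1 - q)\<bar> + ln 2)" by (intro mult_left_mono logker_bounded[OF q]) auto
          finally show "norm (?c p) \<le> exp (\<bar>b\<bar> * (\<bar>ln (1 - q)\<bar> + ln 2))" by simp
        qed
      qed (use m in simp)
      have i2: "integrable torusM (\<lambda>z. exp (a * Re (trig_series (regularized_logcoef q) z)))"
        by (rule torusM.integrable_const_bound[of _ D]) (use D m in auto)
      show "integrable circM (\<lambda>x. \<integral>s. exp (b * logker q x s) \<partial>circM)"
        using circM_pair.integrable_fst'[OF i1[unfolded torusM_def]] by simp
      show "integrable circM (\<lambda>x. \<integral>y. exp (a * Re (trig_series (regularized_logcoef q) (x, y))) \<partial>circM)"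
        using circM_pair.integrable_fst'[OF i2[unfolded torusM_def]] by simp
    qed (rule jen)
    also have "\<dots> \<le> B" unfolding b_def by (rule le[OF q])
    finally show ?thesis .
  qed
  with B show ?thesis using that by blast
qed

section \<open>Covariance kernels\<close>

text \<open>Passes from quadratic to absolute means with a free parameter in place of
  Cauchy-Schwarz; used both for the kernels and for the renormalized masses.\<close>

lemma abs_le_square_over:
  fixes t \<eta> :: real assumes "\<eta> > 0" shows "\<bar>t\<bar> \<le> \<eta> + t\<^sup>2 / \<eta>"
proof (cases "\<bar>t\<bar> \<le> \<eta>")
  case False
  then have "\<bar>t\<bar> * \<eta> \<le> \<bar>t\<bar> * \<bar>t\<bar>" by (intro mult_left_mono) auto
  then have "\<bar>t\<bar> \<le> t\<^sup>2 / \<eta>" using assms by (simp add: pos_le_divide_eq power2_eq_square)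
  then show ?thesis using assms by linarith
next
  case True
  have "0 \<le> t\<^sup>2 / \<eta>" using assms by simp
  then show ?thesis using True by linarith
qed

lemma trig_series_add:
  assumes "(\<lambda>n. norm (c n)) summable_on UNIV" "(\<lambda>n. norm (d n)) summable_on UNIV"
  shows "trig_series (\<lambda>n. c n + d n) z = trig_series c z + trig_series d z"
proof -
  have "((\<lambda>n. c n * cis (freq n \<bullet> z) + d n * cis (freq n \<bullet> z)) has_sum (trig_series c z + trig_series d z)) UNIV"
    by (intro has_sum_add has_sum_trig_series assms)
  then show ?thesis unfolding trig_series_def[of "\<lambda>n. c n + d n"] distrib_right by (rule infsumI)
qed

lemma trig_series_uminus: "trig_series (\<lambda>n. - c n) z = - trig_series c z"
  unfolding trig_series_def by (simp add: infsum_uminus)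

context
  fixes \<rho> :: "real \<times> real \<Rightarrow> real"
  assumes profile: "mollifier_profile \<rho>"
begin

abbreviation cov_coef :: "nat \<Rightarrow> nat \<Rightarrow> int \<times> int \<Rightarrow> complex" where
  "cov_coef N M n \<equiv> of_real (mol_coeff \<rho> N n * mol_coeff \<rho> M n / (jbracket n)\<^sup>2)"

text \<open>The covariance of the fields mollified at scales N and M, at two points that differ by
  z. The denominator collects the factors 1 / (2 pi) of the two basis functions.\<close>

definition cov_kernel :: "nat \<Rightarrow> nat \<Rightarrow> real \<times> real \<Rightarrow> real" where
  "cov_kernel N M z = Re (trig_series (cov_coef N M) z) / (4 * pi\<^sup>2)"

lemma summable_on_abs_mol_coeff: "N \<ge> 1 \<Longrightarrow> (\<lambda>n. \<bar>mol_coeff \<rho> N n\<bar>) summable_on UNIV"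
  using summable_on_mol_coeff[OF profile, of N 0] by simp

lemma summable_on_mol_coeff_mult:
  assumes "N \<ge> 1" "\<And>n. \<bar>f n\<bar> \<le> C"
  shows "(\<lambda>n. norm (of_real (mol_coeff \<rho> N n * f n) :: complex)) summable_on UNIV"
proof (rule Infinite_Sum.abs_summable_on_comparison_test')
  show "(\<lambda>n. \<bar>mol_coeff \<rho> N n\<bar> * C) summable_on UNIV"
    by (intro summable_on_cmult_left summable_on_abs_mol_coeff assms)
  show "norm (of_real (mol_coeff \<rho> N n * f n) :: complex) \<le> \<bar>mol_coeff \<rho> N n\<bar> * C" for n
    unfolding norm_of_real abs_mult by (intro mult_left_mono assms) auto
qed

lemma summable_on_cov_coef:
  assumes "N \<ge> 1" "M \<ge> 1" shows "(\<lambda>n. norm (cov_coef N M n)) summable_on UNIV"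
proof -
  have "\<bar>mol_coeff \<rho> M n / (jbracket n)\<^sup>2\<bar> \<le> 1" for n
  proof -
    have "\<bar>mol_coeff \<rho> M n\<bar> / (jbracket n)\<^sup>2 \<le> 1 / 1"
      using mol_coeff_le_1[OF profile assms(2)] jbracket_ge_1[of n] by (intro frac_le) auto
    then show ?thesis by (simp add: abs_divide)
  qed
  from summable_on_mol_coeff_mult[OF assms(1) this] show ?thesis by simp
qed

text \<open>The coefficients split into a part L built from \<open>logcoef\<close> and a part d
  whose series is bounded by D uniformly in N and M, costing a factor exp (a D). For L, the weights
  q are inserted, both mollifiers are removed by Jensen, and q tends to 1 by Fatou.\<close>

lemma cov_kernel_exp_bound:
  assumes \<gamma>: "0 \<le> \<gamma>" "\<gamma> < 4 * pi"
  obtains B where "0 \<le> B"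
    "\<And>N M. N \<ge> 1 \<Longrightarrow> M \<ge> 1 \<Longrightarrow> (\<integral>z. exp (\<gamma> * cov_kernel N M z) \<partial>torusM) \<le> B"
proof -
  \<comment> \<open>The normalization of \<open>cov_kernel\<close> is absorbed into the exponent;
    gamma < 4 pi becomes a < 1 / pi.\<close>
  define a where "a = \<gamma> / (4 * pi\<^sup>2)"
  have a: "0 \<le> a" "a < 1 / pi" using \<gamma> by (auto simp: a_def field_simps power2_eq_square)
  obtain B0 where B0: "0 \<le> B0" and
    reg: "\<And>q. 0 \<le> q \<Longrightarrow> q < 1 \<Longrightarrow> (\<integral>z. exp (a * Re (trig_series (regularized_logcoef q) z)) \<partial>torusM) \<le> B0"
    using regularized_bound[OF a] by blast
  define D where "D = (\<Sum>\<^sub>\<infinity>n. 3 * product_weight n)"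
  have sD: "(\<lambda>n. 3 * product_weight n) summable_on UNIV"
    by (intro summable_on_cmult_right summable_on_product_weight)
  have "(\<integral>z. exp (\<gamma> * cov_kernel N M z) \<partial>torusM) \<le> exp (a * D) * B0" if N: "N \<ge> 1" and M: "M \<ge> 1" for N M
  proof -
    let ?aN = "mol_coeff \<rho> N" and ?aM = "mol_coeff \<rho> M"
    note le1 = mol_coeff_le_1[OF profile N] mol_coeff_le_1[OF profile M]
    define L where "L n = (of_real (?aN n * (?aM n * logcoef n)) :: complex)" for n
    define d where "d n = (of_real (?aN n * (?aM n * (1 / (jbracket n)\<^sup>2 - logcoef n))) :: complex)" for n
    define q where "q j = 1 - 1 / real (Suc j)" for j
    have q: "0 \<le> q j" "q j < 1" for j by (auto simp: q_def)
    have qlim: "q \<longlonglongrightarrow> 1"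
      unfolding q_def using tendsto_diff[OF tendsto_const[of "1::real"] LIMSEQ_inverse_real_of_nat] by (simp add: inverse_eq_divide)
    define Lj where "Lj j n = of_real (?aN n) * (of_real (?aM n) * regularized_logcoef (q j) n)" for j n
    have mono: "\<bar>?aM n * (t * logcoef n)\<bar> \<le> 4" if "\<bar>t\<bar> \<le> 1" for t n
      unfolding abs_mult using le1(2)[of n] that abs_logcoef_le[of n]
        mult_mono[of "\<bar>?aM n\<bar>" 1 "\<bar>t\<bar> * \<bar>logcoef n\<bar>" 4] mult_mono[of "\<bar>t\<bar>" 1 "\<bar>logcoef n\<bar>" 4] by simp
    have qq: "\<bar>q j ^ nat \<bar>fst n\<bar> * q j ^ nat \<bar>snd n\<bar>\<bar> \<le> 1" for j and n :: "int \<times> int"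
      using q[of j] by (simp add: abs_mult mult_le_one power_le_one)
    have Lj_eq: "Lj j n = of_real (?aN n * (?aM n * ((q j ^ nat \<bar>fst n\<bar> * q j ^ nat \<bar>snd n\<bar>) * logcoef n)))" for j n
      by (simp add: Lj_def)
    have sL: "(\<lambda>n. norm (L n)) summable_on UNIV" unfolding L_def
      by (rule summable_on_mol_coeff_mult[OF N, of _ 4]) (use mono[of 1] in simp)
    have sLj: "(\<lambda>n. norm (Lj j n)) summable_on UNIV" for j unfolding Lj_eq
      by (rule summable_on_mol_coeff_mult[OF N, of _ 4]) (rule mono[OF qq])
    have d_le: "norm (d n) \<le> 3 * product_weight n" for n
    proof -
      have "\<bar>?aN n\<bar> * (\<bar>?aM n\<bar> * \<bar>1 / (jbracket n)\<^sup>2 - logcoef n\<bar>) \<le> 1 * (1 * (3 * product_weight n))"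
        by (intro mult_mono le1 logcoef_approx) (auto simp: product_weight_bounds)
      then show ?thesis by (simp only: d_def norm_of_real abs_mult mult_1_left)
    qed
    have sd: "(\<lambda>n. norm (d n)) summable_on UNIV"
      by (rule Infinite_Sum.abs_summable_on_comparison_test'[OF sD d_le])
    have reg_sm: "(\<lambda>n. norm (regularized_logcoef (q j) n)) summable_on UNIV" for j
    proof (rule Infinite_Sum.abs_summable_on_comparison_test')
      show "(\<lambda>n. (q j ^ nat \<bar>fst n\<bar> * q j ^ nat \<bar>snd n\<bar>) * 4) summable_on UNIV"
        by (intro summable_on_cmult_left summable_on_geometric2[OF q])
      show "norm (regularized_logcoef (q j) n) \<le> (q j ^ nat \<bar>fst n\<bar> * q j ^ nat \<bar>snd n\<bar>) * 4" for n
        unfolding norm_of_real abs_mult[of _ "logcoef n"] using q[of j] abs_logcoef_le[of n]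
        by (intro mult_mono) (auto simp: abs_mult)
    qed
    have sM: "(\<lambda>n. norm (of_real (?aM n) * regularized_logcoef (q j) n)) summable_on UNIV" for j
      by (rule Infinite_Sum.abs_summable_on_comparison_test'[OF reg_sm[of j]])
         (unfold norm_mult[of "of_real (?aM _)"] norm_of_real, use le1(2) in \<open>simp add: mult_left_le_one_le\<close>)
    \<comment> \<open>Jensen twice, once for each mollifier; the bound left over depends neither on
      N and M nor on j.\<close>
    have bj: "(\<integral>z. exp (a * Re (trig_series (Lj j) z)) \<partial>torusM) \<le> B0" for j
      unfolding Lj_def
      using jensen_mollifier[OF profile N sM, of a j] jensen_mollifier[OF profile M reg_sm, of a j] reg[OF q, of j]
      by linarith
    have lim: "(\<lambda>j. trig_series (Lj j) z) \<longlonglongrightarrow> trig_series L z" for z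
      unfolding trig_series_def
    \<comment> \<open>\<open>logcoef\<close> alone decays like |n|^-2 and is not summable in two
      dimensions. The rapidly decaying multiplier of the mollifier provides the domination as q
      tends to 1.\<close>
    proof (rule infsum_dominated_tendsto[where h = "\<lambda>n. \<bar>?aN n\<bar> * 4"])
      show "(\<lambda>n. \<bar>?aN n\<bar> * 4) summable_on UNIV"
        by (intro summable_on_cmult_left summable_on_abs_mol_coeff N)
      show "norm (Lj j n * cis (freq n \<bullet> z)) \<le> \<bar>?aN n\<bar> * 4" for n j
        unfolding norm_mult norm_cis mult_1_right Lj_eq norm_of_real abs_mult[of "?aN n"]
        by (rule mult_left_mono[OF mono[OF qq]]) simp
      have "(\<lambda>j. Lj j n * cis (freq n \<bullet> z)) \<longlonglongrightarrow> of_real (?aN n * (?aM n * ((1 ^ nat \<bar>fst n\<bar> * 1 ^ nat \<bar>snd n\<bar>) * logcoef n))) * cis (freq n \<bullet> z)" for n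
        unfolding Lj_eq by (intro tendsto_intros qlim)
      then show "(\<lambda>j. Lj j n * cis (freq n \<bullet> z)) \<longlonglongrightarrow> L n * cis (freq n \<bullet> z)" for n by (simp add: L_def)
    qed simp
    have intL: "integrable torusM (\<lambda>z. exp (a * Re (trig_series L z)))" by (rule trig_series_bounded_exp[OF sL])
    have intLj: "integrable torusM (\<lambda>z. exp (a * Re (trig_series (Lj j) z)))" for j by (rule trig_series_bounded_exp[OF sLj])
    have [measurable]: "trig_series (Lj j) \<in> borel_measurable borel" for j by (rule trig_series_measurable[OF sLj])
    have "ennreal (\<integral>z. exp (a * Re (trig_series L z)) \<partial>torusM) = (\<integral>\<^sup>+z. ennreal (exp (a * Re (trig_series L z))) \<partial>torusM)"
      by (rule nn_integral_eq_integral[OF intL, symmetric]) simp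
    also have "\<dots> = (\<integral>\<^sup>+z. liminf (\<lambda>j. ennreal (exp (a * Re (trig_series (Lj j) z)))) \<partial>torusM)"
    proof (rule nn_integral_cong)
      fix z
      have "(\<lambda>j. ennreal (exp (a * Re (trig_series (Lj j) z)))) \<longlonglongrightarrow> ennreal (exp (a * Re (trig_series L z)))"
        by (intro tendsto_intros lim)
      then show "ennreal (exp (a * Re (trig_series L z))) = liminf (\<lambda>j. ennreal (exp (a * Re (trig_series (Lj j) z))))"
        by (intro lim_imp_Liminf[symmetric]) auto
    qed
    also have "\<dots> \<le> liminf (\<lambda>j. \<integral>\<^sup>+z. ennreal (exp (a * Re (trig_series (Lj j) z))) \<partial>torusM)"
      by (rule nn_integral_liminf) simp
    also have "\<dots> \<le> liminf (\<lambda>j. ennreal B0)"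
    proof (intro Liminf_mono always_eventually allI)
      fix j
      have "(\<integral>\<^sup>+z. ennreal (exp (a * Re (trig_series (Lj j) z))) \<partial>torusM) = ennreal (\<integral>z. exp (a * Re (trig_series (Lj j) z)) \<partial>torusM)"
        by (rule nn_integral_eq_integral[OF intLj]) simp
      then show "(\<integral>\<^sup>+z. ennreal (exp (a * Re (trig_series (Lj j) z))) \<partial>torusM) \<le> ennreal B0"
        using bj[of j] by (simp add: ennreal_leI)
    qed
    also have "liminf (\<lambda>j. ennreal B0) = ennreal B0" by (rule Liminf_const) simp
    finally have bL: "(\<integral>z. exp (a * Re (trig_series L z)) \<partial>torusM) \<le> B0" using B0 by (simp add: ennreal_le_iff)
    have split: "trig_series (cov_coef N M) z = trig_series L z + trig_series d z" for z
      unfolding trig_series_add[OF sL sd, symmetric]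
      by (rule arg_cong[where f = "\<lambda>c. trig_series c z"]) (simp add: L_def d_def fun_eq_iff algebra_simps)
    have dD: "norm (trig_series d z) \<le> D" for z
      unfolding D_def by (rule norm_infsum_le[OF has_sum_trig_series[OF sd] has_sum_infsum[OF sD]]) (use d_le in \<open>simp add: norm_mult\<close>)
    have ptw: "exp (\<gamma> * cov_kernel N M z) \<le> exp (a * D) * exp (a * Re (trig_series L z))" for z
    proof -
      have "\<gamma> * cov_kernel N M z = a * Re (trig_series L z) + a * Re (trig_series d z)"
        unfolding cov_kernel_def a_def split by (simp add: add_divide_distrib distrib_left)
      moreover have "a * Re (trig_series d z) \<le> a * D"
        using dD[of z] complex_Re_le_cmod[of "trig_series d z"] a(1) by (intro mult_left_mono) auto
      ultimately show ?thesis unfolding exp_add[symmetric] by simp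
    qed
    have intK: "integrable torusM (\<lambda>z. exp (\<gamma> * cov_kernel N M z))"
      using trig_series_bounded_exp[OF summable_on_cov_coef[OF N M], of a] by (simp add: cov_kernel_def a_def)
    have "(\<integral>z. exp (\<gamma> * cov_kernel N M z) \<partial>torusM) \<le> (\<integral>z. exp (a * D) * exp (a * Re (trig_series L z)) \<partial>torusM)"
      by (intro integral_mono intK integrable_mult_right intL ptw)
    also have "\<dots> \<le> exp (a * D) * B0" using bL by simp
    finally show ?thesis .
  qed
  moreover have "0 \<le> exp (a * D) * B0" using B0 by simp
  ultimately show ?thesis using that by blast
qed

text \<open>By Parseval, up to a constant, the squared L2 distance between the Green function, with
  coefficients 1 / (jbracket n)^2, and its mollification at scale N.\<close>

definition mol_defect :: "nat \<Rightarrow> real" where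
  "mol_defect N = (\<Sum>\<^sub>\<infinity>n. (1 - mol_coeff \<rho> N n)\<^sup>2 / jbracket n ^ 4)"

lemma mol_defect_summable:
  assumes "N \<ge> 1" shows "(\<lambda>n. (1 - mol_coeff \<rho> N n)\<^sup>2 / jbracket n ^ 4) summable_on UNIV"
    and "(1 - mol_coeff \<rho> N n)\<^sup>2 / jbracket n ^ 4 \<le> 4 * (1 / jbracket n ^ 4)"
proof -
  show le: "(1 - mol_coeff \<rho> N n)\<^sup>2 / jbracket n ^ 4 \<le> 4 * (1 / jbracket n ^ 4)" for n
  proof -
    have "\<bar>1 - mol_coeff \<rho> N n\<bar> \<le> 2" using mol_coeff_le_1[OF profile assms, of n] by linarith
    then have "(1 - mol_coeff \<rho> N n)\<^sup>2 \<le> 2\<^sup>2" by (metis abs_le_square_iff abs_numeral)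
    then show ?thesis by (simp add: divide_right_mono less_imp_le)
  qed
  show "(\<lambda>n. (1 - mol_coeff \<rho> N n)\<^sup>2 / jbracket n ^ 4) summable_on UNIV"
    by (rule summable_on_comparison_test[OF summable_on_cmult_right[OF summable_on_jbracket4] le]) (simp add: less_imp_le)
qed

lemma mol_coeff_tendsto: "(\<lambda>N. mol_coeff \<rho> N n) \<longlonglongrightarrow> 1"
proof -
  let ?C = "(\<bar>of_int (fst n)\<bar> + \<bar>of_int (snd n)\<bar>) * pi"
  have "(\<lambda>N. ?C / real N) \<longlonglongrightarrow> 0" by (rule lim_const_over_n)
  then have "(\<lambda>N. mol_coeff \<rho> N n - 1) \<longlonglongrightarrow> 0"
    by (rule Lim_null_comparison[rotated])
       (use mol_coeff_near_1[OF profile, of _ n] in \<open>auto simp: eventually_sequentially intro!: exI[of _ 1]\<close>)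
  then show ?thesis by (simp add: LIM_zero_iff)
qed

lemma mol_defect_tendsto: "mol_defect \<longlonglongrightarrow> 0"
proof -
  have "(\<lambda>N. \<Sum>\<^sub>\<infinity>n. (1 - mol_coeff \<rho> (Suc N) n)\<^sup>2 / jbracket n ^ 4) \<longlonglongrightarrow> (\<Sum>\<^sub>\<infinity>n::int\<times>int. (1 - 1)\<^sup>2 / jbracket n ^ 4)"
  proof (rule infsum_dominated_tendsto[OF summable_on_cmult_right[OF summable_on_jbracket4]])
    show "norm ((1 - mol_coeff \<rho> (Suc N) n)\<^sup>2 / jbracket n ^ 4) \<le> 4 * (1 / jbracket n ^ 4)" for n N
      using mol_defect_summable(2)[of "Suc N" n] by (simp add: less_imp_le)
    show "(\<lambda>N. (1 - mol_coeff \<rho> (Suc N) n)\<^sup>2 / jbracket n ^ 4) \<longlonglongrightarrow> (1 - 1)\<^sup>2 / jbracket n ^ 4" for n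
      by (intro tendsto_intros LIMSEQ_Suc[OF mol_coeff_tendsto]) simp
  qed auto
  then have "(\<lambda>N. mol_defect (Suc N)) \<longlonglongrightarrow> 0" by (simp add: mol_defect_def)
  then show ?thesis by (rule LIMSEQ_imp_Suc)
qed

lemma cov_kernel_continuous: "N \<ge> 1 \<Longrightarrow> M \<ge> 1 \<Longrightarrow> continuous_on UNIV (cov_kernel N M)"
  unfolding cov_kernel_def by (intro continuous_intros continuous_trig_series summable_on_cov_coef) auto

text \<open>The two kernels share the multiplier of N, which is at most 1 in modulus and drops out
  after Parseval. The bound therefore involves M and P only and is uniform in N.\<close>

lemma cov_kernel_diff_integral:
  assumes N: "N \<ge> 1" and M: "M \<ge> 1" and P: "P \<ge> 1" and \<eta>: "\<eta> > 0"
  shows "(\<integral>z. \<bar>cov_kernel N M z - cov_kernel N P z\<bar> \<partial>torusM) \<le> 4 * pi\<^sup>2 * \<eta> + 2 * (mol_defect M + mol_defect P) / \<eta>"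
proof -
  let ?a = "mol_coeff \<rho>"
  define d where "d n = cov_coef N M n + (- cov_coef N P n)" for n
  note s1 = summable_on_cov_coef[OF N M] and s2 = summable_on_cov_coef[OF N P]
  have s2': "(\<lambda>n. norm (- cov_coef N P n)) summable_on UNIV" using s2 by (simp only: norm_minus_cancel)
  have sd: "(\<lambda>n. norm (d n)) summable_on UNIV"
  proof (rule Infinite_Sum.abs_summable_on_comparison_test'[OF summable_on_add[OF s1 s2']])
    show "norm (d n) \<le> norm (cov_coef N M n) + norm (- cov_coef N P n)" for n
      unfolding d_def by (rule norm_triangle_ineq)
  qed
  define f where "f z = Re (trig_series d z) / (4 * pi\<^sup>2)" for z
  have f: "cov_kernel N M z - cov_kernel N P z = f z" for z
    unfolding f_def d_def trig_series_add[OF s1 s2'] trig_series_uminus cov_kernel_def by (simp add: diff_divide_distrib)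
  have ptw: "\<bar>f z\<bar> \<le> \<eta> + (norm (trig_series d z))\<^sup>2 / (4 * pi\<^sup>2)\<^sup>2 / \<eta>" for z
  proof -
    have "\<bar>f z\<bar> \<le> \<eta> + \<bar>f z\<bar>\<^sup>2 / \<eta>"
      using abs_le_square_over[OF \<eta>, of "f z"] by simp
    also have "\<bar>f z\<bar>\<^sup>2 / \<eta> \<le> (norm (trig_series d z))\<^sup>2 / (4 * pi\<^sup>2)\<^sup>2 / \<eta>"
    proof -
      have "\<bar>f z\<bar> \<le> norm (trig_series d z) / (4 * pi\<^sup>2)"
        by (simp add: f_def abs_divide divide_right_mono abs_Re_le_cmod)
      then have "\<bar>f z\<bar>\<^sup>2 \<le> (norm (trig_series d z) / (4 * pi\<^sup>2))\<^sup>2" by (intro power_mono) auto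
      then show ?thesis unfolding power_divide using \<eta> by (intro divide_right_mono) auto
    qed
    finally show ?thesis by simp
  qed
  have [measurable]: "trig_series d \<in> borel_measurable borel" by (rule trig_series_measurable[OF sd])
  have int2: "integrable torusM (\<lambda>z. (norm (trig_series d z))\<^sup>2)"
  proof (rule torusM.integrable_const_bound[of _ "(\<Sum>\<^sub>\<infinity>n. norm (d n))\<^sup>2"])
    show "AE z in torusM. norm ((norm (trig_series d z))\<^sup>2) \<le> (\<Sum>\<^sub>\<infinity>n. norm (d n))\<^sup>2"
      by (rule AE_I2) (auto intro!: power_mono trig_series_norm_le[OF sd])
  qed simp
  have inti: "integrable torusM (\<lambda>z. \<eta> + (norm (trig_series d z))\<^sup>2 / (4 * pi\<^sup>2)\<^sup>2 / \<eta>)"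
    using int2 by (intro Bochner_Integration.integrable_add integrable_divide) auto
  have intf: "integrable torusM (\<lambda>z. \<bar>f z\<bar>)"
  proof (rule Bochner_Integration.integrable_bound[OF inti])
    show "AE z in torusM. norm \<bar>f z\<bar> \<le> norm (\<eta> + (norm (trig_series d z))\<^sup>2 / (4 * pi\<^sup>2)\<^sup>2 / \<eta>)"
      using ptw by (intro AE_I2) (auto intro: order_trans[OF _ abs_ge_self])
  qed (simp add: f_def)
  have sum2: "(\<Sum>\<^sub>\<infinity>n. (norm (d n))\<^sup>2) \<le> 2 * (mol_defect M + mol_defect P)"
  proof -
    let ?g = "\<lambda>n. 2 * ((1 - ?a M n)\<^sup>2 / jbracket n ^ 4 + (1 - ?a P n)\<^sup>2 / jbracket n ^ 4)"
    have sg: "?g summable_on UNIV"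
      by (intro summable_on_cmult_right summable_on_add mol_defect_summable(1) M P)
    have le: "(norm (d n))\<^sup>2 \<le> ?g n" for n
    proof -
      have "d n = of_real (?a N n * (?a M n - ?a P n) / (jbracket n)\<^sup>2)"
        by (simp add: d_def right_diff_distrib diff_divide_distrib)
      then have "(norm (d n))\<^sup>2 = (?a N n)\<^sup>2 * (?a M n - ?a P n)\<^sup>2 / jbracket n ^ 4"
        by (simp only: norm_of_real power2_abs power_divide power_mult_distrib flip: power_mult) simp
      also have "\<dots> \<le> 1 * (?a M n - ?a P n)\<^sup>2 / jbracket n ^ 4"
        using mol_coeff_le_1[OF profile N, of n]
        by (intro divide_right_mono mult_right_mono) (auto simp: abs_square_le_1 less_imp_le)
      also have "\<dots> \<le> 2 * ((1 - ?a M n)\<^sup>2 + (1 - ?a P n)\<^sup>2) / jbracket n ^ 4"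
      proof (rule divide_right_mono)
        have "0 \<le> ((1 - ?a M n) + (1 - ?a P n))\<^sup>2" by simp
        then show "1 * (?a M n - ?a P n)\<^sup>2 \<le> 2 * ((1 - ?a M n)\<^sup>2 + (1 - ?a P n)\<^sup>2)"
          by (simp add: power2_eq_square algebra_simps)
      qed (simp add: less_imp_le)
      also have "\<dots> = ?g n" by (simp add: add_divide_distrib)
      finally show ?thesis .
    qed
    have "(\<Sum>\<^sub>\<infinity>n. (norm (d n))\<^sup>2) \<le> (\<Sum>\<^sub>\<infinity>n. ?g n)"
      by (rule infsum_mono[OF summable_on_comparison_test[OF sg le] sg le]) simp
    also have "\<dots> = 2 * (mol_defect M + mol_defect P)"
      unfolding mol_defect_def
      by (subst infsum_cmult_right[OF summable_on_add[OF mol_defect_summable(1)[OF M] mol_defect_summable(1)[OF P]]],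
          subst infsum_add[OF mol_defect_summable(1)[OF M] mol_defect_summable(1)[OF P]]) simp
    finally show ?thesis .
  qed
  have sum0: "0 \<le> (\<Sum>\<^sub>\<infinity>n. (norm (d n))\<^sup>2)" by (rule infsum_nonneg) simp
  have "(\<integral>z. \<bar>f z\<bar> \<partial>torusM) \<le> (\<integral>z. \<eta> + (norm (trig_series d z))\<^sup>2 / (4 * pi\<^sup>2)\<^sup>2 / \<eta> \<partial>torusM)"
    by (rule integral_mono[OF intf inti ptw])
  also have "\<dots> = 4 * pi\<^sup>2 * \<eta> + (4 * pi\<^sup>2 * (\<Sum>\<^sub>\<infinity>n. (norm (d n))\<^sup>2)) / (4 * pi\<^sup>2)\<^sup>2 / \<eta>"
    by (subst Bochner_Integration.integral_add) (use int2 in \<open>auto simp: parseval_trig_series[OF sd]\<close>)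
  also have "\<dots> \<le> 4 * pi\<^sup>2 * \<eta> + 2 * (mol_defect M + mol_defect P) / \<eta>"
  proof -
    have pi4: "1 \<le> 4 * pi\<^sup>2" using pi_ge_two power_mono[of 2 pi 2] by simp
    have "(4 * pi\<^sup>2 * (\<Sum>\<^sub>\<infinity>n. (norm (d n))\<^sup>2)) / (4 * pi\<^sup>2)\<^sup>2 = (\<Sum>\<^sub>\<infinity>n. (norm (d n))\<^sup>2) / (4 * pi\<^sup>2)"
      by (simp add: power2_eq_square)
    also have "\<dots> \<le> (\<Sum>\<^sub>\<infinity>n. (norm (d n))\<^sup>2) / 1" using sum0 pi4 by (intro divide_left_mono) auto
    also have "\<dots> \<le> 2 * (mol_defect M + mol_defect P)" using sum2 by simp
    finally show ?thesis using \<eta> by (intro add_left_mono divide_right_mono) auto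
  qed
  finally show ?thesis unfolding f .
qed

definition cov_energy :: "real \<Rightarrow> nat \<Rightarrow> nat \<Rightarrow> real" where
  "cov_energy b N M = (\<integral>z. exp (b * cov_kernel N M z) \<partial>torusM)"

lemma cov_kernel_exp_integrable: "N \<ge> 1 \<Longrightarrow> M \<ge> 1 \<Longrightarrow> integrable torusM (\<lambda>z. exp (b * cov_kernel N M z))"
  using trig_series_bounded_exp[OF summable_on_cov_coef[of N M], of "b / (4 * pi\<^sup>2)"] by (simp add: cov_kernel_def)

text \<open>The exponential is not Lipschitz, but for c between b and 4 pi the moments of exp (c K)
  are bounded, so \<open>exp_diff_bound\<close> reduces the claim to L1 closeness of the kernels.
  The constants are fixed in the order c, R, eta, N0.\<close>

lemma cov_energy_close:
  assumes b: "0 \<le> b" "b < 4 * pi" and e: "e > 0"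
  shows "\<exists>N0\<ge>1. \<forall>N\<ge>N0. \<forall>M\<ge>N0. \<forall>P\<ge>N0. \<bar>cov_energy b N M - cov_energy b N P\<bar> \<le> e"
proof -
  define c where "c = (b + 4 * pi) / 2"
  have c: "0 \<le> c" "b < c" "c < 4 * pi" using b by (auto simp: c_def)
  obtain B where B: "0 \<le> B" and bound: "\<And>N M. N \<ge> 1 \<Longrightarrow> M \<ge> 1 \<Longrightarrow> (\<integral>z. exp (c * cov_kernel N M z) \<partial>torusM) \<le> B"
    using cov_kernel_exp_bound[OF c(1,3)] by blast
  \<comment> \<open>Solves 4 (B + 1) exp (- (c - b) R) = e, so that the two tails together
    contribute at most e / 2.\<close>
  define R where "R = ln (4 * (B + 1) / e) / (c - b)"
  have "(c - b) * R = ln (4 * (B + 1) / e)" using c by (simp add: R_def)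
  then have "exp (- (c - b) * R) = e / (4 * (B + 1))"
    using e B unfolding minus_mult_left[symmetric] by (simp add: exp_minus)
  then have "exp (- (c - b) * R) * (4 * (B + 1)) = e" using B by simp
  moreover have "exp (- (c - b) * R) * (4 * B) \<le> exp (- (c - b) * R) * (4 * (B + 1))" by (intro mult_left_mono) auto
  ultimately have tail: "exp (- (c - b) * R) * (2 * B) \<le> e / 2" by linarith
  \<comment> \<open>The summand 1 keeps K positive for b = 0.\<close>
  define K where "K = b * exp (b * R) + 1"
  have K: "K > 0" "b * exp (b * R) \<le> K" using b by (auto simp: K_def add_nonneg_pos)
  \<comment> \<open>Makes the term 4 pi^2 eta of \<open>cov_kernel_diff_integral\<close> equal to e
    / (4 K); the defects are then chosen to contribute another e / (4 K).\<close>
  define \<eta> where "\<eta> = e / (4 * K * (4 * pi\<^sup>2))"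
  have \<eta>: "\<eta> > 0" using e K by (simp add: \<eta>_def)
  have "(\<lambda>N. 4 * mol_defect N / \<eta>) \<longlonglongrightarrow> 4 * 0 / \<eta>" using \<eta> by (intro tendsto_intros mol_defect_tendsto) simp
  then have "(\<lambda>N. 4 * mol_defect N / \<eta>) \<longlonglongrightarrow> 0" by simp
  moreover have "0 < e / (4 * K)" using e K by simp
  ultimately have "\<forall>\<^sub>F N in sequentially. 4 * mol_defect N / \<eta> < e / (4 * K)"
    by (rule order_tendstoD)
  then obtain N1 where N1: "\<And>N. N \<ge> N1 \<Longrightarrow> 4 * mol_defect N / \<eta> < e / (4 * K)"
    by (auto simp: eventually_sequentially)
  show ?thesis
  proof (intro exI[of _ "max N1 1"] conjI allI impI)
    fix N M P assume "max N1 1 \<le> N" "max N1 1 \<le> M" "max N1 1 \<le> P"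
    then have N: "N \<ge> 1" and M: "M \<ge> 1" "M \<ge> N1" and P: "P \<ge> 1" "P \<ge> N1" by auto
    let ?k = "cov_kernel N M" and ?l = "cov_kernel N P"
    note ie = cov_kernel_exp_integrable
    have D: "(\<integral>z. \<bar>?k z - ?l z\<bar> \<partial>torusM) \<le> e / (2 * K)"
    proof -
      have "(\<integral>z. \<bar>?k z - ?l z\<bar> \<partial>torusM) \<le> 4 * pi\<^sup>2 * \<eta> + 2 * (mol_defect M + mol_defect P) / \<eta>"
        by (rule cov_kernel_diff_integral[OF N M(1) P(1) \<eta>])
      also have "4 * pi\<^sup>2 * \<eta> = e / (4 * K)" using K by (simp add: \<eta>_def)
      also have "2 * (mol_defect M + mol_defect P) / \<eta> = (4 * mol_defect M / \<eta> + 4 * mol_defect P / \<eta>) / 2"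
        by (simp add: add_divide_distrib)
      also have "\<dots> \<le> (e / (4 * K) + e / (4 * K)) / 2" using N1[OF M(2)] N1[OF P(2)] by simp
      finally show ?thesis by simp
    qed
    have intD: "integrable torusM (\<lambda>z. \<bar>?k z - ?l z\<bar>)"
    proof -
      have "integrable torusM (cov_kernel N Q)" if "Q \<ge> 1" for Q
      proof (rule torusM.integrable_const_bound)
        show "AE z in torusM. norm (cov_kernel N Q z) \<le> (\<Sum>\<^sub>\<infinity>n. norm (cov_coef N Q n)) / (4 * pi\<^sup>2)"
          unfolding cov_kernel_def real_norm_def abs_divide
          using order_trans[OF abs_Re_le_cmod trig_series_norm_le[OF summable_on_cov_coef[OF N that]]]
          by (intro AE_I2) (simp add: divide_right_mono)
        show "cov_kernel N Q \<in> borel_measurable torusM"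
          unfolding measurable_cong_sets[OF sets_torusM refl]
          by (rule borel_measurable_continuous_onI[OF cov_kernel_continuous[OF N that]])
      qed
      then show ?thesis using M(1) P(1) by simp
    qed
    have "\<bar>cov_energy b N M - cov_energy b N P\<bar> = \<bar>\<integral>z. exp (b * ?k z) - exp (b * ?l z) \<partial>torusM\<bar>"
      unfolding cov_energy_def using ie[OF N M(1)] ie[OF N P(1)] by simp
    also have "\<dots> \<le> (\<integral>z. \<bar>exp (b * ?k z) - exp (b * ?l z)\<bar> \<partial>torusM)" by (rule integral_abs_bound)
    also have "\<dots> \<le> (\<integral>z. b * exp (b * R) * \<bar>?k z - ?l z\<bar> + exp (- (c - b) * R) * (exp (c * ?k z) + exp (c * ?l z)) \<partial>torusM)"
    proof (rule integral_mono)
      show "\<bar>exp (b * ?k z) - exp (b * ?l z)\<bar> \<le> b * exp (b * R) * \<bar>?k z - ?l z\<bar> + exp (- (c - b) * R) * (exp (c * ?k z) + exp (c * ?l z))" for z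
        using b c by (intro exp_diff_bound) auto
    qed (use intD ie[OF N M(1)] ie[OF N P(1)] in auto)
    also have "\<dots> = b * exp (b * R) * (\<integral>z. \<bar>?k z - ?l z\<bar> \<partial>torusM) + exp (- (c - b) * R) * ((\<integral>z. exp (c * ?k z) \<partial>torusM) + (\<integral>z. exp (c * ?l z) \<partial>torusM))"
      using intD ie[OF N M(1)] ie[OF N P(1)] by simp
    also have "\<dots> \<le> K * (e / (2 * K)) + exp (- (c - b) * R) * (B + B)"
      using K D b bound[OF N M(1)] bound[OF N P(1)] by (intro add_mono mult_mono) auto
    also have "K * (e / (2 * K)) = e / 2" using K by simp
    also have "exp (- (c - b) * R) * (B + B) \<le> e / 2" using tail by simp
    finally show "\<bar>cov_energy b N M - cov_energy b N P\<bar> \<le> e" by simp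
  qed simp
qed

end

section \<open>Convergence of Gibbs measures in total variation\<close>

text \<open>Along a subsequence with increments of integral at most 2^-j the increments are
  absolutely summable almost everywhere, so the sequence telescopes to a limit.\<close>

lemma L1_cauchy_AE_subsequence:
  fixes Y :: "nat \<Rightarrow> 'b \<Rightarrow> real"
  assumes Y: "\<And>N. integrable \<mu> (Y N)"
    and cauchy: "\<And>e. e > 0 \<Longrightarrow> \<exists>N0. \<forall>N\<ge>N0. \<forall>M\<ge>N0. (\<integral>x. \<bar>Y N x - Y M x\<bar> \<partial>\<mu>) \<le> e"
  obtains r :: "nat \<Rightarrow> nat" where "\<And>j. j \<le> r j" "AE x in \<mu>. convergent (\<lambda>j. Y (r j) x)"
proof -
  have "\<forall>j. \<exists>N0. \<forall>N\<ge>N0. \<forall>M\<ge>N0. (\<integral>x. \<bar>Y N x - Y M x\<bar> \<partial>\<mu>) \<le> (1 / 2) ^ j"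
    using cauchy by simp
  from choice[OF this] obtain n where
    n: "\<forall>j. \<forall>N\<ge>n j. \<forall>M\<ge>n j. (\<integral>x. \<bar>Y N x - Y M x\<bar> \<partial>\<mu>) \<le> (1 / 2) ^ j" ..
  \<comment> \<open>Adding all previous thresholds makes both r j and r (j + 1) exceed n j, and the
    summand j makes r unbounded.\<close>
  define r where "r j = j + (\<Sum>i\<le>j. n i)" for j
  have r: "n j \<le> r j" "n j \<le> r (Suc j)" for j
  proof -
    have "n j \<le> (\<Sum>i\<le>j. n i)" by (rule member_le_sum) auto
    then show "n j \<le> r j" "n j \<le> r (Suc j)" by (auto simp: r_def)
  qed
  have [measurable]: "Y N \<in> borel_measurable \<mu>" for N using Y by auto
  have "AE x in \<mu>. (\<lambda>j. \<bar>Y (r (Suc j)) x - Y (r j) x\<bar>) summable_on UNIV"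
  proof (rule AE_summable_on)
    have "summable (\<lambda>j. (1 / 2 :: real) ^ j)" by (rule summable_geometric) simp
    then show "(\<lambda>j. (1 / 2 :: real) ^ j) summable_on UNIV" by (intro summable_nonneg_imp_summable_on) auto
    fix j
    have "(\<integral>\<^sup>+x. ennreal \<bar>Y (r (Suc j)) x - Y (r j) x\<bar> \<partial>\<mu>) = ennreal (\<integral>x. \<bar>Y (r (Suc j)) x - Y (r j) x\<bar> \<partial>\<mu>)"
      by (rule nn_integral_eq_integral) (use Y in auto)
    also have "\<dots> \<le> ennreal ((1 / 2) ^ j)" using n r by (intro ennreal_leI) blast
    finally show "(\<integral>\<^sup>+x. ennreal \<bar>Y (r (Suc j)) x - Y (r j) x\<bar> \<partial>\<mu>) \<le> ennreal ((1 / 2) ^ j)" .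
  qed auto
  then have "AE x in \<mu>. convergent (\<lambda>j. Y (r j) x)"
  proof eventually_elim
    case (elim x)
    then have "summable (\<lambda>j. \<bar>Y (r (Suc j)) x - Y (r j) x\<bar>)" by (rule summable_on_imp_summable)
    then have "summable (\<lambda>j. Y (r (Suc j)) x - Y (r j) x)" by (rule summable_rabs_cancel)
    then have "convergent (\<lambda>m. \<Sum>j<m. Y (r (Suc j)) x - Y (r j) x)" by (simp add: summable_iff_convergent)
    then have "convergent (\<lambda>m. Y (r m) x - Y (r 0) x)" by (simp only: sum_lessThan_telescope[of "\<lambda>j. Y (r j) x"])
    then have "convergent (\<lambda>m. (Y (r m) x - Y (r 0) x) + Y (r 0) x)" by (intro convergent_add convergent_const)
    then show ?case by simp
  qed
  moreover have "j \<le> r j" for j by (simp add: r_def)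
  ultimately show ?thesis using that by blast
qed

lemma density_prob_space:
  assumes "integrable \<mu> f" "\<And>x. 0 \<le> f x" "(\<integral>x. f x \<partial>\<mu>) = 1"
  shows "prob_space (density \<mu> (\<lambda>x. ennreal (f x)))"
proof
  have "emeasure (density \<mu> (\<lambda>x. ennreal (f x))) (space (density \<mu> (\<lambda>x. ennreal (f x)))) = (\<integral>\<^sup>+x. ennreal (f x) \<partial>\<mu>)"
    using assms(1) by (subst emeasure_density) (auto intro!: nn_integral_cong)
  also have "\<dots> = 1" using assms by (simp add: nn_integral_eq_integral)
  finally show "emeasure (density \<mu> (\<lambda>x. ennreal (f x))) (space (density \<mu> (\<lambda>x. ennreal (f x)))) = 1" .
qed

lemma measure_density_diff_le:
  assumes f: "integrable \<mu> f" "\<And>x. 0 \<le> f x" and h: "integrable \<mu> h" "\<And>x. 0 \<le> h x" and A: "A \<in> sets \<mu>"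
  shows "\<bar>measure (density \<mu> (\<lambda>x. ennreal (f x))) A - measure (density \<mu> (\<lambda>x. ennreal (h x))) A\<bar> \<le> (\<integral>x. \<bar>f x - h x\<bar> \<partial>\<mu>)"
proof -
  have m: "measure (density \<mu> (\<lambda>x. ennreal (k x))) A = (\<integral>x. k x * indicator A x \<partial>\<mu>)"
    if k: "integrable \<mu> k" "\<And>x. 0 \<le> k x" for k
  proof -
    have i: "integrable \<mu> (\<lambda>x. k x * indicator A x)" using integrable_real_mult_indicator[OF A k(1)] .
    have "emeasure (density \<mu> (\<lambda>x. ennreal (k x))) A = (\<integral>\<^sup>+x. ennreal (k x) * indicator A x \<partial>\<mu>)"
      using k A by (intro emeasure_density) auto
    also have "\<dots> = (\<integral>\<^sup>+x. ennreal (k x * indicator A x) \<partial>\<mu>)"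
      by (intro nn_integral_cong) (auto split: split_indicator)
    also have "\<dots> = ennreal (\<integral>x. k x * indicator A x \<partial>\<mu>)"
      using k by (intro nn_integral_eq_integral i) auto
    finally show ?thesis using k by (simp add: measure_def)
  qed
  note ii = integrable_real_mult_indicator[OF A f(1)] integrable_real_mult_indicator[OF A h(1)]
  have "measure (density \<mu> (\<lambda>x. ennreal (f x))) A - measure (density \<mu> (\<lambda>x. ennreal (h x))) A = (\<integral>x. f x * indicator A x - h x * indicator A x \<partial>\<mu>)"
    unfolding m[OF f] m[OF h] using ii by simp
  also have "\<bar>\<dots>\<bar> \<le> (\<integral>x. \<bar>f x * indicator A x - h x * indicator A x\<bar> \<partial>\<mu>)" by (rule integral_abs_bound)
  also have "\<dots> \<le> (\<integral>x. \<bar>f x - h x\<bar> \<partial>\<mu>)"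
    by (rule integral_mono) (use ii f h in \<open>auto split: split_indicator\<close>)
  finally show ?thesis .
qed

text \<open>The difference of the measures of one set is at most the L1 distance of the densities.
  The empty set shows that the supremum is nonnegative, which allows the absolute value on the
  left.\<close>

lemma tv_dist_density_le:
  assumes f: "integrable \<mu> f" "\<And>x. 0 \<le> f x" and h: "integrable \<mu> h" "\<And>x. 0 \<le> h x"
  shows "\<bar>tv_dist (density \<mu> (\<lambda>x. ennreal (f x))) (density \<mu> (\<lambda>x. ennreal (h x)))\<bar> \<le> (\<integral>x. \<bar>f x - h x\<bar> \<partial>\<mu>)"
proof -
  let ?F = "density \<mu> (\<lambda>x. ennreal (f x))" and ?H = "density \<mu> (\<lambda>x. ennreal (h x))"
  let ?d = "\<lambda>A. \<bar>measure ?F A - measure ?H A\<bar>"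
  have le: "?d A \<le> (\<integral>x. \<bar>f x - h x\<bar> \<partial>\<mu>)" if "A \<in> sets ?F" for A
    using that by (intro measure_density_diff_le f h) simp
  then have "bdd_above (?d ` sets ?F)" by (auto intro!: bdd_aboveI2)
  then have "?d {} \<le> (SUP A\<in>sets ?F. ?d A)" by (intro cSUP_upper) auto
  moreover have "(SUP A\<in>sets ?F. ?d A) \<le> (\<integral>x. \<bar>f x - h x\<bar> \<partial>\<mu>)"
    by (rule cSUP_least) (use le in auto)
  ultimately show ?thesis by (simp add: tv_dist_def)
qed

text \<open>The abstract part of the argument: from second moments of nonnegative Y to total
  variation. W is tied to Y on the space of the measure only, since outside the distributions the
  weight is not controlled. The three indices in the Cauchy condition match the expansion of E (Y N
  - Y M)^2 into differences that share one index.\<close>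

lemma gibbs_limit:
  fixes \<mu> :: "'b measure" and Y W :: "nat \<Rightarrow> 'b \<Rightarrow> real" and lam :: real
  assumes "prob_space \<mu>" and lam: "lam > 0"
    and Ym: "\<And>N. Y N \<in> borel_measurable \<mu>" and Y0: "\<And>N x. 0 \<le> Y N x"
    and W: "\<And>N x. x \<in> space \<mu> \<Longrightarrow> W N x = exp (- lam * Y N x)" "\<And>N x. 0 \<le> W N x"
    and YY: "\<And>N M. integrable \<mu> (\<lambda>x. Y N x * Y M x)"
    and close: "\<And>e. e > 0 \<Longrightarrow> \<exists>N0. \<forall>N\<ge>N0. \<forall>M\<ge>N0. \<forall>P\<ge>N0.
       \<bar>(\<integral>x. Y N x * Y M x \<partial>\<mu>) - (\<integral>x. Y N x * Y P x \<partial>\<mu>)\<bar> \<le> e"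
  shows "\<exists>\<nu>. prob_space \<nu> \<and> sets \<nu> = sets \<mu> \<and>
     (\<lambda>N. tv_dist (density \<mu> (\<lambda>x. ennreal (inverse (\<integral>x. W N x \<partial>\<mu>) * W N x))) \<nu>) \<longlonglongrightarrow> 0 \<and>
     absolutely_continuous \<mu> \<nu> \<and> absolutely_continuous \<nu> \<mu>"
proof -
  interpret prob_space \<mu> by fact
  note Ym[measurable]
  have intY2: "integrable \<mu> (\<lambda>x. (Y N x)\<^sup>2)" for N using YY[of N N] by (simp add: power2_eq_square)
  have intY: "integrable \<mu> (Y N)" for N by (rule square_integrable_imp_integrable[OF Ym intY2])
  have cauchyY: "\<exists>N0. \<forall>N\<ge>N0. \<forall>M\<ge>N0. (\<integral>x. \<bar>Y N x - Y M x\<bar> \<partial>\<mu>) \<le> e" if e: "e > 0" for e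
  proof -
    define \<eta> where "\<eta> = e / 3"
    have \<eta>: "\<eta> > 0" using e by (simp add: \<eta>_def)
    obtain N0 where N0: "\<forall>N\<ge>N0. \<forall>M\<ge>N0. \<forall>P\<ge>N0.
       \<bar>(\<integral>x. Y N x * Y M x \<partial>\<mu>) - (\<integral>x. Y N x * Y P x \<partial>\<mu>)\<bar> \<le> \<eta>\<^sup>2" using close[of "\<eta>\<^sup>2"] \<eta> by auto
    have "(\<integral>x. \<bar>Y N x - Y M x\<bar> \<partial>\<mu>) \<le> e" if "N \<ge> N0" "M \<ge> N0" for N M
    proof -
      \<comment> \<open>Grouped so that each bracket has the form Y A Y B - Y A Y C with a common
        index, to which the Cauchy condition applies.\<close>
      have sq: "(Y N x - Y M x)\<^sup>2 = (Y N x * Y N x - Y N x * Y M x) + (Y M x * Y M x - Y M x * Y N x)" for x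
        by (simp add: power2_eq_square algebra_simps)
      have "(\<integral>x. (Y N x - Y M x)\<^sup>2 \<partial>\<mu>) = ((\<integral>x. Y N x * Y N x \<partial>\<mu>) - (\<integral>x. Y N x * Y M x \<partial>\<mu>)) +
          ((\<integral>x. Y M x * Y M x \<partial>\<mu>) - (\<integral>x. Y M x * Y N x \<partial>\<mu>))"
        unfolding sq by (simp only: Bochner_Integration.integral_add[OF Bochner_Integration.integrable_diff[OF YY YY]
            Bochner_Integration.integrable_diff[OF YY YY]] Bochner_Integration.integral_diff[OF YY YY])
      also have "\<dots> \<le> \<eta>\<^sup>2 + \<eta>\<^sup>2"
      proof (rule add_mono)
        show "(\<integral>x. Y N x * Y N x \<partial>\<mu>) - (\<integral>x. Y N x * Y M x \<partial>\<mu>) \<le> \<eta>\<^sup>2"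
          by (rule order_trans[OF abs_ge_self]) (use N0 that in blast)
        show "(\<integral>x. Y M x * Y M x \<partial>\<mu>) - (\<integral>x. Y M x * Y N x \<partial>\<mu>) \<le> \<eta>\<^sup>2"
          by (rule order_trans[OF abs_ge_self]) (use N0 that in blast)
      qed
      finally have sqle: "(\<integral>x. (Y N x - Y M x)\<^sup>2 \<partial>\<mu>) \<le> 2 * \<eta>\<^sup>2" by simp
      have intsq: "integrable \<mu> (\<lambda>x. (Y N x - Y M x)\<^sup>2)" unfolding sq by (intro Bochner_Integration.integrable_add Bochner_Integration.integrable_diff YY)
      have "(\<integral>x. \<bar>Y N x - Y M x\<bar> \<partial>\<mu>) \<le> (\<integral>x. \<eta> + (Y N x - Y M x)\<^sup>2 / \<eta> \<partial>\<mu>)"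
        by (rule integral_mono) (use intY intsq abs_le_square_over[OF \<eta>] in auto)
      also have "\<dots> = \<eta> + (\<integral>x. (Y N x - Y M x)\<^sup>2 \<partial>\<mu>) / \<eta>" using intsq by (simp add: prob_space)
      also have "\<dots> \<le> \<eta> + 2 * \<eta>\<^sup>2 / \<eta>" using sqle \<eta> by (intro add_left_mono divide_right_mono) auto
      also have "\<dots> = e" using \<eta> by (simp add: power2_eq_square \<eta>_def)
      finally show ?thesis .
    qed
    then show ?thesis by blast
  qed
  have WE: "(\<integral>x. F (W N x) x \<partial>\<mu>) = (\<integral>x. F (exp (- lam * Y N x)) x \<partial>\<mu>)" for F :: "real \<Rightarrow> 'b \<Rightarrow> real" and N
    by (rule Bochner_Integration.integral_cong) (auto simp: W(1))
  have Wm [measurable]: "W N \<in> borel_measurable \<mu>" for N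
    by (subst measurable_cong[OF W(1)]) measurable
  have expY: "exp (- lam * Y N x) \<le> 1" for N x using lam Y0[of N x] by simp
  have W1: "W N x \<le> 1" if "x \<in> space \<mu>" for N x using W(1)[OF that, of N] expY[of N x] by simp
  have intW: "integrable \<mu> (W N)" for N
    by (rule integrable_const_bound[of _ 1]) (use W1 W(2) in auto)
  obtain r :: "nat \<Rightarrow> nat" where r: "\<And>j. j \<le> r j" and conv: "AE x in \<mu>. convergent (\<lambda>j. Y (r j) x)"
  proof (rule L1_cauchy_AE_subsequence[OF intY cauchyY])
    fix r :: "nat \<Rightarrow> nat"
    assume "\<And>j. j \<le> r j" "AE x in \<mu>. convergent (\<lambda>j. Y (r j) x)"
    then show thesis by (rule that)
  qed
  \<comment> \<open>Where the subsequence diverges, \<open>lim\<close> is some unspecified real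
    number. V is still the exponential of a real number and so positive everywhere; this yields the
    absolute continuity of the given measure with respect to the limit.\<close>
  define V where "V x = exp (- lam * lim (\<lambda>j. Y (r j) x))" for x
  have Vm [measurable]: "V \<in> borel_measurable \<mu>"
    unfolding V_def by (intro measurable_compose[OF _ borel_measurable_exp] borel_measurable_times borel_measurable_const borel_measurable_lim_metric Ym)
  have V0: "0 < V x" for x by (simp add: V_def)
  have WV: "AE x in \<mu>. (\<lambda>j. W (r j) x) \<longlonglongrightarrow> V x"
    using conv AE_space
  proof eventually_elim
    case (elim x)
    then have "(\<lambda>j. exp (- lam * Y (r j) x)) \<longlonglongrightarrow> V x"
      unfolding V_def convergent_LIMSEQ_iff by (intro tendsto_intros)
    then show ?case using elim by (simp add: W(1))
  qed
  have V1: "AE x in \<mu>. V x \<le> 1"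
    using WV AE_space by eventually_elim (auto intro: LIMSEQ_le_const2 W1)
  have intV: "integrable \<mu> V"
    by (rule integrable_const_bound[of _ 1]) (use V1 V0 in \<open>auto simp: less_imp_le\<close>)
  have subL1: "(\<lambda>j. \<integral>x. \<bar>W (r j) x - V x\<bar> \<partial>\<mu>) \<longlonglongrightarrow> 0"
  proof -
    have "(\<lambda>j. \<integral>x. \<bar>W (r j) x - V x\<bar> \<partial>\<mu>) \<longlonglongrightarrow> (\<integral>x. 0 \<partial>\<mu>)"
    proof (rule integral_dominated_convergence[where w = "\<lambda>_. 1"])
      show "AE x in \<mu>. (\<lambda>j. \<bar>W (r j) x - V x\<bar>) \<longlonglongrightarrow> 0"
        using WV by eventually_elim (auto intro: tendsto_rabs_zero LIM_zero)
      show "AE x in \<mu>. norm \<bar>W (r j) x - V x\<bar> \<le> 1" for j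
        using V1 AE_space
      proof eventually_elim
        case (elim x)
        then show ?case using W1[of x "r j"] W(2)[of "r j" x] V0[of x] by auto
      qed
    qed auto
    then show ?thesis by simp
  qed
  \<comment> \<open>Dominated convergence covers the subsequence only. The rest follows because the
    weights are Lipschitz images of Y, hence Cauchy in L1 along the whole sequence.\<close>
  have L1: "(\<lambda>N. \<integral>x. \<bar>W N x - V x\<bar> \<partial>\<mu>) \<longlonglongrightarrow> 0"
  proof (rule LIMSEQ_I)
    fix e :: real assume e: "e > 0"
    obtain N0 where N0: "\<forall>N\<ge>N0. \<forall>M\<ge>N0. (\<integral>x. \<bar>Y N x - Y M x\<bar> \<partial>\<mu>) \<le> e / (4 * lam)"
      using cauchyY[of "e / (4 * lam)"] e lam by auto
    obtain j0 where j0: "\<forall>j\<ge>j0. norm ((\<integral>x. \<bar>W (r j) x - V x\<bar> \<partial>\<mu>) - 0) < e / 2"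
      using LIMSEQ_D[OF subL1, of "e / 2"] e by auto
    define j where "j = max j0 N0"
    have rj: "r j \<ge> N0" using r[of j] by (simp add: j_def)
    show "\<exists>no. \<forall>N\<ge>no. norm ((\<integral>x. \<bar>W N x - V x\<bar> \<partial>\<mu>) - 0) < e"
    proof (intro exI allI impI)
      fix N assume N: "N \<ge> N0"
      have "(\<integral>x. \<bar>W N x - W (r j) x\<bar> \<partial>\<mu>) \<le> (\<integral>x. lam * \<bar>Y N x - Y (r j) x\<bar> \<partial>\<mu>)"
      proof (rule integral_mono)
        show "\<bar>W N x - W (r j) x\<bar> \<le> lam * \<bar>Y N x - Y (r j) x\<bar>" if x: "x \<in> space \<mu>" for x
        proof -
          \<comment> \<open>\<open>exp_diff_le\<close> with R = 0: both exponents are nonpositive,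
            where the exponential has Lipschitz constant 1.\<close>
          have "\<bar>exp (- lam * Y N x) - exp (- lam * Y (r j) x)\<bar> \<le> exp 0 * \<bar>- lam * Y N x - - lam * Y (r j) x\<bar>"
            using lam Y0 by (intro exp_diff_le) auto
          also have "\<bar>- lam * Y N x - - lam * Y (r j) x\<bar> = lam * \<bar>Y N x - Y (r j) x\<bar>"
          proof -
            have "- lam * Y N x - - lam * Y (r j) x = - lam * (Y N x - Y (r j) x)" by (simp add: algebra_simps)
            then show ?thesis using lam by (simp only: abs_mult abs_minus_cancel abs_of_pos)
          qed
          finally show ?thesis unfolding W(1)[OF x] by simp
        qed
      qed (use intW intY in auto)
      also have "\<dots> = lam * (\<integral>x. \<bar>Y N x - Y (r j) x\<bar> \<partial>\<mu>)" by simp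
      also have "\<dots> \<le> lam * (e / (4 * lam))" using N0 N rj lam by (intro mult_left_mono) auto
      also have "\<dots> = e / 4" using lam by simp
      finally have 1: "(\<integral>x. \<bar>W N x - W (r j) x\<bar> \<partial>\<mu>) \<le> e / 4" .
      have 2: "(\<integral>x. \<bar>W (r j) x - V x\<bar> \<partial>\<mu>) < e / 2"
        using j0[rule_format, of j] by (simp add: j_def)
      have "(\<integral>x. \<bar>W N x - V x\<bar> \<partial>\<mu>) \<le> (\<integral>x. \<bar>W N x - W (r j) x\<bar> + \<bar>W (r j) x - V x\<bar> \<partial>\<mu>)"
        by (rule integral_mono) (use intW intV in auto)
      also have "\<dots> = (\<integral>x. \<bar>W N x - W (r j) x\<bar> \<partial>\<mu>) + (\<integral>x. \<bar>W (r j) x - V x\<bar> \<partial>\<mu>)"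
        using intW intV by simp
      finally have "(\<integral>x. \<bar>W N x - V x\<bar> \<partial>\<mu>) < e" using 1 2 e by linarith
      then show "norm ((\<integral>x. \<bar>W N x - V x\<bar> \<partial>\<mu>) - 0) < e" by simp
    qed
  qed
  define Z where "Z N = (\<integral>x. W N x \<partial>\<mu>)" for N
  define Zl where "Zl = (\<integral>x. V x \<partial>\<mu>)"
  have Zdiff: "\<bar>Z N - Zl\<bar> \<le> (\<integral>x. \<bar>W N x - V x\<bar> \<partial>\<mu>)" for N
    unfolding Z_def Zl_def using integral_abs_bound[of \<mu> "\<lambda>x. W N x - V x"] intW intV by simp
  have Zpos: "Zl > 0"
  proof -
    have "Zl \<ge> 0" unfolding Zl_def using V0 by (intro integral_nonneg_AE) (auto simp: less_imp_le)
    moreover have "Zl \<noteq> 0"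
    proof
      assume "Zl = 0"
      then have "AE x in \<mu>. V x = 0"
        using integral_nonneg_eq_0_iff_AE[OF intV] V0 by (auto simp: Zl_def less_imp_le)
      then have "AE x in \<mu>. False" by eventually_elim (metis V0 less_irrefl)
      then show False by simp
    qed
    ultimately show ?thesis by simp
  qed
  have Zlim: "Z \<longlonglongrightarrow> Zl"
  proof -
    have "(\<lambda>N. Z N - Zl) \<longlonglongrightarrow> 0"
      by (rule Lim_null_comparison[OF _ L1]) (use Zdiff in auto)
    then show ?thesis by (simp add: LIM_zero_iff)
  qed
  have Z0: "0 \<le> Z N" for N unfolding Z_def using W(2) by (intro integral_nonneg_AE) auto
  define \<nu> where "\<nu> = density \<mu> (\<lambda>x. ennreal (inverse Zl * V x))"
  have tv: "(\<lambda>N. tv_dist (density \<mu> (\<lambda>x. ennreal (inverse (Z N) * W N x))) \<nu>) \<longlonglongrightarrow> 0"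
  proof (rule Lim_null_comparison)
    show "\<forall>\<^sub>F N in sequentially. norm (tv_dist (density \<mu> (\<lambda>x. ennreal (inverse (Z N) * W N x))) \<nu>)
        \<le> inverse (Z N) * (\<integral>x. \<bar>W N x - V x\<bar> \<partial>\<mu>) + \<bar>inverse (Z N) - inverse Zl\<bar> * Zl"
    proof (rule always_eventually, rule allI)
      fix N
      have "norm (tv_dist (density \<mu> (\<lambda>x. ennreal (inverse (Z N) * W N x))) \<nu>) \<le> (\<integral>x. \<bar>inverse (Z N) * W N x - inverse Zl * V x\<bar> \<partial>\<mu>)"
        unfolding \<nu>_def real_norm_def
        by (rule tv_dist_density_le) (use intW intV Z0[of N] Zpos W(2) V0 in \<open>auto simp: less_imp_le\<close>)
      also have "\<dots> \<le> (\<integral>x. inverse (Z N) * \<bar>W N x - V x\<bar> + \<bar>inverse (Z N) - inverse Zl\<bar> * V x \<partial>\<mu>)"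
      proof (rule integral_mono)
        fix x
        \<comment> \<open>The error of the normalizing constant is attached to V, whose integral is
          exactly Zl, and the error of the weights to the convergent factor inverse (Z N).\<close>
        have "inverse (Z N) * W N x - inverse Zl * V x = inverse (Z N) * (W N x - V x) + (inverse (Z N) - inverse Zl) * V x"
          by (simp add: algebra_simps)
        also have "\<bar>\<dots>\<bar> \<le> \<bar>inverse (Z N) * (W N x - V x)\<bar> + \<bar>(inverse (Z N) - inverse Zl) * V x\<bar>" by (rule abs_triangle_ineq)
        also have "\<dots> = inverse (Z N) * \<bar>W N x - V x\<bar> + \<bar>inverse (Z N) - inverse Zl\<bar> * V x"
          using Z0[of N] V0[of x] by (simp add: abs_mult)
        finally show "\<bar>inverse (Z N) * W N x - inverse Zl * V x\<bar> \<le> inverse (Z N) * \<bar>W N x - V x\<bar> + \<bar>inverse (Z N) - inverse Zl\<bar> * V x" .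
      qed (use intW intV in auto)
      also have "\<dots> = inverse (Z N) * (\<integral>x. \<bar>W N x - V x\<bar> \<partial>\<mu>) + \<bar>inverse (Z N) - inverse Zl\<bar> * Zl"
        using intW intV by (simp add: Zl_def)
      finally show "norm (tv_dist (density \<mu> (\<lambda>x. ennreal (inverse (Z N) * W N x))) \<nu>)
        \<le> inverse (Z N) * (\<integral>x. \<bar>W N x - V x\<bar> \<partial>\<mu>) + \<bar>inverse (Z N) - inverse Zl\<bar> * Zl" .
    qed
    have "(\<lambda>N. inverse (Z N) * (\<integral>x. \<bar>W N x - V x\<bar> \<partial>\<mu>) + \<bar>inverse (Z N) - inverse Zl\<bar> * Zl)
        \<longlonglongrightarrow> inverse Zl * 0 + \<bar>inverse Zl - inverse Zl\<bar> * Zl"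
      using Zpos by (intro tendsto_intros L1 Zlim) auto
    then show "(\<lambda>N. inverse (Z N) * (\<integral>x. \<bar>W N x - V x\<bar> \<partial>\<mu>) + \<bar>inverse (Z N) - inverse Zl\<bar> * Zl) \<longlonglongrightarrow> 0" by simp
  qed
  have "prob_space \<nu>" unfolding \<nu>_def
  proof (rule density_prob_space)
    show "integrable \<mu> (\<lambda>x. inverse Zl * V x)" using intV by simp
    show "0 \<le> inverse Zl * V x" for x using V0[of x] Zpos by simp
    show "(\<integral>x. inverse Zl * V x \<partial>\<mu>) = 1" using Zpos by (simp add: Zl_def[symmetric])
  qed
  moreover have "sets \<nu> = sets \<mu>" by (simp add: \<nu>_def)
  moreover have "absolutely_continuous \<mu> \<nu>" unfolding \<nu>_def by (rule absolutely_continuousI_density) measurable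
  moreover have "absolutely_continuous \<nu> \<mu>" unfolding absolutely_continuous_def
  proof
    fix A assume "A \<in> null_sets \<nu>"
    then have A: "A \<in> sets \<mu>" "AE x in \<mu>. x \<in> A \<longrightarrow> ennreal (inverse Zl * V x) = 0"
      unfolding \<nu>_def by (subst (asm) null_sets_density_iff; simp)+
    have "AE x in \<mu>. x \<notin> A" using A(2)
    proof eventually_elim
      case (elim x)
      have "0 < inverse Zl * V x" using V0[of x] Zpos by simp
      then show ?case using elim by auto
    qed
    then show "A \<in> null_sets \<mu>" using A(1) by (simp add: AE_iff_null_sets)
  qed
  ultimately show ?thesis using tv unfolding Z_def by blast
qed

section \<open>Second moments of the Gaussian multiplicative chaos\<close>

lemma Re_complex_of_real_mult: "Re (of_real r * z) = r * Re z"
  by simp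

lemma norm_square_cis_combination:
  "(norm (of_real a * cis s + of_real b * cis t))\<^sup>2 = a\<^sup>2 + b\<^sup>2 + 2 * (a * b * cos (s - t))"
proof -
  have "(norm (of_real a * cis s + of_real b * cis t))\<^sup>2 = (a * cos s + b * cos t)\<^sup>2 + (a * sin s + b * sin t)\<^sup>2"
    by (simp add: cmod_power2)
  also have "\<dots> = a\<^sup>2 * ((sin s)\<^sup>2 + (cos s)\<^sup>2) + b\<^sup>2 * ((sin t)\<^sup>2 + (cos t)\<^sup>2) + 2 * (a * b * (cos s * cos t + sin s * sin t))"
    by algebra
  finally show ?thesis by (simp add: cos_diff)
qed

context
  fixes M :: "'a measure" and g :: "int \<times> int \<Rightarrow> 'a \<Rightarrow> complex" and \<rho> :: "real \<times> real \<Rightarrow> real"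
  assumes gauss: "gaussian_family M g" and profile: "mollifier_profile \<rho>"
begin

lemma measurable_gff: "gff_series g \<in> measurable M distribution_space"
  by (intro measurable_gff_series gaussian_measurable gauss)

lemma prob_space_massive_gff: "prob_space (massive_gff M g)"
  unfolding massive_gff_def
  by (rule prob_space.prob_space_distr[OF gaussian_prob_space[OF gauss] measurable_gff])

lemma sets_massive_gff [measurable_cong]: "sets (massive_gff M g) = sets distribution_space"
  by (simp add: massive_gff_def)

lemma space_massive_gff: "space (massive_gff M g) = torus_distributions"
  by (simp add: massive_gff_def space_distribution_space)

text \<open>The coefficient of g n in the mollified field at the point x: the multiplier of the
  mollifier times the value at x of the basis function over \<open>jbracket n\<close>.\<close>

definition field_coef :: "nat \<Rightarrow> real \<times> real \<Rightarrow> int \<times> int \<Rightarrow> complex" where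
  "field_coef N x n = of_real (mol_coeff \<rho> N n / (2 * pi * jbracket n)) * cis (freq n \<bullet> x)"

text \<open>The exceptional null set is that of \<open>AE_poly_coeffs\<close>, hence the same for
  all x.\<close>

lemma has_sum_mollified_field:
  assumes N: "N \<ge> 1"
  shows "AE \<omega> in M. \<forall>x. ((\<lambda>n. g n \<omega> * field_coef N x n) has_sum of_real (mollify \<rho> N (gff_series g \<omega>) x)) UNIV"
  using AE_poly_coeffs[OF gauss]
proof eventually_elim
  case (elim \<omega>)
  show ?case
  proof
    fix x
    note t = mollifier_translate_test[OF profile N, of x]
    have "((\<lambda>n. g n \<omega> / of_real (jbracket n) * (test_coeff (\<lambda>y. mollifier \<rho> N (x - y)) n / of_real (2 * pi)))
      has_sum of_real (gff_series g \<omega> (\<lambda>y. mollifier \<rho> N (x - y)))) UNIV"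
      using has_sum_series_distribution[OF elim t] elim by (simp only: gff_series_eq if_True)
    also have "(\<lambda>n. g n \<omega> / of_real (jbracket n) * (test_coeff (\<lambda>y. mollifier \<rho> N (x - y)) n / of_real (2 * pi))) =
        (\<lambda>n. g n \<omega> * field_coef N x n)"
      unfolding test_coeff_translate[OF profile N] by (simp add: field_coef_def fun_eq_iff)
    finally show "((\<lambda>n. g n \<omega> * field_coef N x n) has_sum of_real (mollify \<rho> N (gff_series g \<omega>) x)) UNIV"
      by (simp only: mollify_def)
  qed
qed

lemma sigma_N_eq:
  assumes N: "N \<ge> 1" shows "sigma_N \<rho> N = (\<Sum>\<^sub>\<infinity>n. (mol_coeff \<rho> N n / (2 * pi * jbracket n))\<^sup>2)"
proof -
  have "sigma_N \<rho> N = 1 / (4 * pi\<^sup>2) * (\<Sum>\<^sub>\<infinity>n. (mol_coeff \<rho> N n)\<^sup>2 / (jbracket n)\<^sup>2)"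
    unfolding sigma_N_def fourier_coeff_mollifier[OF profile N] ..
  also have "\<dots> = (\<Sum>\<^sub>\<infinity>n. 1 / (4 * pi\<^sup>2) * ((mol_coeff \<rho> N n)\<^sup>2 / (jbracket n)\<^sup>2))"
    by (rule infsum_cmult_right'[symmetric])
  finally show ?thesis by (simp add: power_divide power_mult_distrib)
qed

text \<open>The sum of the two field values is a single Gaussian series with coefficients b. By
  \<open>norm_square_cis_combination\<close>, |b n|^2 consists of two diagonal terms, which sum to
  \<open>sigma_N\<close>, and a cross term, which sums to the covariance kernel.\<close>

lemma mollified_field_mgf:
  assumes N: "N \<ge> 1" and P: "P \<ge> 1"
  shows "(\<integral>\<^sup>+\<omega>. ennreal (exp (\<beta> * mollify \<rho> N (gff_series g \<omega>) x + \<beta> * mollify \<rho> P (gff_series g \<omega>) y)) \<partial>M)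
    = ennreal (exp (\<beta>\<^sup>2 / 2 * sigma_N \<rho> N + \<beta>\<^sup>2 / 2 * sigma_N \<rho> P + \<beta>\<^sup>2 * cov_kernel \<rho> N P (x - y)))"
proof -
  let ?S = "\<lambda>\<omega>. \<beta> * mollify \<rho> N (gff_series g \<omega>) x + \<beta> * mollify \<rho> P (gff_series g \<omega>) y"
  define b where "b n = of_real \<beta> * field_coef N x n + of_real \<beta> * field_coef P y n" for n
  define u where "u n = mol_coeff \<rho> N n / (2 * pi * jbracket n)" for n
  define v where "v n = mol_coeff \<rho> P n / (2 * pi * jbracket n)" for n
  have sq: "(norm (b n))\<^sup>2 = \<beta>\<^sup>2 * ((u n)\<^sup>2 + (v n)\<^sup>2 + 2 * (u n * v n * cos (freq n \<bullet> (x - y))))" for n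
  proof -
    have "b n = of_real \<beta> * (of_real (u n) * cis (freq n \<bullet> x) + of_real (v n) * cis (freq n \<bullet> y))"
      by (simp add: b_def field_coef_def u_def v_def distrib_left)
    then show ?thesis
      by (simp only: norm_mult power_mult_distrib norm_of_real power2_abs norm_square_cis_combination inner_diff_right)
  qed
  have usm: "(\<lambda>n. (mol_coeff \<rho> Q n / (2 * pi * jbracket n))\<^sup>2) summable_on UNIV" if Q: "Q \<ge> 1" for Q
  proof (rule summable_on_comparison_test[OF summable_on_abs_mol_coeff[OF profile Q]])
    fix n
    have "(mol_coeff \<rho> Q n)\<^sup>2 \<le> \<bar>mol_coeff \<rho> Q n\<bar> * 1"
      using mol_coeff_le_1[OF profile Q, of n] unfolding power2_eq_square abs_mult_self_eq[symmetric, of "mol_coeff \<rho> Q n"]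
      by (intro mult_left_mono) auto
    moreover have "1 \<le> (2 * pi * jbracket n)\<^sup>2"
    proof -
      have "1 * 1 \<le> (2 * pi) * jbracket n" using pi_ge_two jbracket_ge_1[of n] by (intro mult_mono) auto
      then show ?thesis using power_mono[of 1 "2 * pi * jbracket n" 2] by simp
    qed
    ultimately show "(mol_coeff \<rho> Q n / (2 * pi * jbracket n))\<^sup>2 \<le> \<bar>mol_coeff \<rho> Q n\<bar>"
      unfolding power_divide using frac_le[of "\<bar>mol_coeff \<rho> Q n\<bar>" "(mol_coeff \<rho> Q n)\<^sup>2" 1 "(2 * pi * jbracket n)\<^sup>2"] by simp
  qed simp
  have su: "((\<lambda>n. (u n)\<^sup>2) has_sum sigma_N \<rho> N) UNIV" "((\<lambda>n. (v n)\<^sup>2) has_sum sigma_N \<rho> P) UNIV"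
    unfolding u_def v_def sigma_N_eq[OF N] sigma_N_eq[OF P] by (intro has_sum_infsum usm N P)+
  have "((\<lambda>n. Re (of_real (mol_coeff \<rho> N n * mol_coeff \<rho> P n / (jbracket n)\<^sup>2) * cis (freq n \<bullet> (x - y)))) has_sum
      Re (trig_series (cov_coef \<rho> N P) (x - y))) UNIV"
    by (intro has_sum_Re has_sum_trig_series summable_on_cov_coef[OF profile N P])
  note rs = this
  have sk: "((\<lambda>n. u n * v n * cos (freq n \<bullet> (x - y))) has_sum cov_kernel \<rho> N P (x - y)) UNIV"
  proof -
    have 1: "1 / (4 * pi\<^sup>2) * Re (of_real (mol_coeff \<rho> N n * mol_coeff \<rho> P n / (jbracket n)\<^sup>2) * cis t) = u n * v n * cos t" for n t
      by (simp only: Re_complex_of_real_mult cis.sel) (simp add: u_def v_def power2_eq_square)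
    have 2: "1 / (4 * pi\<^sup>2) * Re (trig_series (cov_coef \<rho> N P) (x - y)) = cov_kernel \<rho> N P (x - y)"
      by (simp only: cov_kernel_def[OF profile] times_divide_eq_left mult_1_left)
    show ?thesis using has_sum_cmult_right[OF rs, of "1 / (4 * pi\<^sup>2)"]
      unfolding 1 2 .
  qed
  have bs: "((\<lambda>n. (norm (b n))\<^sup>2) has_sum (\<beta>\<^sup>2 * (sigma_N \<rho> N + sigma_N \<rho> P + 2 * cov_kernel \<rho> N P (x - y)))) UNIV"
    unfolding sq by (intro has_sum_cmult_right has_sum_add su sk)
  have bm: "b (- n) = cnj (b n)" for n
    by (simp add: b_def field_coef_def mol_coeff_minus[OF profile N] mol_coeff_minus[OF profile P] freq_minus cis_cnj)
  have mS: "(\<lambda>\<omega>. mollify \<rho> Q (gff_series g \<omega>) z) \<in> borel_measurable M" if Q: "Q \<ge> 1" for Q z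
    unfolding mollify_def
    by (rule measurable_compose[OF measurable_gff measurable_eval_distribution[OF mollifier_translate_test[OF profile Q]]])
  have Sm: "?S \<in> borel_measurable M"
    by (intro borel_measurable_add borel_measurable_times borel_measurable_const mS N P)
  have AES: "AE \<omega> in M. ((\<lambda>n. g n \<omega> * b n) has_sum of_real (?S \<omega>)) UNIV"
    using has_sum_mollified_field[OF N] has_sum_mollified_field[OF P]
  proof eventually_elim
    case (elim \<omega>)
    have "((\<lambda>n. of_real \<beta> * (g n \<omega> * field_coef N x n) + of_real \<beta> * (g n \<omega> * field_coef P y n)) has_sum
       (of_real \<beta> * of_real (mollify \<rho> N (gff_series g \<omega>) x) + of_real \<beta> * of_real (mollify \<rho> P (gff_series g \<omega>) y))) UNIV"
      by (intro has_sum_add has_sum_cmult_right spec[OF elim(1)] spec[OF elim(2)])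
    then show ?case by (simp add: b_def distrib_left mult.left_commute)
  qed
  note mgf = gaussian_series_mgf[OF gauss has_sum_imp_summable[OF bs] bm Sm AES]
  have "(\<integral>\<^sup>+\<omega>. ennreal (exp (?S \<omega>)) \<partial>M) = ennreal (\<integral>\<omega>. exp (?S \<omega>) \<partial>M)"
    by (rule nn_integral_eq_integral[OF mgf(1)]) simp
  also have "(\<integral>\<omega>. exp (?S \<omega>) \<partial>M) = exp (\<beta>\<^sup>2 / 2 * sigma_N \<rho> N + \<beta>\<^sup>2 / 2 * sigma_N \<rho> P + \<beta>\<^sup>2 * cov_kernel \<rho> N P (x - y))"
    unfolding mgf(2) infsumI[OF bs] by (simp add: field_simps)
  finally show ?thesis .
qed

definition chaos_mass :: "real \<Rightarrow> nat \<Rightarrow> ((real \<times> real \<Rightarrow> real) \<Rightarrow> real) \<Rightarrow> real" where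
  "chaos_mass \<beta> N u = C_N \<rho> \<beta> N * (\<integral>x. exp (\<beta> * mollify \<rho> N u x) \<partial>torusM)"

lemma C_N_pos: "0 < C_N \<rho> \<beta> N"
  by (simp add: C_N_def)

lemma chaos_mass_nonneg: "0 \<le> chaos_mass \<beta> N u"
  unfolding chaos_mass_def using C_N_pos by (intro mult_nonneg_nonneg integral_nonneg_AE) (auto simp: less_imp_le)

lemma gibbs_weight_chaos_mass:
  assumes N: "N \<ge> 1" and u: "u \<in> torus_distributions"
  shows "gibbs_weight \<rho> lam \<beta> N u = exp (- lam * chaos_mass \<beta> N u)"
proof -
  have [measurable]: "mollify \<rho> N u \<in> borel_measurable borel"
    by (rule borel_measurable_continuous_onI[OF mollify_continuous[OF profile N u]])
  have "(LINT x:torus_cell|lborel. exp (\<beta> * mollify \<rho> N u x)) = (\<integral>x. exp (\<beta> * mollify \<rho> N u x) \<partial>torusM)"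
    by (rule set_integral_torus) measurable
  then show ?thesis by (simp add: gibbs_weight_def chaos_mass_def mult.assoc)
qed

lemma nn_integral_exp_mollify:
  assumes N: "N \<ge> 1" and u: "u \<in> torus_distributions"
  shows "(\<integral>\<^sup>+x. ennreal (exp (\<beta> * mollify \<rho> N u x)) \<partial>torusM) = ennreal (\<integral>x. exp (\<beta> * mollify \<rho> N u x) \<partial>torusM)"
proof (rule nn_integral_eq_integral)
  note cont = mollify_continuous[OF profile N u]
  have "torus_periodic (mollifier \<rho> N)" using mollifier_test[OF profile N] by (simp add: torus_test_def)
  then have per: "mollifier \<rho> N (a + 2 * pi, b) = mollifier \<rho> N (a, b)" "mollifier \<rho> N (a, b + 2 * pi) = mollifier \<rho> N (a, b)" for a b
    unfolding torus_periodic_def by simp_all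
  have "mollifier \<rho> N ((x1 + 2 * pi, x2) - w) = mollifier \<rho> N ((x1, x2) - w)"
    "mollifier \<rho> N ((x1, x2 + 2 * pi) - w) = mollifier \<rho> N ((x1, x2) - w)" for x1 x2 w
    using per(1)[of "x1 - fst w" "x2 - snd w"] per(2)[of "x1 - fst w" "x2 - snd w"]
    by (cases w; simp add: diff_add_eq)+
  then have "torus_periodic (mollify \<rho> N u)" unfolding torus_periodic_def mollify_def by (simp only: simp_thms)
  then obtain B where B: "\<And>x. norm (mollify \<rho> N u x) \<le> B" using torus_periodic_bounded[OF _ cont] by blast
  have [measurable]: "mollify \<rho> N u \<in> borel_measurable borel" by (rule borel_measurable_continuous_onI[OF cont])
  show "integrable torusM (\<lambda>x. exp (\<beta> * mollify \<rho> N u x))"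
  proof (rule torusM.integrable_const_bound[of _ "exp (\<bar>\<beta>\<bar> * B)"])
    show "AE x in torusM. norm (exp (\<beta> * mollify \<rho> N u x)) \<le> exp (\<bar>\<beta>\<bar> * B)"
    proof (rule AE_I2)
      fix x
      have "\<beta> * mollify \<rho> N u x \<le> \<bar>\<beta>\<bar> * \<bar>mollify \<rho> N u x\<bar>" unfolding abs_mult[symmetric] by simp
      also have "\<dots> \<le> \<bar>\<beta>\<bar> * B" using B[of x] by (intro mult_left_mono) auto
      finally show "norm (exp (\<beta> * mollify \<rho> N u x)) \<le> exp (\<bar>\<beta>\<bar> * B)" by simp
    qed
  qed simp
qed simp

lemma chaos_mass_measurable:
  assumes N: "N \<ge> 1" shows "chaos_mass \<beta> N \<in> borel_measurable distribution_space"
proof -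
  have "(\<lambda>p. mollify \<rho> N (fst p) (snd p)) \<in> borel_measurable (distribution_space \<Otimes>\<^sub>M torusM)"
    using measurable_mollify[OF profile N] unfolding measurable_cong_sets[OF sets_pair_measure_cong[OF refl sets_torusM] refl] .
  then have "(\<lambda>(u, x). exp (\<beta> * mollify \<rho> N u x)) \<in> borel_measurable (distribution_space \<Otimes>\<^sub>M torusM)"
    unfolding case_prod_unfold by measurable
  from torusM.borel_measurable_lebesgue_integral[OF this]
  show ?thesis unfolding chaos_mass_def by measurable
qed

text \<open>Computed with nonnegative integrals, so that Tonelli needs no prior integrability; this
  finite value is what then proves it. The renormalization cancels the diagonal variances exactly,
  and translation invariance makes the integral over y independent of x, leaving the area 4
  pi^2.\<close>

lemma chaos_mass_second_moment:
  assumes N: "N \<ge> 1" and P: "P \<ge> 1"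
  shows "integrable (massive_gff M g) (\<lambda>u. chaos_mass \<beta> N u * chaos_mass \<beta> P u)"
    and "(\<integral>u. chaos_mass \<beta> N u * chaos_mass \<beta> P u \<partial>massive_gff M g) = 4 * pi\<^sup>2 * cov_energy \<rho> (\<beta>\<^sup>2) N P"
proof -
  interpret prob_space M by (rule gaussian_prob_space[OF gauss])
  interpret TT: finite_measure "torusM \<Otimes>\<^sub>M torusM"
    by (rule finite_measure_pair_measure[OF torusM.finite_measure_axioms torusM.finite_measure_axioms])
  interpret pair_sigma_finite M "torusM \<Otimes>\<^sub>M torusM" ..
  let ?X = "\<lambda>N \<omega> x. mollify \<rho> N (gff_series g \<omega>) x"
  let ?E = "\<lambda>N \<omega> x. ennreal (exp (\<beta> * ?X N \<omega> x))"
  let ?C = "ennreal (C_N \<rho> \<beta> N * C_N \<rho> \<beta> P)"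
  have gffd: "gff_series g \<omega> \<in> torus_distributions" if "\<omega> \<in> space M" for \<omega>
    using measurable_space[OF measurable_gff that] by (simp add: space_distribution_space)
  have mX: "(\<lambda>p. ?X Q (fst p) (h (snd p))) \<in> borel_measurable (M \<Otimes>\<^sub>M (torusM \<Otimes>\<^sub>M torusM))"
    if Q: "Q \<ge> 1" and h: "h \<in> measurable (torusM \<Otimes>\<^sub>M torusM) borel" for Q h
  proof -
    have "(\<lambda>p. (gff_series g (fst p), h (snd p))) \<in> measurable (M \<Otimes>\<^sub>M (torusM \<Otimes>\<^sub>M torusM)) (distribution_space \<Otimes>\<^sub>M borel)"
      by (intro measurable_Pair measurable_compose[OF measurable_fst measurable_gff] measurable_compose[OF measurable_snd h])
    from measurable_compose[OF this measurable_mollify[OF profile Q]] show ?thesis by simp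
  qed
  have fs: "fst \<in> measurable (torusM \<Otimes>\<^sub>M torusM) borel" "snd \<in> measurable (torusM \<Otimes>\<^sub>M torusM) borel"
    using measurable_fst[of torusM torusM] measurable_snd[of torusM torusM]
    unfolding measurable_cong_sets[OF refl sets_torusM] .
  note mX1 = mX[OF N fs(1)] and mX2 = mX[OF P fs(2)]
  have Em: "(\<lambda>x. ?E Q \<omega> x) \<in> borel_measurable torusM" if "Q \<ge> 1" "\<omega> \<in> space M" for Q \<omega>
  proof -
    have [measurable]: "?X Q \<omega> \<in> borel_measurable borel"
      by (rule borel_measurable_continuous_onI[OF mollify_continuous[OF profile that(1) gffd[OF that(2)]]])
    show ?thesis unfolding measurable_cong_sets[OF sets_torusM refl] by measurable
  qed
  have pm: "(\<lambda>(\<omega>, z). ?E N \<omega> (fst z) * ?E P \<omega> (snd z)) \<in> borel_measurable (M \<Otimes>\<^sub>M (torusM \<Otimes>\<^sub>M torusM))"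
    unfolding case_prod_unfold using mX1 mX2 by measurable
  have kcont: "continuous_on UNIV (\<lambda>z. exp (\<beta>\<^sup>2 * cov_kernel \<rho> N P z))"
    by (intro continuous_intros cov_kernel_continuous[OF profile N P])
  have kper: "torus_periodic (\<lambda>z. exp (\<beta>\<^sup>2 * cov_kernel \<rho> N P z))"
  proof -
    note p = torus_periodic_trig_series[OF summable_on_cov_coef[OF profile N P], unfolded torus_periodic_def, rule_format]
    show ?thesis unfolding torus_periodic_def cov_kernel_def[OF profile]
      by (simp only: conjunct1[OF p] conjunct2[OF p] simp_thms)
  qed
  have "(\<integral>\<^sup>+u. ennreal (chaos_mass \<beta> N u * chaos_mass \<beta> P u) \<partial>massive_gff M g)
      = (\<integral>\<^sup>+\<omega>. ennreal (chaos_mass \<beta> N (gff_series g \<omega>) * chaos_mass \<beta> P (gff_series g \<omega>)) \<partial>M)"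
    unfolding massive_gff_def
    by (rule nn_integral_distr[OF measurable_gff]) (use chaos_mass_measurable[OF N] chaos_mass_measurable[OF P] in measurable)
  also have "\<dots> = (\<integral>\<^sup>+\<omega>. ?C * (\<integral>\<^sup>+z. ?E N \<omega> (fst z) * ?E P \<omega> (snd z) \<partial>(torusM \<Otimes>\<^sub>M torusM)) \<partial>M)"
  proof (rule nn_integral_cong)
    fix \<omega> assume \<omega>: "\<omega> \<in> space M"
    note Em1 = Em[OF N \<omega>] and Em2 = Em[OF P \<omega>]
    have "(\<integral>\<^sup>+z. ?E N \<omega> (fst z) * ?E P \<omega> (snd z) \<partial>(torusM \<Otimes>\<^sub>M torusM)) = (\<integral>\<^sup>+x. (\<integral>\<^sup>+y. ?E N \<omega> x * ?E P \<omega> y \<partial>torusM) \<partial>torusM)"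
    proof (subst torusM.nn_integral_fst[symmetric])
      show "(\<lambda>z. ?E N \<omega> (fst z) * ?E P \<omega> (snd z)) \<in> borel_measurable (torusM \<Otimes>\<^sub>M torusM)"
        using measurable_compose[OF measurable_fst Em1] measurable_compose[OF measurable_snd Em2] by measurable
    qed simp
    also have "\<dots> = (\<integral>\<^sup>+x. ?E N \<omega> x * (\<integral>\<^sup>+y. ?E P \<omega> y \<partial>torusM) \<partial>torusM)"
      by (intro nn_integral_cong nn_integral_cmult Em2)
    also have "\<dots> = (\<integral>\<^sup>+x. ?E N \<omega> x \<partial>torusM) * (\<integral>\<^sup>+y. ?E P \<omega> y \<partial>torusM)"
      by (rule nn_integral_multc[OF Em1])
    also have "\<dots> = ennreal (\<integral>x. exp (\<beta> * ?X N \<omega> x) \<partial>torusM) * ennreal (\<integral>x. exp (\<beta> * ?X P \<omega> x) \<partial>torusM)"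
      unfolding nn_integral_exp_mollify[OF N gffd[OF \<omega>]] nn_integral_exp_mollify[OF P gffd[OF \<omega>]] ..
    finally have e: "(\<integral>\<^sup>+z. ?E N \<omega> (fst z) * ?E P \<omega> (snd z) \<partial>(torusM \<Otimes>\<^sub>M torusM)) =
        ennreal (\<integral>x. exp (\<beta> * ?X N \<omega> x) \<partial>torusM) * ennreal (\<integral>x. exp (\<beta> * ?X P \<omega> x) \<partial>torusM)" .
    have nn: "0 \<le> (\<integral>x. exp (\<beta> * ?X Q \<omega> x) \<partial>torusM)" for Q by (rule integral_nonneg_AE) simp
    have "0 \<le> C_N \<rho> \<beta> N * C_N \<rho> \<beta> P" using C_N_pos[of \<beta> N] C_N_pos[of \<beta> P] by simp
    then show "ennreal (chaos_mass \<beta> N (gff_series g \<omega>) * chaos_mass \<beta> P (gff_series g \<omega>)) =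
        ?C * (\<integral>\<^sup>+z. ?E N \<omega> (fst z) * ?E P \<omega> (snd z) \<partial>(torusM \<Otimes>\<^sub>M torusM))"
      unfolding e chaos_mass_def using nn by (simp add: ennreal_mult[symmetric] mult_ac)
  qed
  also have "\<dots> = ?C * (\<integral>\<^sup>+\<omega>. (\<integral>\<^sup>+z. ?E N \<omega> (fst z) * ?E P \<omega> (snd z) \<partial>(torusM \<Otimes>\<^sub>M torusM)) \<partial>M)"
    by (rule nn_integral_cmult) (rule TT.borel_measurable_nn_integral[OF pm])
  also have "(\<integral>\<^sup>+\<omega>. (\<integral>\<^sup>+z. ?E N \<omega> (fst z) * ?E P \<omega> (snd z) \<partial>(torusM \<Otimes>\<^sub>M torusM)) \<partial>M)
     = (\<integral>\<^sup>+z. (\<integral>\<^sup>+\<omega>. ?E N \<omega> (fst z) * ?E P \<omega> (snd z) \<partial>M) \<partial>(torusM \<Otimes>\<^sub>M torusM))"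
    using Fubini'[OF pm] by simp
  \<comment> \<open>By the choice of \<open>C_N\<close>, the exponential of the two diagonal
    variances is the inverse of the product of the renormalization constants.\<close>
  also have "\<dots> = (\<integral>\<^sup>+z. inverse ?C * ennreal (exp (\<beta>\<^sup>2 * cov_kernel \<rho> N P (fst z - snd z))) \<partial>(torusM \<Otimes>\<^sub>M torusM))"
  proof (rule nn_integral_cong)
    fix z
    have "(\<integral>\<^sup>+\<omega>. ?E N \<omega> (fst z) * ?E P \<omega> (snd z) \<partial>M) =
        ennreal (exp (\<beta>\<^sup>2 / 2 * sigma_N \<rho> N + \<beta>\<^sup>2 / 2 * sigma_N \<rho> P + \<beta>\<^sup>2 * cov_kernel \<rho> N P (fst z - snd z)))"
      unfolding mollified_field_mgf[OF N P, symmetric] by (simp add: exp_add ennreal_mult)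
    also have "exp (\<beta>\<^sup>2 / 2 * sigma_N \<rho> N + \<beta>\<^sup>2 / 2 * sigma_N \<rho> P + \<beta>\<^sup>2 * cov_kernel \<rho> N P (fst z - snd z))
        = inverse (C_N \<rho> \<beta> N * C_N \<rho> \<beta> P) * exp (\<beta>\<^sup>2 * cov_kernel \<rho> N P (fst z - snd z))"
      by (simp add: C_N_def exp_add[symmetric] exp_minus[symmetric])
    finally have f: "(\<integral>\<^sup>+\<omega>. ?E N \<omega> (fst z) * ?E P \<omega> (snd z) \<partial>M) =
        ennreal (inverse (C_N \<rho> \<beta> N * C_N \<rho> \<beta> P) * exp (\<beta>\<^sup>2 * cov_kernel \<rho> N P (fst z - snd z)))" .
    have c: "0 < C_N \<rho> \<beta> N * C_N \<rho> \<beta> P" using C_N_pos[of \<beta> N] C_N_pos[of \<beta> P] by simp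
    show "(\<integral>\<^sup>+\<omega>. ?E N \<omega> (fst z) * ?E P \<omega> (snd z) \<partial>M) = inverse ?C * ennreal (exp (\<beta>\<^sup>2 * cov_kernel \<rho> N P (fst z - snd z)))"
      unfolding f inverse_ennreal[OF c] by (rule ennreal_mult) (use c in \<open>simp_all only: inverse_nonnegative_iff_nonnegative less_imp_le exp_ge_zero\<close>)
  qed
  also have "\<dots> = inverse ?C * (\<integral>\<^sup>+z. ennreal (exp (\<beta>\<^sup>2 * cov_kernel \<rho> N P (fst z - snd z))) \<partial>(torusM \<Otimes>\<^sub>M torusM))"
  proof (rule nn_integral_cmult)
    have "(\<lambda>z. exp (\<beta>\<^sup>2 * cov_kernel \<rho> N P (fst z - snd z))) \<in> borel_measurable borel"
      by (intro borel_measurable_continuous_onI continuous_on_compose2[OF kcont] continuous_intros) auto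
    then show "(\<lambda>z. ennreal (exp (\<beta>\<^sup>2 * cov_kernel \<rho> N P (fst z - snd z)))) \<in> borel_measurable (torusM \<Otimes>\<^sub>M torusM)"
      unfolding measurable_cong_sets[OF sets_torusM_pair refl] by measurable
  qed
  also have "(\<integral>\<^sup>+z. ennreal (exp (\<beta>\<^sup>2 * cov_kernel \<rho> N P (fst z - snd z))) \<partial>(torusM \<Otimes>\<^sub>M torusM))
      = (\<integral>\<^sup>+x. (\<integral>\<^sup>+y. ennreal (exp (\<beta>\<^sup>2 * cov_kernel \<rho> N P (x - y))) \<partial>torusM) \<partial>torusM)"
  proof (subst torusM.nn_integral_fst[symmetric])
    have "(\<lambda>z. exp (\<beta>\<^sup>2 * cov_kernel \<rho> N P (fst z - snd z))) \<in> borel_measurable borel"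
      by (intro borel_measurable_continuous_onI continuous_on_compose2[OF kcont] continuous_intros) auto
    then show "(\<lambda>z. ennreal (exp (\<beta>\<^sup>2 * cov_kernel \<rho> N P (fst z - snd z)))) \<in> borel_measurable (torusM \<Otimes>\<^sub>M torusM)"
      unfolding measurable_cong_sets[OF sets_torusM_pair refl] by measurable
  qed simp
  also have "\<dots> = (\<integral>\<^sup>+x. ennreal (cov_energy \<rho> (\<beta>\<^sup>2) N P) \<partial>torusM)"
  proof (rule nn_integral_cong)
    fix x
    obtain B where B: "\<And>z. norm (exp (\<beta>\<^sup>2 * cov_kernel \<rho> N P z)) \<le> B" using torus_periodic_bounded[OF kper kcont] by blast
    have m: "(\<lambda>y. exp (\<beta>\<^sup>2 * cov_kernel \<rho> N P (x - y))) \<in> borel_measurable borel"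
      by (intro borel_measurable_continuous_onI continuous_on_compose2[OF kcont] continuous_intros) auto
    have "integrable torusM (\<lambda>y. exp (\<beta>\<^sup>2 * cov_kernel \<rho> N P (x - y)))"
      by (rule torusM.integrable_const_bound[of _ B]) (use B m in auto)
    then have "(\<integral>\<^sup>+y. ennreal (exp (\<beta>\<^sup>2 * cov_kernel \<rho> N P (x - y))) \<partial>torusM) = ennreal (\<integral>y. exp (\<beta>\<^sup>2 * cov_kernel \<rho> N P (x - y)) \<partial>torusM)"
      by (rule nn_integral_eq_integral) simp
    also have "(\<integral>y. exp (\<beta>\<^sup>2 * cov_kernel \<rho> N P (x - y)) \<partial>torusM) = cov_energy \<rho> (\<beta>\<^sup>2) N P"
      unfolding cov_energy_def[OF profile] by (rule integral_torusM_shift(2)[OF kcont kper])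
    finally show "(\<integral>\<^sup>+y. ennreal (exp (\<beta>\<^sup>2 * cov_kernel \<rho> N P (x - y))) \<partial>torusM) = ennreal (cov_energy \<rho> (\<beta>\<^sup>2) N P)" .
  qed
  also have "\<dots> = ennreal (4 * pi\<^sup>2 * cov_energy \<rho> (\<beta>\<^sup>2) N P)"
    by (simp add: emeasure_torusM ennreal_mult''[symmetric] mult.commute)
  also have "?C * (inverse ?C * ennreal (4 * pi\<^sup>2 * cov_energy \<rho> (\<beta>\<^sup>2) N P)) = ennreal (4 * pi\<^sup>2 * cov_energy \<rho> (\<beta>\<^sup>2) N P)"
  proof -
    have C: "0 < C_N \<rho> \<beta> N * C_N \<rho> \<beta> P" using C_N_pos[of \<beta> N] C_N_pos[of \<beta> P] by simp
    then have "?C * inverse ?C = 1"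
      by (simp only: inverse_ennreal ennreal_mult[symmetric] less_imp_le inverse_nonnegative_iff_nonnegative
          right_inverse[OF less_imp_neq[OF C, symmetric]] ennreal_1)
    then show ?thesis by (simp only: mult.assoc[symmetric] mult_1_left)
  qed
  finally have nn: "(\<integral>\<^sup>+u. ennreal (chaos_mass \<beta> N u * chaos_mass \<beta> P u) \<partial>massive_gff M g) = ennreal (4 * pi\<^sup>2 * cov_energy \<rho> (\<beta>\<^sup>2) N P)" .
  have meas: "(\<lambda>u. chaos_mass \<beta> N u * chaos_mass \<beta> P u) \<in> borel_measurable (massive_gff M g)"
    unfolding measurable_cong_sets[OF sets_massive_gff refl]
    by (intro borel_measurable_times chaos_mass_measurable N P)
  have nonneg: "0 \<le> chaos_mass \<beta> N u * chaos_mass \<beta> P u" for u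
    by (intro mult_nonneg_nonneg chaos_mass_nonneg)
  show int: "integrable (massive_gff M g) (\<lambda>u. chaos_mass \<beta> N u * chaos_mass \<beta> P u)"
    by (rule integrableI_nonneg) (use meas nonneg nn in auto)
  have "0 \<le> cov_energy \<rho> (\<beta>\<^sup>2) N P" unfolding cov_energy_def[OF profile] by (rule integral_nonneg_AE) simp
  then show "(\<integral>u. chaos_mass \<beta> N u * chaos_mass \<beta> P u \<partial>massive_gff M g) = 4 * pi\<^sup>2 * cov_energy \<rho> (\<beta>\<^sup>2) N P"
    using nn nonneg by (subst integral_eq_nn_integral) (use meas in auto)
qed

end

theorem proposition1p4:
  fixes M :: "'a measure" and g :: "int \<times> int \<Rightarrow> 'a \<Rightarrow> complex"
    and \<rho> :: "real \<times> real \<Rightarrow> real" and lam \<beta> :: real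
  assumes "gaussian_family M g"
    and "mollifier_profile \<rho>"
    and "lam > 0"
    and "0 < \<beta>\<^sup>2" and "\<beta>\<^sup>2 < 4 * pi"
  shows "\<exists>\<rho>_heat. prob_space \<rho>_heat \<and> sets \<rho>_heat = sets (massive_gff M g) \<and>
           (\<lambda>N. tv_dist (rho_heat_N (massive_gff M g) \<rho> lam \<beta> N) \<rho>_heat) \<longlonglongrightarrow> 0 \<and>
           absolutely_continuous (massive_gff M g) \<rho>_heat \<and>
           absolutely_continuous \<rho>_heat (massive_gff M g)"
proof -
  let ?\<mu> = "massive_gff M g"
  \<comment> \<open>Indices start at \<open>1\<close>: \<open>mollifier \<rho> 0\<close> is the zero function.\<close>
  let ?Y = "\<lambda>N. chaos_mass \<rho> \<beta> (Suc N)" and ?W = "\<lambda>N. gibbs_weight \<rho> lam \<beta> (Suc N)"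
  note second = chaos_mass_second_moment[OF assms(1,2)]
  have "\<exists>\<nu>. prob_space \<nu> \<and> sets \<nu> = sets ?\<mu> \<and>
     (\<lambda>N. tv_dist (density ?\<mu> (\<lambda>u. ennreal (inverse (\<integral>u. ?W N u \<partial>?\<mu>) * ?W N u))) \<nu>) \<longlonglongrightarrow> 0 \<and>
     absolutely_continuous ?\<mu> \<nu> \<and> absolutely_continuous \<nu> ?\<mu>"
  proof (rule gibbs_limit[where Y = ?Y and lam = lam])
    show "prob_space ?\<mu>" by (rule prob_space_massive_gff[OF assms(1,2)])
    show "?Y N \<in> borel_measurable ?\<mu>" for N
      unfolding measurable_cong_sets[OF sets_massive_gff[OF assms(1,2)] refl]
      by (rule chaos_mass_measurable[OF assms(1,2)]) simp
    show "0 \<le> ?Y N u" for N u by (rule chaos_mass_nonneg[OF assms(1,2)])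
    show "?W N u = exp (- lam * ?Y N u)" if "u \<in> space ?\<mu>" for N u
      using that by (intro gibbs_weight_chaos_mass[OF assms(1,2)]) (auto simp: space_massive_gff[OF assms(1,2)])
    show "0 \<le> ?W N u" for N u by (simp add: gibbs_weight_def)
    show "integrable ?\<mu> (\<lambda>u. ?Y N u * ?Y P u)" for N P by (rule second(1)) auto
    show "\<exists>N0. \<forall>N\<ge>N0. \<forall>P\<ge>N0. \<forall>Q\<ge>N0. \<bar>(\<integral>u. ?Y N u * ?Y P u \<partial>?\<mu>) - (\<integral>u. ?Y N u * ?Y Q u \<partial>?\<mu>)\<bar> \<le> e"
      if e: "e > 0" for e
    proof -
      have "e / (4 * pi\<^sup>2) > 0" using e by simp
      from cov_energy_close[OF assms(2) _ assms(5) this] obtain N0 where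
        N0: "\<forall>N\<ge>N0. \<forall>P\<ge>N0. \<forall>Q\<ge>N0. \<bar>cov_energy \<rho> (\<beta>\<^sup>2) N P - cov_energy \<rho> (\<beta>\<^sup>2) N Q\<bar> \<le> e / (4 * pi\<^sup>2)" by auto
      show ?thesis
      proof (intro exI[of _ N0] allI impI)
        fix N P Q assume "N0 \<le> N" "N0 \<le> P" "N0 \<le> Q"
        then have "\<bar>cov_energy \<rho> (\<beta>\<^sup>2) (Suc N) (Suc P) - cov_energy \<rho> (\<beta>\<^sup>2) (Suc N) (Suc Q)\<bar> \<le> e / (4 * pi\<^sup>2)"
          using N0 by simp
        then have "4 * pi\<^sup>2 * \<bar>cov_energy \<rho> (\<beta>\<^sup>2) (Suc N) (Suc P) - cov_energy \<rho> (\<beta>\<^sup>2) (Suc N) (Suc Q)\<bar> \<le> e"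
          by (simp add: field_simps)
        moreover have "\<bar>4 * pi\<^sup>2 * s - 4 * pi\<^sup>2 * t\<bar> = 4 * pi\<^sup>2 * \<bar>s - t\<bar>" for s t :: real
          by (simp add: abs_mult flip: right_diff_distrib)
        ultimately show "\<bar>(\<integral>u. ?Y N u * ?Y P u \<partial>?\<mu>) - (\<integral>u. ?Y N u * ?Y Q u \<partial>?\<mu>)\<bar> \<le> e"
          by (simp add: second(2))
      qed
    qed
  qed (rule assms(3))
  then obtain \<nu> where \<nu>: "prob_space \<nu>" "sets \<nu> = sets ?\<mu>"
    "(\<lambda>N. tv_dist (rho_heat_N ?\<mu> \<rho> lam \<beta> (Suc N)) \<nu>) \<longlonglongrightarrow> 0"
    "absolutely_continuous ?\<mu> \<nu>" "absolutely_continuous \<nu> ?\<mu>"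
    unfolding rho_heat_N_def Z_N_def by blast
  then show ?thesis using LIMSEQ_imp_Suc[OF \<nu>(3)] by blast
qed

end
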